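(* Let $k$ be a field of characteristic zero and let $n$ be a natural number. Let $(C_n,\lambda_n)$ be the initial commutative $n$-algebra over $k$, and let $S(T_n)$ be the symmetric algebra on the set of $n$-coloured trees, that is, on the $k$-vector space $T_n$ spanned by this set. Then there is a natural algebra isomorphism between $C_n$ and $S(T_n)$.
   Context: Algebras are associative algebras with unit over $k$. A commutative $n$-algebra is a pair $(A,\alpha)$ consisting of a commutative algebra $A$ and a linear map $\alpha:A^{\otimes n}\to A$. A morphism of $n$-algebras $f:(A,\alpha)\to(B,\beta)$ is an algebra homomorphism $f:A\to B$ such that $\beta\circ f^{\otimes n}=f\circ\alpha$. The category of these $n$-algebras is denoted $\mathcal{C}_n$. It has an initial object (the free $n$-algebra on the empty set of generators), denoted $(C_n,\lambda_n)$ and characterised up to isomorphism by the property that any $n$-algebra $(A,\alpha)$ admits a unique morphism $(C_n,\lambda_n)\to(A,\alpha)$. A rooted tree is an isomorphism class of finite partially ordered sets which have a minimal element $r$ (with $r<x$ for all $x\neq r$), called the root, and which satisfy the tree condition that $y\neq z$, $y<x$ and $z<x$ imply $y<z$ or $z<y$. The elements of a tree are called vertices. A pair of vertices $v<w$ is called an edge if there is no vertex $x$ such that $v<x<w$. An $n$-coloured tree is an isomorphism class of such posets equipped with a function from the set of edges to the set of colours $\{1,\dots,n\}$, where isomorphisms are required to respect the colours. $T_n$ denotes the $k$-vector space spanned by the set of $n$-coloured trees, and $S(T_n)$ is the symmetric algebra on it. *)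

theory Defs
  imports "HOL-Algebra.QuotRing" "HOL-Algebra.Module" "HOL-Library.FuncSet" "HOL-Library.Multiset"
begin

section \<open>Linear algebra over a commutative ring\<close>

definition characteristic_zero :: "('k, 'm) ring_scheme \<Rightarrow> bool" where
  "characteristic_zero K \<longleftrightarrow>
     (\<forall>m::nat. m > 0 \<longrightarrow> [m] \<cdot>\<^bsub>K\<^esub> \<one>\<^bsub>K\<^esub> \<noteq> \<zero>\<^bsub>K\<^esub>)"

definition linear_maps ::
    "('k, 'm) ring_scheme \<Rightarrow> ('k, 'a) module \<Rightarrow> ('k, 'b) module \<Rightarrow> ('a \<Rightarrow> 'b) set" where
  "linear_maps K M N = {f. f \<in> carrier M \<rightarrow> carrier N \<and>
     (\<forall>x\<in>carrier M. \<forall>y\<in>carrier M. f (x \<oplus>\<^bsub>M\<^esub> y) = f x \<oplus>\<^bsub>N\<^esub> f y) \<and>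
     (\<forall>c\<in>carrier K. \<forall>x\<in>carrier M. f (c \<odot>\<^bsub>M\<^esub> x) = c \<odot>\<^bsub>N\<^esub> f x)}"

text \<open>The ring multiplication and unit that every \<^typ>\<open>('k, 'a) module\<close> record carries
  are left unspecified in \<open>free_module\<close>, as they are for any plain module.\<close>

definition free_module :: "('k, 'm) ring_scheme \<Rightarrow> 'x set \<Rightarrow> ('k, 'x \<Rightarrow> 'k) module" where
  "free_module K X =
     \<lparr>carrier = {f. (\<forall>x. f x \<in> carrier K) \<and> (\<forall>x. x \<notin> X \<longrightarrow> f x = \<zero>\<^bsub>K\<^esub>) \<and>
                    finite {x. f x \<noteq> \<zero>\<^bsub>K\<^esub>}},
      monoid.mult = undefined, one = undefined,
      zero = (\<lambda>_. \<zero>\<^bsub>K\<^esub>), add = (\<lambda>f g x. f x \<oplus>\<^bsub>K\<^esub> g x),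
      smult = (\<lambda>c f x. c \<otimes>\<^bsub>K\<^esub> f x)\<rparr>"

definition basis_vec :: "('k, 'm) ring_scheme \<Rightarrow> 'x \<Rightarrow> ('x \<Rightarrow> 'k)" where
  "basis_vec K x = (\<lambda>y. if y = x then \<one>\<^bsub>K\<^esub> else \<zero>\<^bsub>K\<^esub>)"

definition span_in ::
    "('k, 'm) ring_scheme \<Rightarrow> ('k, 'a) module \<Rightarrow> 'a set \<Rightarrow> 'a set" where
  "span_in K M S = \<Inter>{N. submodule N K M \<and> S \<subseteq> N}"

text \<open>The quotient by a submodule, and also the quotient of an algebra by an ideal:
  the ring part is that of \<^const>\<open>FactRing\<close>, whose multiplication is meaningful
  only in the second case. The union in the scalar multiplication is over equal cosets.\<close>

definition quotient_module :: "('k, 'a) module \<Rightarrow> 'a set \<Rightarrow> ('k, 'a set) module" where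
  "quotient_module M N =
     \<lparr>carrier = carrier (M Quot N), monoid.mult = monoid.mult (M Quot N), one = one (M Quot N),
      zero = zero (M Quot N), add = add (M Quot N),
      smult = (\<lambda>c X. \<Union>x\<in>X. N +>\<^bsub>M\<^esub> (c \<odot>\<^bsub>M\<^esub> x))\<rparr>"

section \<open>Tensor powers\<close>

text \<open>The \<open>n\<close>-th tensor power of \<open>M\<close> is the free module on the \<open>n\<close>-tuples of elements
  of \<open>M\<close>, indexed by \<open>{1..n}\<close>, modulo the relations of multilinearity. For \<open>n = 0\<close>
  there is one tuple and no relation, so it is free of rank one.\<close>

type_synonym ('k, 'a) tensor = "((nat \<Rightarrow> 'a) \<Rightarrow> 'k) set"

definition tuples :: "nat \<Rightarrow> ('k, 'a) module \<Rightarrow> (nat \<Rightarrow> 'a) set" where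
  "tuples n M = ({1..n} \<rightarrow>\<^sub>E carrier M)"

definition tensor_relations ::
    "('k, 'm) ring_scheme \<Rightarrow> nat \<Rightarrow> ('k, 'a) module \<Rightarrow> ((nat \<Rightarrow> 'a) \<Rightarrow> 'k) set" where
  "tensor_relations K n M = (let F = free_module K (tuples n M); e = basis_vec K in
     {e (a(i := x \<oplus>\<^bsub>M\<^esub> y)) \<ominus>\<^bsub>F\<^esub> (e (a(i := x)) \<oplus>\<^bsub>F\<^esub> e (a(i := y))) | a i x y.
        a \<in> tuples n M \<and> i \<in> {1..n} \<and> x \<in> carrier M \<and> y \<in> carrier M}
     \<union> {e (a(i := c \<odot>\<^bsub>M\<^esub> x)) \<ominus>\<^bsub>F\<^esub> c \<odot>\<^bsub>F\<^esub> e (a(i := x)) | a i c x.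
        a \<in> tuples n M \<and> i \<in> {1..n} \<and> c \<in> carrier K \<and> x \<in> carrier M})"

definition tensor_power ::
    "('k, 'm) ring_scheme \<Rightarrow> nat \<Rightarrow> ('k, 'a) module \<Rightarrow> ('k, ('k, 'a) tensor) module" where
  "tensor_power K n M = (let F = free_module K (tuples n M) in
     quotient_module F (span_in K F (tensor_relations K n M)))"

definition pure_tensor ::
    "('k, 'm) ring_scheme \<Rightarrow> nat \<Rightarrow> ('k, 'a) module \<Rightarrow> (nat \<Rightarrow> 'a) \<Rightarrow> ('k, 'a) tensor" where
  "pure_tensor K n M a = (let F = free_module K (tuples n M) in
     span_in K F (tensor_relations K n M) +>\<^bsub>F\<^esub> basis_vec K a)"

definition tensor_power_map ::
    "('k, 'm) ring_scheme \<Rightarrow> nat \<Rightarrow> ('k, 'a) module \<Rightarrow> ('k, 'b) module \<Rightarrow>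
     ('a \<Rightarrow> 'b) \<Rightarrow> ('k, 'a) tensor \<Rightarrow> ('k, 'b) tensor" where
  "tensor_power_map K n M N f =
     (THE g. g \<in> linear_maps K (tensor_power K n M) (tensor_power K n N) \<and>
             g \<in> extensional (carrier (tensor_power K n M)) \<and>
             (\<forall>a\<in>tuples n M.
                g (pure_tensor K n M a) = pure_tensor K n N (\<lambda>i\<in>{1..n}. f (a i))))"

section \<open>Commutative \<open>n\<close>-algebras\<close>

text \<open>The locale \<^locale>\<open>algebra\<close> is about commutative algebras with unit.\<close>

definition algebra_hom ::
    "('k, 'm) ring_scheme \<Rightarrow> ('k, 'a) module \<Rightarrow> ('k, 'b) module \<Rightarrow> ('a \<Rightarrow> 'b) set" where
  "algebra_hom K A B = ring_hom A B \<inter> linear_maps K A B"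

definition algebra_iso ::
    "('k, 'm) ring_scheme \<Rightarrow> ('k, 'a) module \<Rightarrow> ('k, 'b) module \<Rightarrow> ('a \<Rightarrow> 'b) set" where
  "algebra_iso K A B = {f \<in> algebra_hom K A B. bij_betw f (carrier A) (carrier B)}"

definition n_algebra ::
    "('k, 'm) ring_scheme \<Rightarrow> nat \<Rightarrow> ('k, 'a) module \<Rightarrow> (('k, 'a) tensor \<Rightarrow> 'a) \<Rightarrow> bool" where
  "n_algebra K n A \<alpha> \<longleftrightarrow> algebra K A \<and> \<alpha> \<in> linear_maps K (tensor_power K n A) A"

definition n_algebra_hom ::
    "('k, 'm) ring_scheme \<Rightarrow> nat \<Rightarrow> ('k, 'a) module \<Rightarrow> (('k, 'a) tensor \<Rightarrow> 'a) \<Rightarrow>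
     ('k, 'b) module \<Rightarrow> (('k, 'b) tensor \<Rightarrow> 'b) \<Rightarrow> ('a \<Rightarrow> 'b) set" where
  "n_algebra_hom K n A \<alpha> B \<beta> = {f \<in> algebra_hom K A B.
     \<forall>x\<in>carrier (tensor_power K n A). \<beta> (tensor_power_map K n A B f x) = f (\<alpha> x)}"

text \<open>A formula cannot quantify over types, so initiality is expressed relative to the
  \<open>n\<close>-algebras whose elements are taken from a given type \<open>'b\<close>. An initial object of the
  category of all \<open>n\<close>-algebras satisfies this for every \<open>'b\<close>. Morphisms are identified
  when they agree on the carrier.\<close>

definition initial_n_algebra ::
    "'b itself \<Rightarrow> ('k, 'm) ring_scheme \<Rightarrow> nat \<Rightarrow> ('k, 'c) module \<Rightarrow>
     (('k, 'c) tensor \<Rightarrow> 'c) \<Rightarrow> bool" where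
  "initial_n_algebra _ K n C \<gamma> \<longleftrightarrow> n_algebra K n C \<gamma> \<and>
     (\<forall>(A :: ('k, 'b) module) \<alpha>. n_algebra K n A \<alpha> \<longrightarrow>
        (\<exists>!f. f \<in> n_algebra_hom K n C \<gamma> A \<alpha> \<and> f \<in> extensional (carrier C)))"

section \<open>Symmetric algebras\<close>

text \<open>The polynomial algebra on a set of variables; monomials are multisets.\<close>

definition poly_algebra ::
    "('k, 'm) ring_scheme \<Rightarrow> 'x set \<Rightarrow> ('k, 'x multiset \<Rightarrow> 'k) module" where
  "poly_algebra K X = (free_module K {m. set_mset m \<subseteq> X})
     \<lparr>monoid.mult := (\<lambda>f g m. \<Oplus>\<^bsub>K\<^esub>a\<in>{a. a \<subseteq># m}. f a \<otimes>\<^bsub>K\<^esub> g (m - a)),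
      one := basis_vec K {#}\<rparr>"

text \<open>The symmetric algebra of \<open>V\<close> is the commutative algebra generated by the elements
  of \<open>V\<close> subject to the relations saying that the inclusion of \<open>V\<close> is linear. The
  commutators are already divided out in the polynomial algebra.\<close>

definition symmetric_relations ::
    "('k, 'm) ring_scheme \<Rightarrow> ('k, 'v) module \<Rightarrow> ('v multiset \<Rightarrow> 'k) set" where
  "symmetric_relations K V =
     (let P = poly_algebra K (carrier V); X = (\<lambda>v. basis_vec K {#v#}) in
     {X (v \<oplus>\<^bsub>V\<^esub> w) \<ominus>\<^bsub>P\<^esub> (X v \<oplus>\<^bsub>P\<^esub> X w) | v w. v \<in> carrier V \<and> w \<in> carrier V}
     \<union> {X (c \<odot>\<^bsub>V\<^esub> v) \<ominus>\<^bsub>P\<^esub> c \<odot>\<^bsub>P\<^esub> X v | c v. c \<in> carrier K \<and> v \<in> carrier V})"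

definition symmetric_algebra ::
    "('k, 'm) ring_scheme \<Rightarrow> ('k, 'v) module \<Rightarrow> ('k, ('v multiset \<Rightarrow> 'k) set) module" where
  "symmetric_algebra K V = (let P = poly_algebra K (carrier V) in
     quotient_module P (Idl\<^bsub>P\<^esub> (symmetric_relations K V)))"

definition symmetric_incl ::
    "('k, 'm) ring_scheme \<Rightarrow> ('k, 'v) module \<Rightarrow> 'v \<Rightarrow> ('v multiset \<Rightarrow> 'k) set" where
  "symmetric_incl K V v = (let P = poly_algebra K (carrier V) in
     (Idl\<^bsub>P\<^esub> (symmetric_relations K V)) +>\<^bsub>P\<^esub> basis_vec K {#v#})"

section \<open>Coloured trees\<close>

text \<open>Every finite poset is isomorphic to one whose underlying set consists of natural
  numbers, so isomorphism classes are taken among those. Values of \<open>colour\<close> outside the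
  set of edges are irrelevant.\<close>

record coloured_poset =
  vertices :: "nat set"
  leq :: "nat rel"
  colour :: "nat \<times> nat \<Rightarrow> nat"

definition less_in :: "coloured_poset \<Rightarrow> nat \<Rightarrow> nat \<Rightarrow> bool" where
  "less_in P x y \<longleftrightarrow> (x, y) \<in> leq P \<and> x \<noteq> y"

definition edges :: "coloured_poset \<Rightarrow> (nat \<times> nat) set" where
  "edges P = {(v, w). less_in P v w \<and> \<not> (\<exists>x. less_in P v x \<and> less_in P x w)}"

definition is_root :: "coloured_poset \<Rightarrow> nat \<Rightarrow> bool" where
  "is_root P r \<longleftrightarrow> r \<in> vertices P \<and> (\<forall>x\<in>vertices P. x \<noteq> r \<longrightarrow> less_in P r x)"

definition coloured_tree_poset :: "nat \<Rightarrow> coloured_poset \<Rightarrow> bool" where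
  "coloured_tree_poset n P \<longleftrightarrow>
     finite (vertices P) \<and> partial_order_on (vertices P) (leq P) \<and>
     (\<exists>r. is_root P r) \<and>
     (\<forall>x y z. y \<noteq> z \<and> less_in P y x \<and> less_in P z x \<longrightarrow> less_in P y z \<or> less_in P z y) \<and>
     (\<forall>e\<in>edges P. colour P e \<in> {1..n})"

definition coloured_poset_iso :: "coloured_poset \<Rightarrow> coloured_poset \<Rightarrow> bool" where
  "coloured_poset_iso P Q \<longleftrightarrow> (\<exists>h. bij_betw h (vertices P) (vertices Q) \<and>
     (\<forall>x\<in>vertices P. \<forall>y\<in>vertices P. (x, y) \<in> leq P \<longleftrightarrow> (h x, h y) \<in> leq Q) \<and>
     (\<forall>(v, w)\<in>edges P. colour Q (h v, h w) = colour P (v, w)))"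

type_synonym coloured_tree = "coloured_poset set"

definition tree_class :: "nat \<Rightarrow> coloured_poset \<Rightarrow> coloured_tree" where
  "tree_class n P = {Q. coloured_tree_poset n Q \<and> coloured_poset_iso P Q}"

definition coloured_trees :: "nat \<Rightarrow> coloured_tree set" where
  "coloured_trees n = {tree_class n P | P. coloured_tree_poset n P}"

definition tree_space ::
    "('k, 'm) ring_scheme \<Rightarrow> nat \<Rightarrow> ('k, coloured_tree \<Rightarrow> 'k) module" where
  "tree_space K n = free_module K (coloured_trees n)"

type_synonym 'k tree_poly = "((coloured_tree \<Rightarrow> 'k) multiset \<Rightarrow> 'k) set"

definition sym_trees ::
    "('k, 'm) ring_scheme \<Rightarrow> nat \<Rightarrow> ('k, 'k tree_poly) module" where
  "sym_trees K n = symmetric_algebra K (tree_space K n)"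

definition tree_gen ::
    "('k, 'm) ring_scheme \<Rightarrow> nat \<Rightarrow> coloured_poset \<Rightarrow> 'k tree_poly" where
  "tree_gen K n P = symmetric_incl K (tree_space K n) (basis_vec K (tree_class n P))"

text \<open>\<open>branches K n P i\<close> is the forest of those branches at the root of \<open>P\<close> that are
  joined to the root by an edge of colour \<open>i\<close>, as a monomial of the symmetric algebra.\<close>

definition children :: "coloured_poset \<Rightarrow> nat \<Rightarrow> nat set" where
  "children P i = {w. \<exists>r. is_root P r \<and> (r, w) \<in> edges P \<and> colour P (r, w) = i}"

definition subtree_at :: "coloured_poset \<Rightarrow> nat \<Rightarrow> coloured_poset" where
  "subtree_at P w = (let U = {x \<in> vertices P. (w, x) \<in> leq P} in
     \<lparr>vertices = U, leq = leq P \<inter> U \<times> U, colour = colour P\<rparr>)"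

definition branches ::
    "('k, 'm) ring_scheme \<Rightarrow> nat \<Rightarrow> coloured_poset \<Rightarrow> nat \<Rightarrow> 'k tree_poly" where
  "branches K n P i =
     (\<Otimes>\<^bsub>sym_trees K n\<^esub>w\<in>children P i. tree_gen K n (subtree_at P w))"

text \<open>What makes an isomorphism to the symmetric algebra on trees the natural one: the
  operation \<open>\<gamma>\<close> corresponds to grafting, i.e. applied to forests it joins them to a new
  root, the trees of the \<open>i\<close>-th forest by edges of colour \<open>i\<close>. Every tree \<open>P\<close> arises so
  from exactly one tuple of forests, namely its own branches.\<close>

definition takes_to_grafting ::
    "('k, 'm) ring_scheme \<Rightarrow> nat \<Rightarrow> ('k, 'c) module \<Rightarrow> (('k, 'c) tensor \<Rightarrow> 'c) \<Rightarrow>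
     ('c \<Rightarrow> 'k tree_poly) \<Rightarrow> bool" where
  "takes_to_grafting K n C \<gamma> \<phi> \<longleftrightarrow>
     (\<forall>P a. coloured_tree_poset n P \<longrightarrow> a \<in> tuples n C \<longrightarrow>
        (\<forall>i\<in>{1..n}. \<phi> (a i) = branches K n P i) \<longrightarrow>
        \<phi> (\<gamma> (pure_tensor K n C a)) = tree_gen K n P)"

end

theory Submission
  imports Defs "HOL-Library.Nat_Bijection"
begin

text \<open>A tree with edges coloured by \<open>1, \<dots>, n\<close> is the same thing as the \<open>n\<close>-tuple of forests of its
  branches at the root, and the forests are the monomials of \<open>S(T\<^sub>n)\<close>. Sending a tuple of forests
  to the tree that it forms therefore extends to a multilinear operation on \<open>S(T\<^sub>n)\<close>, grafting.
  With it, \<open>S(T\<^sub>n)\<close> is an initial \<open>n\<close>-algebra: a morphism to \<open>(A, \<alpha>)\<close> has to send a tree to the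
  value of \<open>\<alpha>\<close> on the products of the images of its branches, and this recursion on the number of
  vertices determines the images of the generators, which can be prescribed freely. The
  isomorphism is the comparison of two initial objects.\<close>

section \<open>Linear maps\<close>

text \<open>Two points shape the work. An operation on \<open>S(T\<^sub>n)\<close> is prescribed by
  its values on tuples of forests, which is legitimate only if the forest monomials form a basis.
  The presentation of the symmetric algebra, generated by all vectors modulo linearity, does not
  show this, so it is identified with a polynomial algebra, where independence of the monomials is
  built in. And initiality of \<open>C\<close> speaks of one type of elements at a time: at the type
  of \<open>S(T\<^sub>n)\<close> it yields the map to the trees, at the type of \<open>C\<close> the
  uniqueness that makes one composite the identity. Initiality of \<open>S(T\<^sub>n)\<close>, by
  contrast, is obtained for \<open>n\<close>-algebras over any type and supplies the map back.
  Tensor powers and symmetric algebras are entered through their universal properties, so that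
  identities between linear or multilinear maps can be checked on spanning sets.\<close>

lemma linear_maps_closed: "f \<in> linear_maps K M N \<Longrightarrow> x \<in> carrier M \<Longrightarrow> f x \<in> carrier N"
  and linear_maps_add: "f \<in> linear_maps K M N \<Longrightarrow> x \<in> carrier M \<Longrightarrow> y \<in> carrier M \<Longrightarrow>
    f (x \<oplus>\<^bsub>M\<^esub> y) = f x \<oplus>\<^bsub>N\<^esub> f y"
  and linear_maps_smult: "f \<in> linear_maps K M N \<Longrightarrow> c \<in> carrier K \<Longrightarrow> x \<in> carrier M \<Longrightarrow>
    f (c \<odot>\<^bsub>M\<^esub> x) = c \<odot>\<^bsub>N\<^esub> f x"
  by (auto simp: linear_maps_def)

lemma linear_mapsI:
  assumes "\<And>x. x \<in> carrier M \<Longrightarrow> f x \<in> carrier N"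
    and "\<And>x y. x \<in> carrier M \<Longrightarrow> y \<in> carrier M \<Longrightarrow> f (x \<oplus>\<^bsub>M\<^esub> y) = f x \<oplus>\<^bsub>N\<^esub> f y"
    and "\<And>c x. c \<in> carrier K \<Longrightarrow> x \<in> carrier M \<Longrightarrow> f (c \<odot>\<^bsub>M\<^esub> x) = c \<odot>\<^bsub>N\<^esub> f x"
  shows "f \<in> linear_maps K M N"
  using assms by (auto simp: linear_maps_def)

text \<open>Only values on the carrier matter for membership in \<open>linear_maps\<close>; the
  module hypothesis keeps sums and multiples inside the carrier, where \<open>f\<close> and
  \<open>g\<close> agree.\<close>

lemma linear_maps_cong:
  assumes "f \<in> linear_maps K M N" "module K M" "\<And>x. x \<in> carrier M \<Longrightarrow> f x = g x"
  shows "g \<in> linear_maps K M N"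
proof -
  interpret M: module K M by fact
  show ?thesis
    using assms(1) by (auto simp: linear_maps_def Pi_iff simp flip: assms(3))
qed

lemma linear_maps_comp:
  "f \<in> linear_maps K M N \<Longrightarrow> g \<in> linear_maps K N L \<Longrightarrow> (\<lambda>x. g (f x)) \<in> linear_maps K M L"
  by (auto simp: linear_maps_def Pi_iff)

lemma linear_maps_abelian_group_hom:
  assumes "module K M" "module K N" "f \<in> linear_maps K M N"
  shows "abelian_group_hom M N f"
proof -
  interpret M: module K M by fact
  interpret N: module K N by fact
  show ?thesis
    by (intro abelian_group_homI M.abelian_group_axioms N.abelian_group_axioms
        group_hom.intro group_hom_axioms.intro M.a_group N.a_group)
      (use assms(3) in \<open>auto simp: hom_def linear_maps_def\<close>)
qed

lemma linear_maps_zero: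
  assumes "module K M" "module K N" "f \<in> linear_maps K M N"
  shows "f \<zero>\<^bsub>M\<^esub> = \<zero>\<^bsub>N\<^esub>"
  using abelian_group_hom.hom_zero[OF linear_maps_abelian_group_hom[OF assms]] .

lemma linear_maps_uminus:
  assumes "module K M" "module K N" "f \<in> linear_maps K M N" "x \<in> carrier M"
  shows "f (\<ominus>\<^bsub>M\<^esub> x) = \<ominus>\<^bsub>N\<^esub> f x"
  using abelian_group_hom.hom_a_inv[OF linear_maps_abelian_group_hom[OF assms(1-3)] assms(4)] .

lemma linear_maps_minus:
  assumes "module K M" "module K N" "f \<in> linear_maps K M N" "x \<in> carrier M" "y \<in> carrier M"
  shows "f (x \<ominus>\<^bsub>M\<^esub> y) = f x \<ominus>\<^bsub>N\<^esub> f y"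
proof -
  interpret M: module K M by fact
  interpret N: module K N by fact
  show ?thesis
    using assms(4,5) by (simp add: M.minus_eq N.minus_eq linear_maps_add[OF assms(3)]
        linear_maps_uminus[OF assms(1-3)])
qed

lemma equalizer_submodule:
  assumes "module K M" "module K N" "f \<in> linear_maps K M N" "g \<in> linear_maps K M N"
  shows "submodule {x \<in> carrier M. f x = g x} K M"
proof -
  interpret M: module K M by fact
  interpret N: module K N by fact
  show ?thesis
    by (rule M.submoduleI)
      (auto simp: linear_maps_zero[OF assms(1,2,3)] linear_maps_zero[OF assms(1,2,4)]
        linear_maps_uminus[OF assms(1,2,3)] linear_maps_uminus[OF assms(1,2,4)]
        linear_maps_add[OF assms(3)] linear_maps_add[OF assms(4)] linear_maps_smult[OF assms(3)] linear_maps_smult[OF assms(4)])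
qed

lemma vimage_submodule:
  assumes "module K M" "module K N" "f \<in> linear_maps K M N" "submodule H K N"
  shows "submodule {x \<in> carrier M. f x \<in> H} K M"
proof -
  interpret M: module K M by fact
  interpret N: module K N by fact
  note H = N.submoduleE[OF assms(4)]
  have "\<zero>\<^bsub>N\<^esub> \<in> H"
    using subgroup.one_closed[OF submodule.axioms(1)[OF assms(4)]] by simp
  then show ?thesis
    by (intro M.submoduleI)
      (auto simp: linear_maps_zero[OF assms(1,2,3)] linear_maps_uminus[OF assms(1,2,3)]
        linear_maps_add[OF assms(3)]
        linear_maps_smult[OF assms(3)] intro: H)
qed

lemma span_in_submodule:
  assumes "module K M" "S \<subseteq> carrier M"
  shows "submodule (span_in K M S) K M"
proof -
  interpret M: module K M by fact
  \<comment> \<open>The intersected family contains the whole carrier, so the intersection stays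
    inside it; over an empty family it would be the universe.\<close>
  have c: "carrier M \<in> {N. submodule N K M \<and> S \<subseteq> N}"
    using assms(2) M.carrier_is_submodule by simp
  have z: "\<zero>\<^bsub>M\<^esub> \<in> N" if "submodule N K M" for N
    using subgroup.one_closed[OF submodule.axioms(1)[OF that]] by simp
  show ?thesis
    unfolding span_in_def
    by (rule M.submoduleI) (use c in \<open>auto intro: z M.submoduleE\<close>)
qed

lemma span_in_superset: "S \<subseteq> span_in K M S"
  by (auto simp: span_in_def)

lemma span_in_least: "submodule H K M \<Longrightarrow> S \<subseteq> H \<Longrightarrow> span_in K M S \<subseteq> H"
  by (auto simp: span_in_def)

lemma span_in_subset_carrier: "module K M \<Longrightarrow> S \<subseteq> carrier M \<Longrightarrow> span_in K M S \<subseteq> carrier M"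
  by (simp add: module.carrier_is_submodule span_in_least)

text \<open>The equalizer of \<open>f\<close> and \<open>g\<close> is a submodule, so it contains
  the span as soon as it contains \<open>S\<close>. Many identities below are proved this way, once
  both sides are recognised as linear.\<close>

lemma linear_maps_eq_on_span:
  assumes "module K M" "module K N" "f \<in> linear_maps K M N" "g \<in> linear_maps K M N"
    and "span_in K M S = carrier M" "S \<subseteq> carrier M" "\<And>s. s \<in> S \<Longrightarrow> f s = g s" "x \<in> carrier M"
  shows "f x = g x"
proof -
  have "span_in K M S \<subseteq> {x \<in> carrier M. f x = g x}"
    using assms by (intro span_in_least equalizer_submodule) auto
  with assms show ?thesis by auto
qed

text \<open>The preimage of the span of the image of \<open>S\<close> is a submodule containing
  \<open>S\<close>, hence everything.\<close>

lemma span_in_image: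
  assumes "module K M" "module K N" "f \<in> linear_maps K M N" "f ` carrier M = carrier N"
    and "span_in K M S = carrier M" "S \<subseteq> carrier M"
  shows "span_in K N (f ` S) = carrier N"
proof
  have sub: "f ` S \<subseteq> carrier N" using assms(4,6) by auto
  show "span_in K N (f ` S) \<subseteq> carrier N"
    by (rule span_in_subset_carrier[OF assms(2) sub])
  have "span_in K M S \<subseteq> {x \<in> carrier M. f x \<in> span_in K N (f ` S)}"
    using assms(5,6) span_in_superset[of "f ` S" K N]
    by (intro span_in_least vimage_submodule[OF assms(1-3) span_in_submodule[OF assms(2) sub]]) auto
  with assms(5) have "f ` carrier M \<subseteq> span_in K N (f ` S)" by auto
  with assms(4) show "carrier N \<subseteq> span_in K N (f ` S)" by simp
qed

section \<open>Free modules\<close>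

lemma free_module_simps [simp]:
  "\<zero>\<^bsub>free_module K X\<^esub> = (\<lambda>_. \<zero>\<^bsub>K\<^esub>)"
  "f \<oplus>\<^bsub>free_module K X\<^esub> g = (\<lambda>x. f x \<oplus>\<^bsub>K\<^esub> g x)"
  "c \<odot>\<^bsub>free_module K X\<^esub> f = (\<lambda>x. c \<otimes>\<^bsub>K\<^esub> f x)"
  by (simp_all add: free_module_def)

lemma free_module_carrier:
  "carrier (free_module K X) = {f. (\<forall>x. f x \<in> carrier K) \<and> (\<forall>x. x \<notin> X \<longrightarrow> f x = \<zero>\<^bsub>K\<^esub>) \<and>
     finite {x. f x \<noteq> \<zero>\<^bsub>K\<^esub>}}"
  by (simp add: free_module_def)

context cring
begin

lemma free_module_add_closed:
  assumes "f \<in> carrier (free_module R X)" "g \<in> carrier (free_module R X)"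
  shows "(\<lambda>x. f x \<oplus> g x) \<in> carrier (free_module R X)"
proof -
  have "{x. f x \<oplus> g x \<noteq> \<zero>} \<subseteq> {x. f x \<noteq> \<zero>} \<union> {x. g x \<noteq> \<zero>}" by auto
  then show ?thesis
    using assms unfolding free_module_carrier by (auto intro: finite_subset)
qed

lemma free_module_smult_closed:
  assumes "f \<in> carrier (free_module R X)" "c \<in> carrier R"
  shows "(\<lambda>x. c \<otimes> f x) \<in> carrier (free_module R X)"
proof -
  have "{x. c \<otimes> f x \<noteq> \<zero>} \<subseteq> {x. f x \<noteq> \<zero>}" using assms(2) by auto
  then show ?thesis
    using assms unfolding free_module_carrier by (auto intro: finite_subset)
qed

lemma free_module_module: "module R (free_module R X)"
proof (rule moduleI)
  show "cring R" by (rule is_cring)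
  have cl: "f x \<in> carrier R" if "f \<in> carrier (free_module R X)" for f x
    using that by (auto simp: free_module_carrier)
  show "abelian_group (free_module R X)"
  proof (rule abelian_groupI)
    fix f assume f: "f \<in> carrier (free_module R X)"
    have "{x. \<ominus> f x \<noteq> \<zero>} \<subseteq> {x. f x \<noteq> \<zero>}" by auto
    then have "(\<lambda>x. \<ominus> f x) \<in> carrier (free_module R X)"
      using f unfolding free_module_carrier by (auto intro: finite_subset)
    moreover have "(\<lambda>x. \<ominus> f x) \<oplus>\<^bsub>free_module R X\<^esub> f = \<zero>\<^bsub>free_module R X\<^esub>"
      using cl[OF f] by (simp add: l_neg)
    ultimately show "\<exists>y\<in>carrier (free_module R X). y \<oplus>\<^bsub>free_module R X\<^esub> f = \<zero>\<^bsub>free_module R X\<^esub>"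
      by blast
  next
    show "\<zero>\<^bsub>free_module R X\<^esub> \<in> carrier (free_module R X)"
      by (auto simp: free_module_carrier)
  next
    fix f g h
    assume "f \<in> carrier (free_module R X)" "g \<in> carrier (free_module R X)"
      "h \<in> carrier (free_module R X)"
    then show "f \<oplus>\<^bsub>free_module R X\<^esub> g \<oplus>\<^bsub>free_module R X\<^esub> h =
        f \<oplus>\<^bsub>free_module R X\<^esub> (g \<oplus>\<^bsub>free_module R X\<^esub> h)"
      by (simp add: free_module_carrier a_assoc)
  qed (simp_all add: free_module_add_closed, simp_all add: free_module_carrier a_comm)
qed (simp_all add: free_module_smult_closed, simp_all add: free_module_carrier l_distr r_distr m_assoc)

lemma basis_vec_closed [intro]: "x \<in> X \<Longrightarrow> basis_vec R x \<in> carrier (free_module R X)"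
proof -
  assume "x \<in> X"
  moreover have "finite {y. basis_vec R x y \<noteq> \<zero>}"
    by (rule finite_subset[of _ "{x}"]) (auto simp: basis_vec_def)
  ultimately show ?thesis by (auto simp: free_module_carrier basis_vec_def)
qed

lemma free_module_span: "span_in R (free_module R X) (basis_vec R ` X) = carrier (free_module R X)"
    (is "?S = carrier ?F")
proof
  interpret F: module R ?F by (rule free_module_module)
  have sub: "basis_vec R ` X \<subseteq> carrier ?F" by auto
  show "?S \<subseteq> carrier ?F"
    by (rule span_in_subset_carrier[OF free_module_module sub])
  note S = F.submoduleE[OF span_in_submodule[OF free_module_module sub]]
  have base: "basis_vec R x \<in> ?S" if "x \<in> X" for x
    using span_in_superset[of "basis_vec R ` X"] that by blast
  have zero: "(\<lambda>_. \<zero>) \<in> ?S"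
    using subgroup.one_closed[OF submodule.axioms(1)[OF span_in_submodule[OF free_module_module sub]]]
    by simp
  \<comment> \<open>Induction over a finite set that merely contains the support: setting one
    coefficient to zero then shrinks the set even if that coefficient was zero before.\<close>
  have key: "f \<in> ?S" if "finite A" "f \<in> carrier ?F" "{x. f x \<noteq> \<zero>} \<subseteq> A" for A f
    using that
  proof (induction A arbitrary: f)
    case empty
    then have "f = (\<lambda>_. \<zero>)" by auto
    then show ?case using zero by simp
  next
    case (insert a A)
    let ?g = "f(a := \<zero>)"
    have c: "f a \<in> carrier R" "\<And>x. f x \<in> carrier R" using insert.prems by (auto simp: free_module_carrier)
    have g: "?g \<in> carrier ?F"
    proof -
      have "{x. ?g x \<noteq> \<zero>} \<subseteq> {x. f x \<noteq> \<zero>}" by auto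
      then show ?thesis using insert.prems(1) unfolding free_module_carrier
        by (auto intro: finite_subset)
    qed
    have gS: "?g \<in> ?S" by (rule insert.IH[OF g]) (use insert.prems(2) in auto)
    show ?case
    proof (cases "a \<in> X")
      case True
      have "f = ?g \<oplus>\<^bsub>?F\<^esub> (f a \<odot>\<^bsub>?F\<^esub> basis_vec R a)"
        by (rule ext) (use c in \<open>simp add: basis_vec_def\<close>)
      also have "\<dots> \<in> ?S" by (intro S gS base True c)
      finally show ?thesis .
    next
      \<comment> \<open>\<open>A\<close> may stick out of \<open>X\<close>; there the coefficient is
        already zero.\<close>
      case False
      then have "f = ?g" using insert.prems(1) by (auto simp: free_module_carrier fun_eq_iff)
      then show ?thesis using gS by simp
    qed
  qed
  show "carrier ?F \<subseteq> ?S"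
  proof
    fix f assume f: "f \<in> carrier ?F"
    then have "finite {x. f x \<noteq> \<zero>}" by (simp add: free_module_carrier)
    then show "f \<in> ?S" using f by (rule key) (rule order_refl)
  qed
qed

lemma free_module_linear_eq:
  assumes "module R N" "f \<in> linear_maps R (free_module R X) N" "g \<in> linear_maps R (free_module R X) N"
    and "\<And>x. x \<in> X \<Longrightarrow> f (basis_vec R x) = g (basis_vec R x)" "u \<in> carrier (free_module R X)"
  shows "f u = g u"
proof (rule linear_maps_eq_on_span[OF free_module_module assms(1-3) free_module_span])
  show "basis_vec R ` X \<subseteq> carrier (free_module R X)" by (rule image_subsetI) (rule basis_vec_closed)
  show "f s = g s" if "s \<in> basis_vec R ` X" for s
    using that by (elim imageE) (simp only: assms(4))
qed (rule assms(5))

end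

definition lin_ext ::
    "('k, 'm) ring_scheme \<Rightarrow> ('k, 'a) module \<Rightarrow> ('x \<Rightarrow> 'a) \<Rightarrow> ('x \<Rightarrow> 'k) \<Rightarrow> 'a" where
  "lin_ext K N g f = (\<Oplus>\<^bsub>N\<^esub>x\<in>{x. f x \<noteq> \<zero>\<^bsub>K\<^esub>}. f x \<odot>\<^bsub>N\<^esub> g x)"

context
  fixes K :: "('k, 'm) ring_scheme" and M :: "('k, 'a) module"
  assumes M: "module K M"
begin

interpretation module K M by (fact M)

text \<open>The sum in \<open>lin_ext\<close> runs over the support of \<open>f\<close>, which
  changes with \<open>f\<close>. Enlarging it to any finite \<open>A\<close> inside \<open>X\<close>
  adds only zero terms, so the sums for two functions and for their sum can be compared over one
  index set.\<close>

lemma lin_ext_eq: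
  assumes "f \<in> carrier (free_module K X)" "g \<in> X \<rightarrow> carrier M"
    and "finite A" "{x. f x \<noteq> \<zero>\<^bsub>K\<^esub>} \<subseteq> A" "A \<subseteq> X"
  shows "lin_ext K M g f = (\<Oplus>\<^bsub>M\<^esub>x\<in>A. f x \<odot>\<^bsub>M\<^esub> g x)"
  unfolding lin_ext_def
  by (rule M.add.finprod_mono_neutral_cong_left)
    (use assms in \<open>auto simp: free_module_carrier Pi_iff\<close>)

lemma lin_ext_linear:
  assumes g: "g \<in> X \<rightarrow> carrier M"
  shows "lin_ext K M g \<in> linear_maps K (free_module K X) M"
proof (rule linear_mapsI)
  fix f h assume f: "f \<in> carrier (free_module K X)" and h: "h \<in> carrier (free_module K X)"
  let ?A = "{x. f x \<noteq> \<zero>\<^bsub>K\<^esub>} \<union> {x. h x \<noteq> \<zero>\<^bsub>K\<^esub>}"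
  have A: "finite ?A" "?A \<subseteq> X" using f h by (auto simp: free_module_carrier)
  note fh = R.free_module_add_closed[OF f h]
  have c: "\<And>x. f x \<in> carrier K" "\<And>x. h x \<in> carrier K" using f h by (auto simp: free_module_carrier)
  have gc: "g x \<in> carrier M" if "x \<in> ?A" for x using A(2) that g by auto
  have "lin_ext K M g (\<lambda>x. f x \<oplus>\<^bsub>K\<^esub> h x) = (\<Oplus>\<^bsub>M\<^esub>x\<in>?A. (f x \<oplus>\<^bsub>K\<^esub> h x) \<odot>\<^bsub>M\<^esub> g x)"
    by (rule lin_ext_eq[OF fh g A(1) _ A(2)]) auto
  also have "\<dots> = (\<Oplus>\<^bsub>M\<^esub>x\<in>?A. f x \<odot>\<^bsub>M\<^esub> g x \<oplus>\<^bsub>M\<^esub> h x \<odot>\<^bsub>M\<^esub> g x)"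
    using gc c by (intro M.finsum_cong') (auto simp: smult_l_distr)
  also have "\<dots> = (\<Oplus>\<^bsub>M\<^esub>x\<in>?A. f x \<odot>\<^bsub>M\<^esub> g x) \<oplus>\<^bsub>M\<^esub> (\<Oplus>\<^bsub>M\<^esub>x\<in>?A. h x \<odot>\<^bsub>M\<^esub> g x)"
    using gc c by (intro M.finsum_addf) auto
  also have "(\<Oplus>\<^bsub>M\<^esub>x\<in>?A. f x \<odot>\<^bsub>M\<^esub> g x) = lin_ext K M g f"
    by (rule lin_ext_eq[OF f g A(1) _ A(2), symmetric]) auto
  also have "(\<Oplus>\<^bsub>M\<^esub>x\<in>?A. h x \<odot>\<^bsub>M\<^esub> g x) = lin_ext K M g h"
    by (rule lin_ext_eq[OF h g A(1) _ A(2), symmetric]) auto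
  finally show "lin_ext K M g (f \<oplus>\<^bsub>free_module K X\<^esub> h) = lin_ext K M g f \<oplus>\<^bsub>M\<^esub> lin_ext K M g h"
    by simp
next
  fix c f assume c: "c \<in> carrier K" and f: "f \<in> carrier (free_module K X)"
  let ?A = "{x. f x \<noteq> \<zero>\<^bsub>K\<^esub>}"
  have A: "finite ?A" "?A \<subseteq> X" using f by (auto simp: free_module_carrier)
  have fc: "\<And>x. f x \<in> carrier K" using f by (auto simp: free_module_carrier)
  have gc: "g x \<in> carrier M" if "x \<in> ?A" for x using A(2) that g by auto
  have "lin_ext K M g (\<lambda>x. c \<otimes>\<^bsub>K\<^esub> f x) = (\<Oplus>\<^bsub>M\<^esub>x\<in>?A. (c \<otimes>\<^bsub>K\<^esub> f x) \<odot>\<^bsub>M\<^esub> g x)"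
    by (rule lin_ext_eq[OF R.free_module_smult_closed[OF f c] g A(1) _ A(2)]) (use c in auto)
  also have "\<dots> = (\<Oplus>\<^bsub>M\<^esub>x\<in>?A. c \<odot>\<^bsub>M\<^esub> (f x \<odot>\<^bsub>M\<^esub> g x))"
    using gc c fc by (intro M.finsum_cong') (auto simp: smult_assoc1)
  also have "\<dots> = c \<odot>\<^bsub>M\<^esub> lin_ext K M g f"
    unfolding lin_ext_def using gc c fc A by (intro finsum_smult_ldistr[symmetric]) auto
  finally show "lin_ext K M g (c \<odot>\<^bsub>free_module K X\<^esub> f) = c \<odot>\<^bsub>M\<^esub> lin_ext K M g f"
    by simp
next
  fix f assume f: "f \<in> carrier (free_module K X)"
  then show "lin_ext K M g f \<in> carrier M"
    unfolding lin_ext_def using g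
    by (intro M.finsum_closed) (auto simp: free_module_carrier Pi_iff)
qed

lemma lin_ext_basis_vec:
  assumes "g \<in> X \<rightarrow> carrier M" "x \<in> X"
  shows "lin_ext K M g (basis_vec K x) = g x"
proof -
  have "lin_ext K M g (basis_vec K x) = (\<Oplus>\<^bsub>M\<^esub>y\<in>{x}. basis_vec K x y \<odot>\<^bsub>M\<^esub> g y)"
    by (rule lin_ext_eq[OF R.basis_vec_closed[OF assms(2)] assms(1)])
      (use assms in \<open>auto simp: basis_vec_def\<close>)
  also have "\<dots> = g x" using assms by (simp add: basis_vec_def Pi_iff)
  finally show ?thesis .
qed

end

section \<open>Quotients\<close>

lemma submodule_abelian_subgroup:
  assumes "module K M" "submodule H K M"
  shows "abelian_subgroup H M"
proof -
  interpret M: module K M by fact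
  show ?thesis
    using submodule.axioms(1)[OF assms(2)]
    by (intro abelian_subgroupI3 additive_subgroupI M.abelian_group_axioms)
qed

lemma quotient_module_simps [simp]:
  "carrier (quotient_module M H) = a_rcosets\<^bsub>M\<^esub> H"
  "add (quotient_module M H) = set_add M"
  "zero (quotient_module M H) = H"
  "monoid.mult (quotient_module M H) = rcoset_mult M H"
  "one (quotient_module M H) = H +>\<^bsub>M\<^esub> \<one>\<^bsub>M\<^esub>"
  "smult (quotient_module M H) = (\<lambda>c X. \<Union>x\<in>X. H +>\<^bsub>M\<^esub> (c \<odot>\<^bsub>M\<^esub> x))"
  by (simp_all add: quotient_module_def FactRing_def)

context
  fixes K :: "('k, 'm) ring_scheme" and M :: "('k, 'a) module" and H
  assumes M: "module K M" and H: "submodule H K M"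
begin

interpretation module K M by (fact M)
interpretation H: abelian_subgroup H M by (rule submodule_abelian_subgroup[OF M H])

lemma rcosets_imageE:
  assumes "X \<in> a_rcosets\<^bsub>M\<^esub> H"
  obtains x where "x \<in> carrier M" "X = H +>\<^bsub>M\<^esub> x"
  using assms by (auto simp: A_RCOSETS_def' a_r_coset_def')

text \<open>Two representatives of a coset differ by an element of \<open>H\<close>, and
  \<open>H\<close> absorbs scalars, so all cosets in the union coincide; the union is not empty,
  since \<open>x\<close> lies in its own coset.\<close>

lemma quotient_smult:
  assumes c: "c \<in> carrier K" and x: "x \<in> carrier M"
  shows "(\<Union>y\<in>H +>\<^bsub>M\<^esub> x. H +>\<^bsub>M\<^esub> (c \<odot>\<^bsub>M\<^esub> y)) = H +>\<^bsub>M\<^esub> (c \<odot>\<^bsub>M\<^esub> x)"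
proof -
  have "H +>\<^bsub>M\<^esub> (c \<odot>\<^bsub>M\<^esub> y) = H +>\<^bsub>M\<^esub> (c \<odot>\<^bsub>M\<^esub> x)" if "y \<in> H +>\<^bsub>M\<^esub> x" for y
  proof -
    from that obtain h where h: "h \<in> H" "y = h \<oplus>\<^bsub>M\<^esub> x"
      by (auto simp: a_r_coset_def')
    have "c \<odot>\<^bsub>M\<^esub> y = c \<odot>\<^bsub>M\<^esub> h \<oplus>\<^bsub>M\<^esub> c \<odot>\<^bsub>M\<^esub> x"
      using h c x by (simp add: smult_r_distr)
    moreover have "c \<odot>\<^bsub>M\<^esub> h \<in> H" using h c H by (simp add: submodule.smult_closed)
    ultimately have "c \<odot>\<^bsub>M\<^esub> y \<in> H +>\<^bsub>M\<^esub> (c \<odot>\<^bsub>M\<^esub> x)"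
      by (auto simp: a_r_coset_def')
    then show ?thesis
      using H.a_repr_independence'[of "c \<odot>\<^bsub>M\<^esub> y" "c \<odot>\<^bsub>M\<^esub> x"] c x by simp
  qed
  moreover have "x \<in> H +>\<^bsub>M\<^esub> x" using x by (rule H.a_rcos_self)
  ultimately show ?thesis by blast
qed

lemma quotient_proj_closed: "x \<in> carrier M \<Longrightarrow> H +>\<^bsub>M\<^esub> x \<in> a_rcosets\<^bsub>M\<^esub> H"
  by (rule a_rcosetsI[OF H.a_subset])

lemma quotient_module_module: "module K (quotient_module M H)"
proof (rule moduleI)
  show "cring K" by (rule R.is_cring)
  have zero: "H = H +>\<^bsub>M\<^esub> \<zero>\<^bsub>M\<^esub>" using H.a_subset by simp
  show "abelian_group (quotient_module M H)"
  proof (rule abelian_groupI)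
    show "\<zero>\<^bsub>quotient_module M H\<^esub> \<in> carrier (quotient_module M H)"
      using quotient_proj_closed[of "\<zero>\<^bsub>M\<^esub>"] zero by simp
    fix X assume "X \<in> carrier (quotient_module M H)"
    then obtain x where x: "x \<in> carrier M" "X = H +>\<^bsub>M\<^esub> x" by (auto elim: rcosets_imageE)
    show "\<zero>\<^bsub>quotient_module M H\<^esub> \<oplus>\<^bsub>quotient_module M H\<^esub> X = X"
      using x H.a_rcos_sum[of "\<zero>\<^bsub>M\<^esub>" x] zero by simp
    have "(H +>\<^bsub>M\<^esub> (\<ominus>\<^bsub>M\<^esub> x)) <+>\<^bsub>M\<^esub> (H +>\<^bsub>M\<^esub> x) = H"
      using x H.a_rcos_sum[of "\<ominus>\<^bsub>M\<^esub> x" x] zero by (simp add: M.l_neg)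
    then show "\<exists>y\<in>carrier (quotient_module M H).
        y \<oplus>\<^bsub>quotient_module M H\<^esub> X = \<zero>\<^bsub>quotient_module M H\<^esub>"
      using x quotient_proj_closed[of "\<ominus>\<^bsub>M\<^esub> x"] by auto
  qed (auto elim!: rcosets_imageE simp: H.a_rcos_sum quotient_proj_closed M.a_ac)
next
  fix a X assume a: "a \<in> carrier K" and "X \<in> carrier (quotient_module M H)"
  then obtain x where x: "x \<in> carrier M" "X = H +>\<^bsub>M\<^esub> x" by (auto elim!: rcosets_imageE)
  show "a \<odot>\<^bsub>quotient_module M H\<^esub> X \<in> carrier (quotient_module M H)"
    using a x by (simp add: quotient_smult quotient_proj_closed)
  {
    fix b assume b: "b \<in> carrier K"
    show "(a \<oplus>\<^bsub>K\<^esub> b) \<odot>\<^bsub>quotient_module M H\<^esub> X =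
        a \<odot>\<^bsub>quotient_module M H\<^esub> X \<oplus>\<^bsub>quotient_module M H\<^esub> b \<odot>\<^bsub>quotient_module M H\<^esub> X"
      using a b x by (simp add: quotient_smult H.a_rcos_sum smult_l_distr)
    show "(a \<otimes>\<^bsub>K\<^esub> b) \<odot>\<^bsub>quotient_module M H\<^esub> X =
        a \<odot>\<^bsub>quotient_module M H\<^esub> (b \<odot>\<^bsub>quotient_module M H\<^esub> X)"
      using a b x by (simp add: quotient_smult smult_assoc1)
  }
  fix Y assume "Y \<in> carrier (quotient_module M H)"
  then obtain y where y: "y \<in> carrier M" "Y = H +>\<^bsub>M\<^esub> y" by (auto elim!: rcosets_imageE)
  show "a \<odot>\<^bsub>quotient_module M H\<^esub> (X \<oplus>\<^bsub>quotient_module M H\<^esub> Y) =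
      a \<odot>\<^bsub>quotient_module M H\<^esub> X \<oplus>\<^bsub>quotient_module M H\<^esub> a \<odot>\<^bsub>quotient_module M H\<^esub> Y"
    using a x y by (simp add: quotient_smult H.a_rcos_sum smult_r_distr)
next
  fix X assume "X \<in> carrier (quotient_module M H)"
  then obtain x where x: "x \<in> carrier M" "X = H +>\<^bsub>M\<^esub> x" by (auto elim: rcosets_imageE)
  then show "\<one>\<^bsub>K\<^esub> \<odot>\<^bsub>quotient_module M H\<^esub> X = X"
    by (simp add: quotient_smult)
qed

lemma quotient_proj_linear: "(\<lambda>x. H +>\<^bsub>M\<^esub> x) \<in> linear_maps K M (quotient_module M H)"
  by (rule linear_mapsI) (simp_all add: H.a_rcos_sum quotient_smult quotient_proj_closed)

lemma quotient_proj_eqI: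
  assumes x: "x \<in> carrier M" and y: "y \<in> carrier M" and xy: "x \<ominus>\<^bsub>M\<^esub> y \<in> H"
  shows "H +>\<^bsub>M\<^esub> x = H +>\<^bsub>M\<^esub> y"
proof -
  have "x = (x \<ominus>\<^bsub>M\<^esub> y) \<oplus>\<^bsub>M\<^esub> y"
    using x y by (simp add: M.minus_eq M.a_assoc M.l_neg)
  then have "x \<in> H +>\<^bsub>M\<^esub> y"
    using xy unfolding a_r_coset_def' by blast
  then show ?thesis using H.a_repr_independence'[of x y] y by simp
qed

lemma quotient_proj_surj: "(\<lambda>x. H +>\<^bsub>M\<^esub> x) ` carrier M = carrier (quotient_module M H)"
  by (auto elim!: rcosets_imageE intro: a_rcosetsI H.a_subset)

lemma quotient_lift:
  assumes N: "module K N" and f: "f \<in> linear_maps K M N" and "\<And>h. h \<in> H \<Longrightarrow> f h = \<zero>\<^bsub>N\<^esub>"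
  shows "\<exists>g \<in> linear_maps K (quotient_module M H) N. \<forall>x\<in>carrier M. g (H +>\<^bsub>M\<^esub> x) = f x"
proof -
  interpret N: module K N by fact
  \<comment> \<open>The value of \<open>g\<close> on a coset is the common value of \<open>f\<close>
    there, so no representative is chosen; \<open>f\<close> is constant on cosets because it kills
    \<open>H\<close>.\<close>
  define g where "g X = (THE y. \<forall>x\<in>X. f x = y)" for X
  have g: "g (H +>\<^bsub>M\<^esub> x) = f x" if x: "x \<in> carrier M" for x
  proof -
    have "f y = f x" if "y \<in> H +>\<^bsub>M\<^esub> x" for y
    proof -
      from that obtain h where h: "h \<in> H" "y = h \<oplus>\<^bsub>M\<^esub> x"
        by (auto simp: a_r_coset_def')
      then show ?thesis
        using x assms(3) by (simp add: linear_maps_add[OF f] linear_maps_closed[OF f])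
    qed
    moreover have "x \<in> H +>\<^bsub>M\<^esub> x" using x by (rule H.a_rcos_self)
    ultimately show ?thesis unfolding g_def by (intro the_equality) metis+
  qed
  have "g \<in> linear_maps K (quotient_module M H) N"
  proof (rule linear_mapsI)
    fix X Y assume "X \<in> carrier (quotient_module M H)" "Y \<in> carrier (quotient_module M H)"
    then obtain x y where x: "x \<in> carrier M" "X = H +>\<^bsub>M\<^esub> x" and y: "y \<in> carrier M" "Y = H +>\<^bsub>M\<^esub> y"
      by (auto elim!: rcosets_imageE)
    show "g (X \<oplus>\<^bsub>quotient_module M H\<^esub> Y) = g X \<oplus>\<^bsub>N\<^esub> g Y"
      using x y by (simp add: H.a_rcos_sum g linear_maps_add[OF f])
  next
    fix c X assume c: "c \<in> carrier K" and "X \<in> carrier (quotient_module M H)"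
    then obtain x where x: "x \<in> carrier M" "X = H +>\<^bsub>M\<^esub> x"
      by (auto elim!: rcosets_imageE)
    show "g (c \<odot>\<^bsub>quotient_module M H\<^esub> X) = c \<odot>\<^bsub>N\<^esub> g X"
      using c x by (simp add: quotient_smult g linear_maps_smult[OF f])
  next
    fix X assume "X \<in> carrier (quotient_module M H)"
    then obtain x where x: "x \<in> carrier M" "X = H +>\<^bsub>M\<^esub> x"
      by (auto elim!: rcosets_imageE)
    show "g X \<in> carrier N"
      using x by (simp add: g linear_maps_closed[OF f])
  qed
  with g show ?thesis by blast
qed

end

section \<open>Multilinear maps and tensor powers\<close>

text \<open>Tuples are extensional functions on \<open>{1..n}\<close>, so the \<open>i\<close>-th
  slot is varied by a function update. For \<open>n = 0\<close> there is no slot, and a multilinear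
  map amounts to the choice of one element of \<open>N\<close>.\<close>

definition multilinear_maps ::
    "('k, 'm) ring_scheme \<Rightarrow> nat \<Rightarrow> ('k, 'a) module \<Rightarrow> ('k, 'b) module \<Rightarrow> ((nat \<Rightarrow> 'a) \<Rightarrow> 'b) set" where
  "multilinear_maps K n M N = {\<mu>. \<mu> \<in> tuples n M \<rightarrow> carrier N \<and>
     (\<forall>a\<in>tuples n M. \<forall>i\<in>{1..n}. (\<lambda>x. \<mu> (a(i := x))) \<in> linear_maps K M N)}"

lemma multilinear_closed: "\<mu> \<in> multilinear_maps K n M N \<Longrightarrow> a \<in> tuples n M \<Longrightarrow> \<mu> a \<in> carrier N"
  and multilinear_linear: "\<mu> \<in> multilinear_maps K n M N \<Longrightarrow> a \<in> tuples n M \<Longrightarrow> i \<in> {1..n} \<Longrightarrow>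
    (\<lambda>x. \<mu> (a(i := x))) \<in> linear_maps K M N"
  by (auto simp: multilinear_maps_def)

lemma tuples_update: "a \<in> tuples n M \<Longrightarrow> i \<in> {1..n} \<Longrightarrow> x \<in> carrier M \<Longrightarrow> a(i := x) \<in> tuples n M"
  by (auto simp: tuples_def PiE_iff extensional_def)

lemma tuples_component: "a \<in> tuples n M \<Longrightarrow> i \<in> {1..n} \<Longrightarrow> a i \<in> carrier M"
  by (auto simp: tuples_def)

lemma tuples_map: "a \<in> tuples n M \<Longrightarrow> f \<in> carrier M \<rightarrow> carrier N \<Longrightarrow> (\<lambda>i\<in>{1..n}. f (a i)) \<in> tuples n N"
  by (auto simp: tuples_def PiE_iff)

text \<open>The slots are freed one at a time: \<open>J\<close> is the set of slots whose entry is
  arbitrary, and all others hold elements of \<open>S\<close>.\<close>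

lemma multilinear_eq_on_span:
  assumes M: "module K M" and N: "module K N"
    and \<mu>: "\<mu> \<in> multilinear_maps K n M N" and \<nu>: "\<nu> \<in> multilinear_maps K n M N"
    and S: "span_in K M S = carrier M" "S \<subseteq> carrier M"
    and eq: "\<And>s. s \<in> {1..n} \<rightarrow>\<^sub>E S \<Longrightarrow> \<mu> s = \<nu> s"
    and a: "a \<in> tuples n M"
  shows "\<mu> a = \<nu> a"
proof -
  have "\<mu> b = \<nu> b" if "finite J" "J \<subseteq> {1..n}" "b \<in> tuples n M" "\<forall>i\<in>{1..n} - J. b i \<in> S" for J b
    using that
  proof (induction J arbitrary: b)
    case empty
    then have "b \<in> {1..n} \<rightarrow>\<^sub>E S" by (simp add: tuples_def PiE_iff)
    then show ?case by (rule eq)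
  next
    case (insert j J)
    then have j: "j \<in> {1..n}" by simp
    \<comment> \<open>Rewriting \<open>b\<close> as \<open>b(j := b j)\<close> exposes slot
      \<open>j\<close>, in which both maps are linear. If an element of \<open>S\<close> is put
      there, the slot no longer counts as free and the induction hypothesis applies.\<close>
    have "\<mu> (b(j := b j)) = \<nu> (b(j := b j))"
    proof (rule linear_maps_eq_on_span[OF M N _ _ S])
      show "(\<lambda>x. \<mu> (b(j := x))) \<in> linear_maps K M N" "(\<lambda>x. \<nu> (b(j := x))) \<in> linear_maps K M N"
        using \<mu> \<nu> insert.prems(2) j by (auto intro: multilinear_linear)
      show "b j \<in> carrier M" using insert.prems(2) j by (rule tuples_component)
      fix s assume s: "s \<in> S"
      show "\<mu> (b(j := s)) = \<nu> (b(j := s))"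
      proof (rule insert.IH)
        show "b(j := s) \<in> tuples n M"
          using insert.prems(2) j s S(2) by (intro tuples_update) auto
      qed (use insert.prems s in auto)
    qed
    then show ?case by simp
  qed
  from this[of "{1..n}" a] a show ?thesis by simp
qed

lemma linear_multilinear_comp:
  assumes "\<mu> \<in> multilinear_maps K n M N" "f \<in> linear_maps K N L"
  shows "(\<lambda>a. f (\<mu> a)) \<in> multilinear_maps K n M L"
proof -
  have "(\<lambda>x. f (\<mu> (a(i := x)))) \<in> linear_maps K M L" if "a \<in> tuples n M" "i \<in> {1..n}" for a i
    by (rule linear_maps_comp[OF multilinear_linear[OF assms(1) that] assms(2)])
  then show ?thesis
    using assms by (auto simp: multilinear_maps_def linear_maps_def)
qed

lemma multilinear_linear_comp:
  assumes M: "module K M" and \<mu>: "\<mu> \<in> multilinear_maps K n N L" and f: "f \<in> linear_maps K M N"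
  shows "(\<lambda>a. \<mu> (\<lambda>i\<in>{1..n}. f (a i))) \<in> multilinear_maps K n M L"
proof -
  have fc: "f \<in> carrier M \<rightarrow> carrier N" using f by (auto simp: linear_maps_def)
  have "(\<lambda>x. \<mu> (\<lambda>j\<in>{1..n}. f ((a(i := x)) j))) \<in> linear_maps K M L"
    if a: "a \<in> tuples n M" and i: "i \<in> {1..n}" for a i
  proof -
    have "(\<lambda>x. \<mu> ((\<lambda>j\<in>{1..n}. f (a j))(i := f x))) \<in> linear_maps K M L"
      by (rule linear_maps_comp[OF f multilinear_linear[OF \<mu> tuples_map[OF a fc] i]])
    moreover have "(\<lambda>j\<in>{1..n}. f (a j))(i := f x) = (\<lambda>j\<in>{1..n}. f ((a(i := x)) j))" for x
      using i by auto
    ultimately show ?thesis by simp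
  qed
  moreover have "\<mu> (\<lambda>i\<in>{1..n}. f (a i)) \<in> carrier L" if "a \<in> tuples n M" for a
    by (rule multilinear_closed[OF \<mu> tuples_map[OF that fc]])
  ultimately show ?thesis by (simp add: multilinear_maps_def)
qed

section \<open>The universal property of the tensor power\<close>

context
  fixes K :: "('k, 'm) ring_scheme" and n :: nat and M :: "('k, 'a) module"
  assumes M: "module K M"
begin

interpretation module K M by (fact M)

private abbreviation (input) "F \<equiv> free_module K (tuples n M)"
private abbreviation (input) "H \<equiv> span_in K F (tensor_relations K n M)"
private abbreviation (input) "T \<equiv> tensor_power K n M"

interpretation F: module K F by (rule R.free_module_module)

private lemma basis_closed: "a \<in> tuples n M \<Longrightarrow> basis_vec K a \<in> carrier F"
  by (rule R.basis_vec_closed)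

private lemma tensor_relations_carrier: "tensor_relations K n M \<subseteq> carrier F"
  unfolding tensor_relations_def Let_def
proof (intro Un_least subsetI; elim CollectE exE conjE)
  fix u a i x y
  assume "u = basis_vec K (a(i := x \<oplus>\<^bsub>M\<^esub> y)) \<ominus>\<^bsub>F\<^esub> (basis_vec K (a(i := x)) \<oplus>\<^bsub>F\<^esub> basis_vec K (a(i := y)))"
    "a \<in> tuples n M" "i \<in> {1..n}" "x \<in> carrier M" "y \<in> carrier M"
  then show "u \<in> carrier F"
    by (simp only:) (intro F.minus_closed F.a_closed basis_closed tuples_update M.a_closed)
next
  fix u a i c x
  assume "u = basis_vec K (a(i := c \<odot>\<^bsub>M\<^esub> x)) \<ominus>\<^bsub>F\<^esub> c \<odot>\<^bsub>F\<^esub> basis_vec K (a(i := x))"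
    "a \<in> tuples n M" "i \<in> {1..n}" "c \<in> carrier K" "x \<in> carrier M"
  then show "u \<in> carrier F"
    by (simp only:) (intro F.minus_closed F.smult_closed basis_closed tuples_update smult_closed)
qed

private lemma H: "submodule H K F"
  by (rule span_in_submodule[OF F.module_axioms tensor_relations_carrier])

private lemma tensor_power_eq: "T = quotient_module F H"
  by (simp add: tensor_power_def Let_def)

private lemma pure_eq: "pure_tensor K n M a = H +>\<^bsub>F\<^esub> basis_vec K a"
  by (simp add: pure_tensor_def Let_def)

lemma tensor_power_module: "module K T"
  unfolding tensor_power_eq by (rule quotient_module_module[OF F.module_axioms H])

text \<open>The relations divided out are exactly the defects of additivity and homogeneity in one
  slot.\<close>

lemma pure_tensor_multilinear: "pure_tensor K n M \<in> multilinear_maps K n M T"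
proof -
  have pl: "(\<lambda>u. H +>\<^bsub>F\<^esub> u) \<in> linear_maps K F T"
    unfolding tensor_power_eq by (rule quotient_proj_linear[OF F.module_axioms H])
  have pc: "pure_tensor K n M a \<in> carrier T" if "a \<in> tuples n M" for a
    unfolding pure_eq by (rule linear_maps_closed[OF pl basis_closed[OF that]])
  have "(\<lambda>x. pure_tensor K n M (a(i := x))) \<in> linear_maps K M T"
    if a: "a \<in> tuples n M" and i: "i \<in> {1..n}" for a i
  proof (rule linear_mapsI)
    fix x assume x: "x \<in> carrier M"
    note ax = basis_closed[OF tuples_update[OF a i x]]
    show "pure_tensor K n M (a(i := x)) \<in> carrier T"
      by (rule pc[OF tuples_update[OF a i x]])
    {
      fix y assume y: "y \<in> carrier M"
      note ay = basis_closed[OF tuples_update[OF a i y]]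
        and axy = basis_closed[OF tuples_update[OF a i M.a_closed[OF x y]]]
      have "basis_vec K (a(i := x \<oplus>\<^bsub>M\<^esub> y)) \<ominus>\<^bsub>F\<^esub> (basis_vec K (a(i := x)) \<oplus>\<^bsub>F\<^esub> basis_vec K (a(i := y))) \<in> H"
        by (rule subsetD[OF span_in_superset]) (use a i x y in \<open>unfold tensor_relations_def Let_def, blast\<close>)
      from quotient_proj_eqI[OF F.module_axioms H axy F.a_closed[OF ax ay] this]
      show "pure_tensor K n M (a(i := x \<oplus>\<^bsub>M\<^esub> y)) =
          pure_tensor K n M (a(i := x)) \<oplus>\<^bsub>T\<^esub> pure_tensor K n M (a(i := y))"
        unfolding pure_eq linear_maps_add[OF pl ax ay] .
    }
    {
      fix c assume c: "c \<in> carrier K"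
      note acx = basis_closed[OF tuples_update[OF a i smult_closed[OF c x]]]
      have "basis_vec K (a(i := c \<odot>\<^bsub>M\<^esub> x)) \<ominus>\<^bsub>F\<^esub> c \<odot>\<^bsub>F\<^esub> basis_vec K (a(i := x)) \<in> H"
        by (rule subsetD[OF span_in_superset]) (use a i x c in \<open>unfold tensor_relations_def Let_def, blast\<close>)
      from quotient_proj_eqI[OF F.module_axioms H acx F.smult_closed[OF c ax] this]
      show "pure_tensor K n M (a(i := c \<odot>\<^bsub>M\<^esub> x)) = c \<odot>\<^bsub>T\<^esub> pure_tensor K n M (a(i := x))"
        unfolding pure_eq linear_maps_smult[OF pl c ax] .
    }
  qed
  with pc show ?thesis by (simp add: multilinear_maps_def)
qed

lemma pure_tensor_closed: "a \<in> tuples n M \<Longrightarrow> pure_tensor K n M a \<in> carrier T"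
  by (rule multilinear_closed[OF pure_tensor_multilinear])

lemma pure_tensor_span: "span_in K T (pure_tensor K n M ` tuples n M) = carrier T"
proof -
  have "span_in K T ((\<lambda>u. H +>\<^bsub>F\<^esub> u) ` basis_vec K ` tuples n M) = carrier T"
    unfolding tensor_power_eq
    by (rule span_in_image[OF F.module_axioms quotient_module_module[OF F.module_axioms H]
          quotient_proj_linear[OF F.module_axioms H] quotient_proj_surj[OF F.module_axioms H]
          R.free_module_span]) (rule image_subsetI, rule basis_closed)
  moreover have "(\<lambda>u. H +>\<^bsub>F\<^esub> u) ` basis_vec K ` tuples n M = pure_tensor K n M ` tuples n M"
    unfolding image_image pure_eq ..
  ultimately show ?thesis by simp
qed

lemma tensor_linear_eq:
  assumes "module K N" "f \<in> linear_maps K T N" "g \<in> linear_maps K T N"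
    and "\<And>a. a \<in> tuples n M \<Longrightarrow> f (pure_tensor K n M a) = g (pure_tensor K n M a)"
    and "t \<in> carrier T"
  shows "f t = g t"
proof (rule linear_maps_eq_on_span[OF tensor_power_module assms(1-3) pure_tensor_span])
  show "pure_tensor K n M ` tuples n M \<subseteq> carrier T" by (rule image_subsetI) (rule pure_tensor_closed)
  show "f s = g s" if "s \<in> pure_tensor K n M ` tuples n M" for s
    using that by (elim imageE) (simp only: assms(4))
qed (rule assms(5))

text \<open>\<mu> extends linearly to the free module on all tuples; multilinearity says that the
  extension kills the relations, so it descends to the quotient.\<close>

lemma tensor_lift:
  assumes N: "module K N" and \<mu>: "\<mu> \<in> multilinear_maps K n M N"
  shows "\<exists>f \<in> linear_maps K T N. \<forall>a\<in>tuples n M. f (pure_tensor K n M a) = \<mu> a"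
proof -
  interpret N: module K N by fact
  let ?l = "lin_ext K N \<mu>"
  have \<mu>c: "\<mu> \<in> tuples n M \<rightarrow> carrier N" using \<mu> by (simp add: multilinear_maps_def)
  have ll: "?l \<in> linear_maps K F N" by (rule lin_ext_linear[OF N \<mu>c])
  have lb: "?l (basis_vec K a) = \<mu> a" if "a \<in> tuples n M" for a
    by (rule lin_ext_basis_vec[OF N \<mu>c that])
  \<comment> \<open>The kernel is written as the preimage of the zero submodule, so that
    \<open>vimage_submodule\<close> turns the inclusion of the relations into one of their
    span.\<close>
  have "tensor_relations K n M \<subseteq> {u \<in> carrier F. ?l u \<in> {\<zero>\<^bsub>N\<^esub>}}"
  proof
    fix u assume u: "u \<in> tensor_relations K n M"
    then have uF: "u \<in> carrier F" using tensor_relations_carrier by blast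
    have "?l u = \<zero>\<^bsub>N\<^esub>"
      using u unfolding tensor_relations_def Let_def
    proof (elim UnE CollectE exE conjE)
      fix a i x y
      assume u: "u = basis_vec K (a(i := x \<oplus>\<^bsub>M\<^esub> y)) \<ominus>\<^bsub>F\<^esub> (basis_vec K (a(i := x)) \<oplus>\<^bsub>F\<^esub> basis_vec K (a(i := y)))"
        and a: "a \<in> tuples n M" and i: "i \<in> {1..n}" and x: "x \<in> carrier M" and y: "y \<in> carrier M"
      note t = tuples_update[OF a i x] tuples_update[OF a i y] tuples_update[OF a i M.a_closed[OF x y]]
      note b = t[THEN basis_closed] and m = linear_maps_add[OF multilinear_linear[OF \<mu> a i] x y]
      show "?l u = \<zero>\<^bsub>N\<^esub>"
        unfolding u linear_maps_minus[OF F.module_axioms N ll b(3) F.a_closed[OF b(1,2)]]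
          linear_maps_add[OF ll b(1,2)] t[THEN lb] m N.M.minus_eq
        by (rule N.M.r_neg) (intro N.M.a_closed multilinear_closed[OF \<mu>] t)
    next
      fix a i c x
      assume u: "u = basis_vec K (a(i := c \<odot>\<^bsub>M\<^esub> x)) \<ominus>\<^bsub>F\<^esub> c \<odot>\<^bsub>F\<^esub> basis_vec K (a(i := x))"
        and a: "a \<in> tuples n M" and i: "i \<in> {1..n}" and c: "c \<in> carrier K" and x: "x \<in> carrier M"
      note t = tuples_update[OF a i x] tuples_update[OF a i smult_closed[OF c x]]
      note b = t[THEN basis_closed] and m = linear_maps_smult[OF multilinear_linear[OF \<mu> a i] c x]
      show "?l u = \<zero>\<^bsub>N\<^esub>"
        unfolding u linear_maps_minus[OF F.module_axioms N ll b(2) F.smult_closed[OF c b(1)]]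
          linear_maps_smult[OF ll c b(1)] t[THEN lb] m N.M.minus_eq
        by (rule N.M.r_neg) (intro N.smult_closed[OF c] multilinear_closed[OF \<mu>] t)
    qed
    with uF show "u \<in> {u \<in> carrier F. ?l u \<in> {\<zero>\<^bsub>N\<^esub>}}" by simp
  qed
  moreover have "submodule {\<zero>\<^bsub>N\<^esub>} K N"
    by (rule N.submoduleI) auto
  ultimately have sub: "H \<subseteq> {u \<in> carrier F. ?l u \<in> {\<zero>\<^bsub>N\<^esub>}}"
    by (intro span_in_least vimage_submodule[OF F.module_axioms N ll])
  have "\<exists>g\<in>linear_maps K (quotient_module F H) N. \<forall>x\<in>carrier F. g (H +>\<^bsub>F\<^esub> x) = ?l x"
    by (rule quotient_lift[OF F.module_axioms H N ll]) (use sub in blast)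
  then obtain g where g: "g \<in> linear_maps K T N" "\<And>x. x \<in> carrier F \<Longrightarrow> g (H +>\<^bsub>F\<^esub> x) = ?l x"
    unfolding tensor_power_eq by blast
  have "g (pure_tensor K n M a) = \<mu> a" if "a \<in> tuples n M" for a
    unfolding pure_eq g(2)[OF basis_closed[OF that]] by (rule lb[OF that])
  with g(1) show ?thesis by blast
qed

end

section \<open>Functoriality of tensor powers, and morphisms tested on pure tensors\<close>

lemma tensor_power_map:
  assumes M: "module K M" and N: "module K N" and f: "f \<in> linear_maps K M N"
  shows tensor_power_map_linear:
      "tensor_power_map K n M N f \<in> linear_maps K (tensor_power K n M) (tensor_power K n N)"
    and tensor_power_map_pure: "\<And>a. a \<in> tuples n M \<Longrightarrow>
      tensor_power_map K n M N f (pure_tensor K n M a) = pure_tensor K n N (\<lambda>i\<in>{1..n}. f (a i))"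
proof -
  let ?T = "tensor_power K n M" and ?U = "tensor_power K n N"
  let ?P = "\<lambda>g. g \<in> linear_maps K ?T ?U \<and> g \<in> extensional (carrier ?T) \<and>
    (\<forall>a\<in>tuples n M. g (pure_tensor K n M a) = pure_tensor K n N (\<lambda>i\<in>{1..n}. f (a i)))"
  note T = tensor_power_module[OF M, of n] and U = tensor_power_module[OF N, of n]
  have "(\<lambda>a. pure_tensor K n N (\<lambda>i\<in>{1..n}. f (a i))) \<in> multilinear_maps K n M ?U"
    by (rule multilinear_linear_comp[OF M pure_tensor_multilinear[OF N] f])
  from tensor_lift[OF M U this]
  obtain g where g: "g \<in> linear_maps K ?T ?U"
    "\<And>a. a \<in> tuples n M \<Longrightarrow> g (pure_tensor K n M a) = pure_tensor K n N (\<lambda>i\<in>{1..n}. f (a i))"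
    by blast
  \<comment> \<open>Cutting \<open>g\<close> off outside the carrier gives the extensional witness
    that the definite description asks for; it is unique since pure tensors span.\<close>
  have ex: "?P (restrict g (carrier ?T))"
    using g(2) pure_tensor_closed[OF M] linear_maps_cong[OF g(1) T, of "restrict g (carrier ?T)"]
    by simp
  have uniq: "h = h'" if h: "?P h" and h': "?P h'" for h h'
  proof (rule extensionalityI)
    show "h \<in> extensional (carrier ?T)" "h' \<in> extensional (carrier ?T)" using h h' by auto
    show "h t = h' t" if "t \<in> carrier ?T" for t
      by (rule tensor_linear_eq[OF M U _ _ _ that]) (use h h' in \<open>simp_all only:\<close>)
  qed
  have "?P (THE g. ?P g)" by (rule theI[of ?P, OF ex]) (rule uniq[OF _ ex])
  then have P: "?P (tensor_power_map K n M N f)" unfolding tensor_power_map_def .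
  then show "tensor_power_map K n M N f \<in> linear_maps K ?T ?U" by blast
  show "tensor_power_map K n M N f (pure_tensor K n M a) = pure_tensor K n N (\<lambda>i\<in>{1..n}. f (a i))"
    if "a \<in> tuples n M" for a using P that by blast
qed

lemma algebra_hom_linear: "f \<in> algebra_hom K A B \<Longrightarrow> f \<in> linear_maps K A B"
  by (simp add: algebra_hom_def)

text \<open>Both sides of the compatibility condition are linear in the tensor, so pure tensors
  suffice. From here on \<open>tensor_power_map\<close> no longer has to be handled.\<close>

lemma n_algebra_hom_iff:
  assumes A: "n_algebra K n A \<alpha>" and B: "n_algebra K n B \<beta>"
  shows "f \<in> n_algebra_hom K n A \<alpha> B \<beta> \<longleftrightarrow> f \<in> algebra_hom K A B \<and>
    (\<forall>a\<in>tuples n A. f (\<alpha> (pure_tensor K n A a)) = \<beta> (pure_tensor K n B (\<lambda>i\<in>{1..n}. f (a i))))"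
    (is "?L \<longleftrightarrow> ?R")
proof
  have mA: "module K A" and mB: "module K B"
    using A B by (auto simp: n_algebra_def intro: algebra.module)
  have \<alpha>: "\<alpha> \<in> linear_maps K (tensor_power K n A) A" and \<beta>: "\<beta> \<in> linear_maps K (tensor_power K n B) B"
    using A B by (auto simp: n_algebra_def)
  {
    assume ?L
    then have f: "f \<in> algebra_hom K A B"
      and eq: "\<And>x. x \<in> carrier (tensor_power K n A) \<Longrightarrow> \<beta> (tensor_power_map K n A B f x) = f (\<alpha> x)"
      by (auto simp: n_algebra_hom_def)
    have "f (\<alpha> (pure_tensor K n A a)) = \<beta> (pure_tensor K n B (\<lambda>i\<in>{1..n}. f (a i)))"
      if "a \<in> tuples n A" for a
      using eq[OF pure_tensor_closed[OF mA that]]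
      by (simp only: tensor_power_map_pure[OF mA mB algebra_hom_linear[OF f] that])
    with f show ?R by blast
  }
  assume R: ?R
  then have f: "f \<in> linear_maps K A B" by (blast intro: algebra_hom_linear)
  have "\<beta> (tensor_power_map K n A B f x) = f (\<alpha> x)" if "x \<in> carrier (tensor_power K n A)" for x
  proof (rule tensor_linear_eq[OF mA mB _ _ _ that])
    show "(\<lambda>x. \<beta> (tensor_power_map K n A B f x)) \<in> linear_maps K (tensor_power K n A) B"
      by (rule linear_maps_comp[OF tensor_power_map_linear[OF mA mB f] \<beta>])
    show "(\<lambda>x. f (\<alpha> x)) \<in> linear_maps K (tensor_power K n A) B"
      by (rule linear_maps_comp[OF \<alpha> f])
    show "\<beta> (tensor_power_map K n A B f (pure_tensor K n A a)) = f (\<alpha> (pure_tensor K n A a))"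
      if "a \<in> tuples n A" for a
      unfolding tensor_power_map_pure[OF mA mB f that] using R that by simp
  qed
  with R show ?L by (simp add: n_algebra_hom_def)
qed

section \<open>Polynomial algebras\<close>

text \<open>The value of the monomial \<open>m\<close> under the substitution of \<open>g x\<close>
  for each variable \<open>x\<close>.\<close>

definition monomial_prod :: "('a, 'm) monoid_scheme \<Rightarrow> ('x \<Rightarrow> 'a) \<Rightarrow> 'x multiset \<Rightarrow> 'a" where
  "monomial_prod G g m = (\<Otimes>\<^bsub>G\<^esub>x\<in>set_mset m. g x [^]\<^bsub>G\<^esub> count m x)"

context comm_monoid
begin

lemma monomial_prod_empty [simp]: "monomial_prod G g {#} = \<one>"
  by (simp add: monomial_prod_def)

lemma monomial_prod_closed:
  "(\<And>x. x \<in># m \<Longrightarrow> g x \<in> carrier G) \<Longrightarrow> monomial_prod G g m \<in> carrier G"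
  unfolding monomial_prod_def by (rule finprod_closed) auto

lemma monomial_prod_add_mset:
  assumes g: "\<And>y. y \<in># add_mset x m \<Longrightarrow> g y \<in> carrier G"
  shows "monomial_prod G g (add_mset x m) = g x \<otimes> monomial_prod G g m"
proof -
  let ?S = "set_mset m - {x}"
  have cl: "g y \<in> carrier G" if "y \<in> insert x ?S" for y using g that by auto
  \<comment> \<open>All exponents are compared over the one index set \<open>insert x ?S\<close>; a
    variable missing from \<open>k\<close> enters with exponent zero, which spares a case split on
    whether \<open>x\<close> occurs in \<open>m\<close>.\<close>
  have eq: "monomial_prod G g k = g x [^] count k x \<otimes> (\<Otimes>y\<in>?S. g y [^] count k y)"
    if k: "set_mset k \<subseteq> insert x ?S" for k
  proof -
    have "monomial_prod G g k = (\<Otimes>y\<in>insert x ?S. g y [^] count k y)"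
      unfolding monomial_prod_def
      by (rule finprod_mono_neutral_cong_left) (use k cl in \<open>auto simp: not_in_iff\<close>)
    also have "\<dots> = g x [^] count k x \<otimes> (\<Otimes>y\<in>?S. g y [^] count k y)"
      by (rule finprod_insert) (use cl in auto)
    finally show ?thesis .
  qed
  have c: "(\<Otimes>y\<in>?S. g y [^] count m y) \<in> carrier G" by (rule finprod_closed) (use cl in auto)
  have "(\<Otimes>y\<in>?S. g y [^] count (add_mset x m) y) = (\<Otimes>y\<in>?S. g y [^] count m y)"
    by (rule finprod_cong') (use cl in auto)
  then have "monomial_prod G g (add_mset x m) = g x [^] Suc (count m x) \<otimes> (\<Otimes>y\<in>?S. g y [^] count m y)"
    by (subst eq) auto
  also have "\<dots> = g x \<otimes> (g x [^] count m x \<otimes> (\<Otimes>y\<in>?S. g y [^] count m y))"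
    using cl[of x] c by (simp add: m_ac)
  also have "\<dots> = g x \<otimes> monomial_prod G g m"
    by (subst eq[of m]) auto
  finally show ?thesis .
qed

lemma monomial_prod_union:
  "(\<And>y. y \<in># m + k \<Longrightarrow> g y \<in> carrier G) \<Longrightarrow>
    monomial_prod G g (m + k) = monomial_prod G g m \<otimes> monomial_prod G g k"
proof (induction m)
  case empty
  then show ?case by (simp add: monomial_prod_closed)
next
  case (add x m)
  then have c: "g x \<in> carrier G" "monomial_prod G g m \<in> carrier G" "monomial_prod G g k \<in> carrier G"
    by (auto intro!: monomial_prod_closed)
  have "monomial_prod G g (add_mset x m + k) = g x \<otimes> monomial_prod G g (m + k)"
    unfolding union_mset_add_mset_left by (rule monomial_prod_add_mset) (use add.prems in auto)
  also have "\<dots> = g x \<otimes> (monomial_prod G g m \<otimes> monomial_prod G g k)"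
    using add.IH add.prems by simp
  also have "\<dots> = monomial_prod G g (add_mset x m) \<otimes> monomial_prod G g k"
    by (subst monomial_prod_add_mset) (use add.prems c in \<open>auto simp: m_assoc\<close>)
  finally show ?case .
qed

lemma monomial_prod_single: "g x \<in> carrier G \<Longrightarrow> monomial_prod G g {#x#} = g x"
  by (subst monomial_prod_add_mset) auto

lemma monomial_prod_cong:
  "(\<And>x. x \<in># m \<Longrightarrow> g x \<in> carrier G) \<Longrightarrow> (\<And>x. x \<in># m \<Longrightarrow> g x = h x) \<Longrightarrow>
    monomial_prod G g m = monomial_prod G h m"
  unfolding monomial_prod_def by (rule finprod_cong') auto

text \<open>\<open>h\<close> need not be injective: the multiset image keeps multiplicities. This
  matters for trees with several isomorphic branches at the root.\<close>

lemma monomial_prod_image_mset_set: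
  assumes "finite A" "\<And>a. a \<in> A \<Longrightarrow> g (h a) \<in> carrier G"
  shows "monomial_prod G g (image_mset h (mset_set A)) = (\<Otimes>a\<in>A. g (h a))"
  using assms
proof (induction A)
  case (insert a A)
  then have "monomial_prod G g (add_mset (h a) (image_mset h (mset_set A))) =
      g (h a) \<otimes> monomial_prod G g (image_mset h (mset_set A))"
    by (intro monomial_prod_add_mset) auto
  with insert show ?case by (simp add: Pi_iff)
qed simp

end

lemma monomial_prod_hom:
  assumes "cring A" "cring B" "f \<in> ring_hom A B" "\<And>x. x \<in># m \<Longrightarrow> g x \<in> carrier A"
  shows "f (monomial_prod A g m) = monomial_prod B (\<lambda>x. f (g x)) m"
proof -
  interpret A: cring A by fact
  interpret B: cring B by fact
  note f = ring_hom_memE[OF assms(3)]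
  show ?thesis
    using assms(4)
  proof (induction m)
    case empty
    then show ?case by (simp add: f)
  next
    case (add x m)
    then have "monomial_prod A g m \<in> carrier A" by (intro A.monomial_prod_closed) auto
    with add show ?case
      by (subst A.monomial_prod_add_mset B.monomial_prod_add_mset, simp_all add: f)+
  qed
qed

section \<open>The convolution product of polynomials\<close>

lemma poly_algebra_simps [simp]:
  "carrier (poly_algebra K X) = carrier (free_module K {m. set_mset m \<subseteq> X})"
  "f \<oplus>\<^bsub>poly_algebra K X\<^esub> g = f \<oplus>\<^bsub>free_module K {m. set_mset m \<subseteq> X}\<^esub> g"
  "\<zero>\<^bsub>poly_algebra K X\<^esub> = \<zero>\<^bsub>free_module K {m. set_mset m \<subseteq> X}\<^esub>"
  "c \<odot>\<^bsub>poly_algebra K X\<^esub> f = c \<odot>\<^bsub>free_module K {m. set_mset m \<subseteq> X}\<^esub> f"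
  "f \<otimes>\<^bsub>poly_algebra K X\<^esub> g = (\<lambda>m. \<Oplus>\<^bsub>K\<^esub>a\<in>{a. a \<subseteq># m}. f a \<otimes>\<^bsub>K\<^esub> g (m - a))"
  "\<one>\<^bsub>poly_algebra K X\<^esub> = basis_vec K {#}"
  by (simp_all add: poly_algebra_def)

text \<open>\<open>poly_algebra\<close> replaces only the product and the unit of the free module,
  and linearity does not see them.\<close>

lemma linear_maps_poly_algebra:
  "linear_maps K (poly_algebra K X) N = linear_maps K (free_module K {m. set_mset m \<subseteq> X}) N"
  "linear_maps K N (poly_algebra K X) = linear_maps K N (free_module K {m. set_mset m \<subseteq> X})"
  by (simp_all add: linear_maps_def)

lemma abelian_group_cong:
  assumes "abelian_group M" "carrier N = carrier M" "add N = add M" "zero N = zero M"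
  shows "abelian_group N"
proof -
  interpret M: abelian_group M by fact
  show ?thesis
    by (rule abelian_groupI)
      (use assms(2-4) M.add.inv_closed M.l_neg in \<open>auto simp: M.a_ac intro!: bexI\<close>)
qed

text \<open>A coefficient of a product is a sum over the submultisets of a monomial; the sum
  operator would return zero for an infinite index set.\<close>

lemma finite_submultisets: "finite {a. a \<subseteq># m}"
proof (induction m)
  case (add x m)
  have "{a. a \<subseteq># add_mset x m} \<subseteq> {a. a \<subseteq># m} \<union> add_mset x ` {a. a \<subseteq># m}"
  proof
    fix a assume a: "a \<in> {a. a \<subseteq># add_mset x m}"
    show "a \<in> {a. a \<subseteq># m} \<union> add_mset x ` {a. a \<subseteq># m}"
    proof (cases "x \<in># a")
      case True
      then obtain b where "a = add_mset x b" by (meson mset_add)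
      with a show ?thesis by auto
    next
      case False
      with a have "a \<subseteq># m"
        by (metis diff_single_trivial mem_Collect_eq subset_eq_diff_conv add_mset_add_single)
      then show ?thesis by simp
    qed
  qed
  with add show ?case by (meson finite_UnI finite_imageI finite_subset)
qed simp

context cring
begin

context
begin

private abbreviation (input) "mons X \<equiv> {m. set_mset m \<subseteq> X}"
private abbreviation (input) "FM X \<equiv> free_module R (mons X)"
private abbreviation (input) "P X \<equiv> poly_algebra R X"

lemma poly_algebra_module: "module R (P X)"
proof -
  interpret F: module R "FM X" by (rule free_module_module)
  show ?thesis
  proof (rule moduleI[OF is_cring])
    show "abelian_group (P X)"
      by (rule abelian_group_cong[OF F.abelian_group_axioms]) (simp_all add: poly_algebra_def)
  qed (simp_all del: free_module_simps
      add: F.smult_l_distr F.smult_r_distr F.smult_assoc1)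
qed

private lemma carrier_coeff: "f \<in> carrier (P X) \<Longrightarrow> f m \<in> carrier R"
  by (simp add: free_module_carrier)

private lemma poly_mult_closed:
  assumes f: "f \<in> carrier (P X)" and g: "g \<in> carrier (P X)"
  shows "f \<otimes>\<^bsub>P X\<^esub> g \<in> carrier (P X)"
proof -
  note cf = carrier_coeff[OF f] and cg = carrier_coeff[OF g]
  \<comment> \<open>A monomial with nonzero coefficient in the product is the union of one from
    \<open>f\<close> and one from \<open>g\<close>, so it lies in this finite set.\<close>
  let ?S = "(\<lambda>(a, b). a + b) ` ({a. f a \<noteq> \<zero>} \<times> {b. g b \<noteq> \<zero>})"
  have fin: "finite ?S" using f g by (simp add: free_module_carrier)
  have nz: "\<exists>a. a \<subseteq># m \<and> f a \<noteq> \<zero> \<and> g (m - a) \<noteq> \<zero>" if "(f \<otimes>\<^bsub>P X\<^esub> g) m \<noteq> \<zero>" for m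
  proof (rule ccontr)
    assume "\<not> ?thesis"
    then have z: "f a \<otimes> g (m - a) = \<zero>" if "a \<in> {a. a \<subseteq># m}" for a
      using that cf cg by (cases "f a = \<zero>") auto
    have "(f \<otimes>\<^bsub>P X\<^esub> g) m = \<zero>"
      by (simp, rule add.finprod_one_eqI) (rule z)
    with that show False by simp
  qed
  have "{m. (f \<otimes>\<^bsub>P X\<^esub> g) m \<noteq> \<zero>} \<subseteq> ?S"
  proof
    fix m assume "m \<in> {m. (f \<otimes>\<^bsub>P X\<^esub> g) m \<noteq> \<zero>}"
    then obtain a where "a \<subseteq># m" "f a \<noteq> \<zero>" "g (m - a) \<noteq> \<zero>" using nz by blast
    then show "m \<in> ?S" by (intro image_eqI[of _ _ "(a, m - a)"]) auto
  qed
  then have "finite {m. (f \<otimes>\<^bsub>P X\<^esub> g) m \<noteq> \<zero>}" using fin by (rule finite_subset)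
  moreover have "(f \<otimes>\<^bsub>P X\<^esub> g) m = \<zero>" if "m \<notin> mons X" for m
  proof (rule ccontr)
    assume "(f \<otimes>\<^bsub>P X\<^esub> g) m \<noteq> \<zero>"
    then obtain a where a: "a \<subseteq># m" "f a \<noteq> \<zero>" "g (m - a) \<noteq> \<zero>" using nz by blast
    then have "a \<in> mons X" "m - a \<in> mons X" using f g by (auto simp: free_module_carrier)
    moreover have "set_mset m = set_mset a \<union> set_mset (m - a)"
      using a(1) by (metis set_mset_union subset_mset.add_diff_inverse)
    ultimately show False using that by auto
  qed
  moreover have "(f \<otimes>\<^bsub>P X\<^esub> g) m \<in> carrier R" for m
    by (simp, rule finsum_closed) (auto intro: cf cg)
  ultimately show ?thesis by (simp add: free_module_carrier)
qed

text \<open>Taking complements \<open>a \<mapsto> m - a\<close> is an involution on the submultisets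
  of \<open>m\<close>, and it exchanges the roles of the two factors.\<close>

private lemma poly_mult_comm:
  assumes f: "f \<in> carrier (P X)" and g: "g \<in> carrier (P X)"
  shows "f \<otimes>\<^bsub>P X\<^esub> g = g \<otimes>\<^bsub>P X\<^esub> f"
proof (rule ext)
  show "(f \<otimes>\<^bsub>P X\<^esub> g) m = (g \<otimes>\<^bsub>P X\<^esub> f) m" for m
  proof -
    note cf = carrier_coeff[OF f] and cg = carrier_coeff[OF g]
    let ?A = "{a. a \<subseteq># m}"
    have dd: "m - (m - a) = a" if "a \<subseteq># m" for a
      using that by (auto simp: mset_subset_eq_exists_conv)
    have img: "(\<lambda>a. m - a) ` ?A = ?A"
    proof
      show "?A \<subseteq> (\<lambda>a. m - a) ` ?A"
      proof
        fix a assume "a \<in> ?A"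
        then have "a = m - (m - a)" by (simp add: dd)
        then show "a \<in> (\<lambda>a. m - a) ` ?A" by (rule image_eqI) simp
      qed
    qed auto
    have "(\<Oplus>a\<in>(\<lambda>a. m - a) ` ?A. f a \<otimes> g (m - a)) = (\<Oplus>a\<in>?A. f (m - a) \<otimes> g (m - (m - a)))"
      by (rule finsum_reindex)
        (auto intro!: cf cg inj_onI, metis dd)
    also have "\<dots> = (\<Oplus>a\<in>?A. g a \<otimes> f (m - a))"
      by (rule finsum_cong') (auto intro!: cf cg m_comm simp: dd)
    finally show ?thesis
      unfolding img by simp
  qed
qed

private lemma poly_mult_linear:
  assumes g: "g \<in> carrier (P X)"
  shows "(\<lambda>f. f \<otimes>\<^bsub>P X\<^esub> g) \<in> linear_maps R (P X) (P X)"
proof (rule linear_mapsI)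
  fix f assume f: "f \<in> carrier (P X)"
  note cf = carrier_coeff[OF f] and cg = carrier_coeff[OF g]
  show "f \<otimes>\<^bsub>P X\<^esub> g \<in> carrier (P X)" using f g by (rule poly_mult_closed)
  {
    fix h assume h: "h \<in> carrier (P X)"
    note ch = carrier_coeff[OF h]
    show "(f \<oplus>\<^bsub>P X\<^esub> h) \<otimes>\<^bsub>P X\<^esub> g = f \<otimes>\<^bsub>P X\<^esub> g \<oplus>\<^bsub>P X\<^esub> h \<otimes>\<^bsub>P X\<^esub> g"
    proof
      fix m
      have "(\<Oplus>a\<in>{a. a \<subseteq># m}. (f a \<oplus> h a) \<otimes> g (m - a)) =
          (\<Oplus>a\<in>{a. a \<subseteq># m}. f a \<otimes> g (m - a) \<oplus> h a \<otimes> g (m - a))"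
        by (rule finsum_cong') (auto simp: cf cg ch l_distr)
      also have "\<dots> = (\<Oplus>a\<in>{a. a \<subseteq># m}. f a \<otimes> g (m - a)) \<oplus> (\<Oplus>a\<in>{a. a \<subseteq># m}. h a \<otimes> g (m - a))"
        by (rule finsum_addf) (auto simp: cf cg ch)
      finally show "((f \<oplus>\<^bsub>P X\<^esub> h) \<otimes>\<^bsub>P X\<^esub> g) m = (f \<otimes>\<^bsub>P X\<^esub> g \<oplus>\<^bsub>P X\<^esub> h \<otimes>\<^bsub>P X\<^esub> g) m"
        by simp
    qed
  }
  fix c assume c: "c \<in> carrier R"
  show "(c \<odot>\<^bsub>P X\<^esub> f) \<otimes>\<^bsub>P X\<^esub> g = c \<odot>\<^bsub>P X\<^esub> (f \<otimes>\<^bsub>P X\<^esub> g)"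
  proof
    fix m
    have "c \<otimes> (\<Oplus>a\<in>{a. a \<subseteq># m}. f a \<otimes> g (m - a)) = (\<Oplus>a\<in>{a. a \<subseteq># m}. c \<otimes> (f a \<otimes> g (m - a)))"
      by (rule finsum_rdistr) (auto simp: cf cg c finite_submultisets)
    also have "\<dots> = (\<Oplus>a\<in>{a. a \<subseteq># m}. (c \<otimes> f a) \<otimes> g (m - a))"
      by (rule finsum_cong') (auto simp: cf cg c m_assoc)
    finally show "((c \<odot>\<^bsub>P X\<^esub> f) \<otimes>\<^bsub>P X\<^esub> g) m = (c \<odot>\<^bsub>P X\<^esub> (f \<otimes>\<^bsub>P X\<^esub> g)) m"
      by simp
  qed
qed

private lemma poly_mult_linear':
  assumes g: "g \<in> carrier (P X)"
  shows "(\<lambda>f. g \<otimes>\<^bsub>P X\<^esub> f) \<in> linear_maps R (P X) (P X)"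
  by (rule linear_maps_cong[OF poly_mult_linear[OF g] poly_algebra_module poly_mult_comm[OF _ g]])

lemma poly_basis_closed: "set_mset m \<subseteq> X \<Longrightarrow> basis_vec R m \<in> carrier (P X)"
  unfolding poly_algebra_simps by (rule basis_vec_closed) simp

text \<open>In the convolution sum only the submultiset \<open>c = a\<close> can contribute, and it
  does so exactly when its complement in \<open>m\<close> is \<open>b\<close>.\<close>

lemma poly_basis_mult:
  "basis_vec R a \<otimes>\<^bsub>P X\<^esub> basis_vec R b = basis_vec R (a + b)"
proof
  fix m
  let ?t = "\<lambda>c. basis_vec R a c \<otimes> basis_vec R b (m - c)"
  have cl: "basis_vec R a c \<in> carrier R" for a c :: "'c multiset" by (simp add: basis_vec_def)
  have "(\<Oplus>c\<in>{c. c \<subseteq># m}. ?t c) = basis_vec R (a + b) m"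
  proof (cases "m = a + b")
    case True
    have "(\<Oplus>c\<in>{c. c \<subseteq># m}. ?t c) = (\<Oplus>c\<in>{a}. ?t c)"
      by (rule add.finprod_mono_neutral_cong_right)
        (use True in \<open>auto simp: finite_submultisets basis_vec_def\<close>)
    also have "\<dots> = \<one>" using True by (simp add: basis_vec_def)
    finally show ?thesis using True by (simp add: basis_vec_def)
  next
    case False
    have "(\<Oplus>c\<in>{c. c \<subseteq># m}. ?t c) = \<zero>"
      by (rule add.finprod_one_eqI) (use False in \<open>auto simp: basis_vec_def\<close>)
    then show ?thesis using False by (simp add: basis_vec_def)
  qed
  then show "(basis_vec R a \<otimes>\<^bsub>P X\<^esub> basis_vec R b) m = basis_vec R (a + b) m" by simp
qed

lemma poly_linear_eq:
  assumes "module R N" "f \<in> linear_maps R (P X) N" "g \<in> linear_maps R (P X) N"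
    and "\<And>m. set_mset m \<subseteq> X \<Longrightarrow> f (basis_vec R m) = g (basis_vec R m)" "u \<in> carrier (P X)"
  shows "f u = g u"
proof (rule free_module_linear_eq[where X = "mons X", OF assms(1)])
  show "f \<in> linear_maps R (FM X) N" "g \<in> linear_maps R (FM X) N" "u \<in> carrier (FM X)"
    using assms(2,3,5) by (simp_all add: linear_maps_poly_algebra)
  show "f (basis_vec R m) = g (basis_vec R m)" if "m \<in> mons X" for m
    using that assms(4) by simp
qed

text \<open>The product is bilinear, so associativity compares two trilinear maps. Applying
  \<open>poly_linear_eq\<close> in each argument reduces it to basis vectors, where it is
  associativity of multiset union; double convolution sums never have to be rearranged.\<close>

lemma poly_algebra_algebra: "algebra R (P X)"
proof -
  interpret P: module R "P X" by (rule poly_algebra_module)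
  note mP = poly_algebra_module[of X]
  have assoc: "(f \<otimes>\<^bsub>P X\<^esub> g) \<otimes>\<^bsub>P X\<^esub> h = f \<otimes>\<^bsub>P X\<^esub> (g \<otimes>\<^bsub>P X\<^esub> h)"
    if f: "f \<in> carrier (P X)" and g: "g \<in> carrier (P X)" and h: "h \<in> carrier (P X)" for f g h
  proof (rule poly_linear_eq[OF mP _ _ _ f])
    show "(\<lambda>f. (f \<otimes>\<^bsub>P X\<^esub> g) \<otimes>\<^bsub>P X\<^esub> h) \<in> linear_maps R (P X) (P X)"
      by (rule linear_maps_comp[OF poly_mult_linear[OF g] poly_mult_linear[OF h]])
    show "(\<lambda>f. f \<otimes>\<^bsub>P X\<^esub> (g \<otimes>\<^bsub>P X\<^esub> h)) \<in> linear_maps R (P X) (P X)"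
      by (rule poly_mult_linear[OF poly_mult_closed[OF g h]])
    fix a assume "set_mset a \<subseteq> X"
    note a = poly_basis_closed[OF this]
    show "(basis_vec R a \<otimes>\<^bsub>P X\<^esub> g) \<otimes>\<^bsub>P X\<^esub> h = basis_vec R a \<otimes>\<^bsub>P X\<^esub> (g \<otimes>\<^bsub>P X\<^esub> h)"
    proof (rule poly_linear_eq[OF mP _ _ _ g])
      show "(\<lambda>g. (basis_vec R a \<otimes>\<^bsub>P X\<^esub> g) \<otimes>\<^bsub>P X\<^esub> h) \<in> linear_maps R (P X) (P X)"
        by (rule linear_maps_comp[OF poly_mult_linear'[OF a] poly_mult_linear[OF h]])
      show "(\<lambda>g. basis_vec R a \<otimes>\<^bsub>P X\<^esub> (g \<otimes>\<^bsub>P X\<^esub> h)) \<in> linear_maps R (P X) (P X)"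
        by (rule linear_maps_comp[OF poly_mult_linear[OF h] poly_mult_linear'[OF a]])
      fix b assume "set_mset b \<subseteq> X"
      note b = poly_basis_closed[OF this]
      show "(basis_vec R a \<otimes>\<^bsub>P X\<^esub> basis_vec R b) \<otimes>\<^bsub>P X\<^esub> h = basis_vec R a \<otimes>\<^bsub>P X\<^esub> (basis_vec R b \<otimes>\<^bsub>P X\<^esub> h)"
      proof (rule poly_linear_eq[OF mP _ _ _ h])
        show "(\<lambda>h. (basis_vec R a \<otimes>\<^bsub>P X\<^esub> basis_vec R b) \<otimes>\<^bsub>P X\<^esub> h) \<in> linear_maps R (P X) (P X)"
          by (rule poly_mult_linear'[OF poly_mult_closed[OF a b]])
        show "(\<lambda>h. basis_vec R a \<otimes>\<^bsub>P X\<^esub> (basis_vec R b \<otimes>\<^bsub>P X\<^esub> h)) \<in> linear_maps R (P X) (P X)"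
          by (rule linear_maps_comp[OF poly_mult_linear'[OF b] poly_mult_linear'[OF a]])
      qed (simp only: poly_basis_mult add.assoc)
    qed
  qed
  have one: "\<one>\<^bsub>P X\<^esub> \<otimes>\<^bsub>P X\<^esub> f = f" if f: "f \<in> carrier (P X)" for f
  proof (rule poly_linear_eq[OF mP _ _ _ f])
    show "(\<lambda>f. \<one>\<^bsub>P X\<^esub> \<otimes>\<^bsub>P X\<^esub> f) \<in> linear_maps R (P X) (P X)"
      by (rule poly_mult_linear') (simp only: poly_algebra_simps(6), rule poly_basis_closed, simp)
    show "(\<lambda>f. f) \<in> linear_maps R (P X) (P X)" by (intro linear_mapsI refl)
    show "\<one>\<^bsub>P X\<^esub> \<otimes>\<^bsub>P X\<^esub> basis_vec R m = basis_vec R m" for m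
      by (simp only: poly_algebra_simps(6) poly_basis_mult add_0_left)
  qed
  have "cring (P X)"
  proof (rule cringI)
    show "abelian_group (P X)" by (rule P.abelian_group_axioms)
    show "comm_monoid (P X)"
    proof (rule comm_monoidI)
      show "\<one>\<^bsub>P X\<^esub> \<in> carrier (P X)"
        by (simp only: poly_algebra_simps(6), rule poly_basis_closed) simp
    qed (fact poly_mult_closed assoc one poly_mult_comm)+
    show "(f \<oplus>\<^bsub>P X\<^esub> g) \<otimes>\<^bsub>P X\<^esub> h = f \<otimes>\<^bsub>P X\<^esub> h \<oplus>\<^bsub>P X\<^esub> g \<otimes>\<^bsub>P X\<^esub> h"
      if "f \<in> carrier (P X)" "g \<in> carrier (P X)" "h \<in> carrier (P X)" for f g h
      by (rule linear_maps_add[OF poly_mult_linear[OF that(3)] that(1,2)])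
  qed
  then show ?thesis
    by (rule algebraI[OF is_cring])
      (fact P.smult_closed P.smult_l_distr P.smult_r_distr P.smult_assoc1 P.smult_one
        | rule linear_maps_smult[OF poly_mult_linear], assumption+)+
qed

end

end

section \<open>Algebra homomorphisms and the universal property of polynomials\<close>

lemma algebra_mult_linear:
  assumes "algebra K A" "a \<in> carrier A"
  shows "(\<lambda>x. x \<otimes>\<^bsub>A\<^esub> a) \<in> linear_maps K A A" "(\<lambda>x. a \<otimes>\<^bsub>A\<^esub> x) \<in> linear_maps K A A"
proof -
  interpret algebra K A by fact
  show l: "(\<lambda>x. x \<otimes>\<^bsub>A\<^esub> a) \<in> linear_maps K A A"
    using assms(2) by (intro linear_mapsI) (auto simp: l_distr smult_assoc2)
  show "(\<lambda>x. a \<otimes>\<^bsub>A\<^esub> x) \<in> linear_maps K A A"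
    by (rule linear_maps_cong[OF l module_axioms m_comm[OF _ assms(2)]])
qed

lemma algebra_hom_mult: "f \<in> algebra_hom K A B \<Longrightarrow> x \<in> carrier A \<Longrightarrow> y \<in> carrier A \<Longrightarrow>
    f (x \<otimes>\<^bsub>A\<^esub> y) = f x \<otimes>\<^bsub>B\<^esub> f y"
  and algebra_hom_one: "f \<in> algebra_hom K A B \<Longrightarrow> f \<one>\<^bsub>A\<^esub> = \<one>\<^bsub>B\<^esub>"
  and algebra_hom_closed: "f \<in> algebra_hom K A B \<Longrightarrow> x \<in> carrier A \<Longrightarrow> f x \<in> carrier B"
  by (auto simp: algebra_hom_def ring_hom_def)

lemma algebra_homI:
  assumes "f \<in> linear_maps K A B" "\<And>x y. x \<in> carrier A \<Longrightarrow> y \<in> carrier A \<Longrightarrow> f (x \<otimes>\<^bsub>A\<^esub> y) = f x \<otimes>\<^bsub>B\<^esub> f y"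
    and "f \<one>\<^bsub>A\<^esub> = \<one>\<^bsub>B\<^esub>"
  shows "f \<in> algebra_hom K A B"
  using assms by (auto simp: algebra_hom_def linear_maps_def ring_hom_def)

lemma algebra_hom_comp:
  "f \<in> algebra_hom K A B \<Longrightarrow> g \<in> algebra_hom K B C \<Longrightarrow> (\<lambda>x. g (f x)) \<in> algebra_hom K A C"
  by (auto simp: algebra_hom_def linear_maps_def ring_hom_def Pi_iff)

lemma algebra_hom_id: "(\<lambda>x. x) \<in> algebra_hom K A A"
  by (auto simp: algebra_hom_def linear_maps_def ring_hom_def)

lemma algebra_hom_monomial_prod:
  assumes "algebra K A" "algebra K B" "f \<in> algebra_hom K A B" "\<And>x. x \<in># m \<Longrightarrow> g x \<in> carrier A"
  shows "f (monomial_prod A g m) = monomial_prod B (\<lambda>x. f (g x)) m"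
  using assms by (intro monomial_prod_hom) (auto simp: algebra_hom_def algebra.M_cring)

context
  fixes K :: "('k, 'm) ring_scheme" and X :: "'x set"
  assumes K: "cring K"
begin

interpretation cring K by (fact K)

private abbreviation (input) "PX \<equiv> poly_algebra K X"

lemma poly_basis_eq_monomial_prod:
  "set_mset m \<subseteq> X \<Longrightarrow> basis_vec K m = monomial_prod PX (\<lambda>x. basis_vec K {#x#}) m"
proof (induction m)
  case empty
  interpret P: algebra K PX by (rule poly_algebra_algebra)
  show ?case by (simp only: P.monomial_prod_empty poly_algebra_simps(6))
next
  case (add x m)
  interpret P: algebra K PX by (rule poly_algebra_algebra)
  have cl: "basis_vec K {#y#} \<in> carrier PX" if "y \<in># add_mset x m" for y
    by (rule poly_basis_closed) (use add.prems that in auto)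
  have "monomial_prod PX (\<lambda>x. basis_vec K {#x#}) (add_mset x m) =
      basis_vec K {#x#} \<otimes>\<^bsub>PX\<^esub> monomial_prod PX (\<lambda>x. basis_vec K {#x#}) m"
    by (rule P.monomial_prod_add_mset[OF cl])
  also have "\<dots> = basis_vec K {#x#} \<otimes>\<^bsub>PX\<^esub> basis_vec K m"
    using add by simp
  also have "\<dots> = basis_vec K (add_mset x m)"
    unfolding poly_basis_mult by simp
  finally show ?case by simp
qed

lemma poly_algebra_hom_eq:
  assumes A: "algebra K A" and f: "f \<in> algebra_hom K PX A" and g: "g \<in> algebra_hom K PX A"
    and eq: "\<And>x. x \<in> X \<Longrightarrow> f (basis_vec K {#x#}) = g (basis_vec K {#x#})" and u: "u \<in> carrier PX"
  shows "f u = g u"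
proof (rule poly_linear_eq[OF algebra.module[OF A] algebra_hom_linear[OF f] algebra_hom_linear[OF g] _ u])
  fix m assume m: "set_mset m \<subseteq> X"
  interpret A: algebra K A by (rule A)
  have cl: "basis_vec K {#x#} \<in> carrier PX" if "x \<in># m" for x
    using m that by (intro poly_basis_closed) auto
  have h: "k (basis_vec K m) = monomial_prod A (\<lambda>x. k (basis_vec K {#x#})) m"
    if "k \<in> algebra_hom K PX A" for k
    using algebra_hom_monomial_prod[OF poly_algebra_algebra A that cl]
    by (simp only: poly_basis_eq_monomial_prod[OF m])
  show "f (basis_vec K m) = g (basis_vec K m)"
    unfolding h[OF f] h[OF g]
    by (rule A.monomial_prod_cong) (use m eq algebra_hom_closed[OF f cl] in auto)
qed

text \<open>Evaluation of monomials is extended linearly. Multiplicativity is an equality of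
  bilinear maps, so it need only be checked on monomials, where it is
  \<open>monomial_prod_union\<close>.\<close>

lemma poly_algebra_universal:
  assumes A: "algebra K A" and g: "g \<in> X \<rightarrow> carrier A"
  shows "\<exists>f \<in> algebra_hom K PX A. (\<forall>x\<in>X. f (basis_vec K {#x#}) = g x) \<and>
    (\<forall>m. set_mset m \<subseteq> X \<longrightarrow> f (basis_vec K m) = monomial_prod A g m)"
proof -
  interpret A: algebra K A by (rule A)
  interpret P: algebra K PX by (rule poly_algebra_algebra)
  let ?f = "lin_ext K A (monomial_prod A g)"
  have mc: "monomial_prod A g \<in> {m. set_mset m \<subseteq> X} \<rightarrow> carrier A"
    using g by (auto intro!: A.monomial_prod_closed)
  have lin: "?f \<in> linear_maps K PX A"
    unfolding linear_maps_poly_algebra by (rule lin_ext_linear[OF A.module mc])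
  have base: "?f (basis_vec K m) = monomial_prod A g m" if "set_mset m \<subseteq> X" for m
    by (rule lin_ext_basis_vec[OF A.module mc]) (use that in simp)
  have "?f (u \<otimes>\<^bsub>PX\<^esub> v) = ?f u \<otimes>\<^bsub>A\<^esub> ?f v" if u: "u \<in> carrier PX" and v: "v \<in> carrier PX" for u v
  proof (rule poly_linear_eq[OF A.module _ _ _ u])
    show "(\<lambda>u. ?f (u \<otimes>\<^bsub>PX\<^esub> v)) \<in> linear_maps K PX A"
      by (rule linear_maps_comp[OF algebra_mult_linear(1)[OF P.algebra_axioms v] lin])
    show "(\<lambda>u. ?f u \<otimes>\<^bsub>A\<^esub> ?f v) \<in> linear_maps K PX A"
      by (rule linear_maps_comp[OF lin algebra_mult_linear(1)[OF A linear_maps_closed[OF lin v]]])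
    fix a assume a: "set_mset a \<subseteq> X"
    note ac = poly_basis_closed[OF a]
    show "?f (basis_vec K a \<otimes>\<^bsub>PX\<^esub> v) = ?f (basis_vec K a) \<otimes>\<^bsub>A\<^esub> ?f v"
    proof (rule poly_linear_eq[OF A.module _ _ _ v])
      show "(\<lambda>v. ?f (basis_vec K a \<otimes>\<^bsub>PX\<^esub> v)) \<in> linear_maps K PX A"
        by (rule linear_maps_comp[OF algebra_mult_linear(2)[OF P.algebra_axioms ac] lin])
      show "(\<lambda>v. ?f (basis_vec K a) \<otimes>\<^bsub>A\<^esub> ?f v) \<in> linear_maps K PX A"
        by (rule linear_maps_comp[OF lin algebra_mult_linear(2)[OF A linear_maps_closed[OF lin ac]]])
      fix b assume b: "set_mset b \<subseteq> X"
      then have ab: "set_mset (a + b) \<subseteq> X" using a by simp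
      show "?f (basis_vec K a \<otimes>\<^bsub>PX\<^esub> basis_vec K b) = ?f (basis_vec K a) \<otimes>\<^bsub>A\<^esub> ?f (basis_vec K b)"
        unfolding poly_basis_mult base[OF a] base[OF b] base[OF ab]
        by (rule A.monomial_prod_union) (use a b g in auto)
    qed
  qed
  moreover have "?f \<one>\<^bsub>PX\<^esub> = \<one>\<^bsub>A\<^esub>"
    unfolding poly_algebra_simps(6) using base[of "{#}"] by simp
  ultimately have "?f \<in> algebra_hom K PX A" by (intro algebra_homI lin)
  moreover have "?f (basis_vec K {#x#}) = g x" if "x \<in> X" for x
    using base[of "{#x#}"] that g by (simp add: A.monomial_prod_single Pi_iff)
  ultimately show ?thesis using base by blast
qed

end

section \<open>Symmetric algebras\<close>

text \<open>A scalar \<open>c\<close> acts as multiplication by \<open>c\<close> times the unit, so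
  absorption of ring elements includes absorption of scalars.\<close>

lemma ideal_submodule:
  assumes "algebra K A" "ideal I A"
  shows "submodule I K A"
proof -
  interpret A: algebra K A by fact
  interpret I: ideal I A by fact
  show ?thesis
  proof (rule A.submoduleI)
    fix c x assume c: "c \<in> carrier K" and x: "x \<in> I"
    have "c \<odot>\<^bsub>A\<^esub> x = (c \<odot>\<^bsub>A\<^esub> \<one>\<^bsub>A\<^esub>) \<otimes>\<^bsub>A\<^esub> x"
      using c I.a_Hcarr[OF x] by (simp add: A.smult_assoc2)
    also have "\<dots> \<in> I" using c x by (simp add: I.I_l_closed)
    finally show "c \<odot>\<^bsub>A\<^esub> x \<in> I" .
  qed (auto intro: I.a_Hcarr)
qed

section \<open>Quotients of algebras by ideals\<close>

context
  fixes K :: "('k, 'm) ring_scheme" and A :: "('k, 'a) module" and I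
  assumes A: "algebra K A" and I: "ideal I A"
begin

interpretation A: algebra K A by (fact A)
interpretation I: ideal I A by (fact I)

private abbreviation (input) "QA \<equiv> quotient_module A I"

lemma quotient_algebra: "algebra K QA"
proof -
  note sub = ideal_submodule[OF A I]
  interpret Q: module K QA by (rule quotient_module_module[OF A.module sub])
  note E = rcosets_imageE[OF A.module sub]
  have R: "cring (A Quot I)" by (rule I.quotient_is_cring) (rule A.M_cring)
  interpret R: cring "A Quot I" by (rule R)
  \<comment> \<open>The record \<open>QA\<close> shares its ring operations with
    \<open>A Quot I\<close>, so the ring laws are inherited; only the compatibility of scalars with
    products is computed on representatives.\<close>
  have c: "carrier QA = carrier (A Quot I)" "monoid.mult QA = monoid.mult (A Quot I)"
    "one QA = one (A Quot I)" "add QA = add (A Quot I)"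
    by (simp_all add: quotient_module_def)
  have "cring QA"
  proof (rule cringI)
    show "abelian_group QA" by (rule Q.abelian_group_axioms)
    show "comm_monoid QA"
      by (rule comm_monoidI; simp only: c)
        (fact R.m_closed R.one_closed R.m_assoc R.l_one R.m_comm)+
    show "(x \<oplus>\<^bsub>QA\<^esub> y) \<otimes>\<^bsub>QA\<^esub> z = x \<otimes>\<^bsub>QA\<^esub> z \<oplus>\<^bsub>QA\<^esub> y \<otimes>\<^bsub>QA\<^esub> z"
      if "x \<in> carrier QA" "y \<in> carrier QA" "z \<in> carrier QA" for x y z
      using that unfolding c by (rule R.l_distr)
  qed
  moreover have "(r \<odot>\<^bsub>QA\<^esub> x) \<otimes>\<^bsub>QA\<^esub> y = r \<odot>\<^bsub>QA\<^esub> (x \<otimes>\<^bsub>QA\<^esub> y)"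
    if r: "r \<in> carrier K" and xy: "x \<in> carrier QA" "y \<in> carrier QA" for r x y
  proof -
    from xy obtain a b where a: "a \<in> carrier A" "x = I +>\<^bsub>A\<^esub> a" and b: "b \<in> carrier A" "y = I +>\<^bsub>A\<^esub> b"
      unfolding quotient_module_simps by (auto elim!: E)
    show ?thesis
      using r a b by (simp add: quotient_smult[OF A.module sub] I.rcoset_mult_add A.smult_assoc2)
  qed
  ultimately show ?thesis
    by (intro algebra.intro cring.intro algebra_axioms.intro Q.module_axioms)
      (auto intro: cring.axioms)
qed

lemma quotient_proj_algebra_hom: "(\<lambda>x. I +>\<^bsub>A\<^esub> x) \<in> algebra_hom K A QA"
  by (rule algebra_homI[OF quotient_proj_linear[OF A.module ideal_submodule[OF A I]]])
    (simp_all add: I.rcoset_mult_add)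

lemma quotient_algebra_lift:
  assumes B: "algebra K B" and f: "f \<in> algebra_hom K A B" and ker: "\<And>h. h \<in> I \<Longrightarrow> f h = \<zero>\<^bsub>B\<^esub>"
  shows "\<exists>g \<in> algebra_hom K QA B. \<forall>x\<in>carrier A. g (I +>\<^bsub>A\<^esub> x) = f x"
proof -
  note sub = ideal_submodule[OF A I]
  note E = rcosets_imageE[OF A.module sub]
  from quotient_lift[OF A.module sub algebra.module[OF B] algebra_hom_linear[OF f] ker]
  obtain g where g: "g \<in> linear_maps K QA B" "\<And>x. x \<in> carrier A \<Longrightarrow> g (I +>\<^bsub>A\<^esub> x) = f x" by blast
  have "g \<in> algebra_hom K QA B"
  proof (rule algebra_homI[OF g(1)])
    show "g \<one>\<^bsub>QA\<^esub> = \<one>\<^bsub>B\<^esub>" by (simp add: g(2) algebra_hom_one[OF f])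
    fix x y assume "x \<in> carrier QA" "y \<in> carrier QA"
    then obtain a b where a: "a \<in> carrier A" "x = I +>\<^bsub>A\<^esub> a" and b: "b \<in> carrier A" "y = I +>\<^bsub>A\<^esub> b"
      unfolding quotient_module_simps by (auto elim!: E)
    show "g (x \<otimes>\<^bsub>QA\<^esub> y) = g x \<otimes>\<^bsub>B\<^esub> g y"
      using a b by (simp add: I.rcoset_mult_add g(2) algebra_hom_mult[OF f])
  qed
  with g(2) show ?thesis by blast
qed

lemma quotient_algebra_hom_eq:
  assumes "\<And>a. a \<in> carrier A \<Longrightarrow> f (I +>\<^bsub>A\<^esub> a) = g (I +>\<^bsub>A\<^esub> a)" "x \<in> carrier QA"
  shows "f x = g x"
proof -
  from assms(2) obtain a where "a \<in> carrier A" "x = I +>\<^bsub>A\<^esub> a"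
    unfolding quotient_module_simps by (auto elim!: rcosets_imageE[OF A.module ideal_submodule[OF A I]])
  then show ?thesis using assms(1) by blast
qed

end

section \<open>The universal property of the symmetric algebra\<close>

context
  fixes K :: "('k, 'm) ring_scheme" and V :: "('k, 'v) module"
  assumes V: "module K V"
begin

interpretation V: module K V by (fact V)

private abbreviation (input) "PV \<equiv> poly_algebra K (carrier V)"
private abbreviation (input) "IV \<equiv> Idl\<^bsub>PV\<^esub> (symmetric_relations K V)"
private abbreviation (input) "SV \<equiv> symmetric_algebra K V"
private abbreviation (input) "inclV \<equiv> symmetric_incl K V"

interpretation P: algebra K PV by (rule V.R.poly_algebra_algebra)

private lemma gen_closed: "v \<in> carrier V \<Longrightarrow> basis_vec K {#v#} \<in> carrier PV"
  by (rule V.R.poly_basis_closed) simp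

private lemma symmetric_relations_carrier: "symmetric_relations K V \<subseteq> carrier PV"
  unfolding symmetric_relations_def Let_def
proof (intro Un_least subsetI; elim CollectE exE conjE)
  fix u v w
  assume "u = basis_vec K {#v \<oplus>\<^bsub>V\<^esub> w#} \<ominus>\<^bsub>PV\<^esub> (basis_vec K {#v#} \<oplus>\<^bsub>PV\<^esub> basis_vec K {#w#})"
    "v \<in> carrier V" "w \<in> carrier V"
  then show "u \<in> carrier PV"
    by (simp only:) (intro P.M.minus_closed P.M.a_closed gen_closed V.M.a_closed)
next
  fix u c v
  assume "u = basis_vec K {#c \<odot>\<^bsub>V\<^esub> v#} \<ominus>\<^bsub>PV\<^esub> c \<odot>\<^bsub>PV\<^esub> basis_vec K {#v#}"
    "c \<in> carrier K" "v \<in> carrier V"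
  then show "u \<in> carrier PV"
    by (simp only:) (intro P.M.minus_closed P.smult_closed gen_closed V.smult_closed)
qed

private lemma IV: "ideal IV PV"
  by (rule P.genideal_ideal[OF symmetric_relations_carrier])

private lemma symmetric_algebra_eq: "SV = quotient_module PV IV"
  by (simp add: symmetric_algebra_def Let_def)

private lemma incl_eq: "inclV v = IV +>\<^bsub>PV\<^esub> basis_vec K {#v#}"
  by (simp add: symmetric_incl_def Let_def)

lemma symmetric_algebra_algebra: "algebra K SV"
  unfolding symmetric_algebra_eq by (rule quotient_algebra[OF P.algebra_axioms IV])

lemma symmetric_incl_linear: "inclV \<in> linear_maps K V SV"
proof (rule linear_mapsI)
  note sub = ideal_submodule[OF P.algebra_axioms IV]
  have pl: "(\<lambda>u. IV +>\<^bsub>PV\<^esub> u) \<in> linear_maps K PV SV"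
    unfolding symmetric_algebra_eq by (rule quotient_proj_linear[OF P.module sub])
  note rel = subsetD[OF P.genideal_self[OF symmetric_relations_carrier]]
  fix v assume v: "v \<in> carrier V"
  note gv = gen_closed[OF v]
  show "inclV v \<in> carrier SV" unfolding incl_eq by (rule linear_maps_closed[OF pl gv])
  {
    fix w assume w: "w \<in> carrier V"
    note gw = gen_closed[OF w]
    have "basis_vec K {#v \<oplus>\<^bsub>V\<^esub> w#} \<ominus>\<^bsub>PV\<^esub> (basis_vec K {#v#} \<oplus>\<^bsub>PV\<^esub> basis_vec K {#w#}) \<in> IV"
      by (rule rel) (use v w in \<open>unfold symmetric_relations_def Let_def, blast\<close>)
    from quotient_proj_eqI[OF P.module sub gen_closed[OF V.M.a_closed[OF v w]] P.M.a_closed[OF gv gw] this]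
    show "inclV (v \<oplus>\<^bsub>V\<^esub> w) = inclV v \<oplus>\<^bsub>SV\<^esub> inclV w"
      unfolding incl_eq linear_maps_add[OF pl gv gw] .
  }
  fix c assume c: "c \<in> carrier K"
  have "basis_vec K {#c \<odot>\<^bsub>V\<^esub> v#} \<ominus>\<^bsub>PV\<^esub> c \<odot>\<^bsub>PV\<^esub> basis_vec K {#v#} \<in> IV"
    by (rule rel) (use v c in \<open>unfold symmetric_relations_def Let_def, blast\<close>)
  from quotient_proj_eqI[OF P.module sub gen_closed[OF V.smult_closed[OF c v]] P.smult_closed[OF c gv] this]
  show "inclV (c \<odot>\<^bsub>V\<^esub> v) = c \<odot>\<^bsub>SV\<^esub> inclV v"
    unfolding incl_eq linear_maps_smult[OF pl c gv] .
qed

lemma symmetric_algebra_hom_eq: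
  assumes A: "algebra K A" and f: "f \<in> algebra_hom K SV A" and g: "g \<in> algebra_hom K SV A"
    and eq: "\<And>v. v \<in> carrier V \<Longrightarrow> f (inclV v) = g (inclV v)" and s: "s \<in> carrier SV"
  shows "f s = g s"
proof (rule quotient_algebra_hom_eq[OF P.algebra_axioms IV])
  have p: "(\<lambda>u. IV +>\<^bsub>PV\<^esub> u) \<in> algebra_hom K PV SV"
    unfolding symmetric_algebra_eq by (rule quotient_proj_algebra_hom[OF P.algebra_axioms IV])
  show "f (IV +>\<^bsub>PV\<^esub> u) = g (IV +>\<^bsub>PV\<^esub> u)" if "u \<in> carrier PV" for u
    by (rule poly_algebra_hom_eq[OF V.R.is_cring A algebra_hom_comp[OF p f] algebra_hom_comp[OF p g] _ that])
      (fold incl_eq, rule eq)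
  show "s \<in> carrier (quotient_module PV IV)" using s unfolding symmetric_algebra_eq .
qed

text \<open>The homomorphism from the polynomial algebra that agrees with \<open>g\<close> on
  variables kills the relations because \<open>g\<close> is linear; its kernel is an ideal, so it
  contains the ideal they generate.\<close>

lemma symmetric_algebra_universal:
  assumes A: "algebra K A" and g: "g \<in> linear_maps K V A"
  shows "\<exists>f \<in> algebra_hom K SV A. \<forall>v\<in>carrier V. f (inclV v) = g v"
proof -
  interpret A: algebra K A by (rule A)
  have "g \<in> carrier V \<rightarrow> carrier A" using g by (simp add: linear_maps_def)
  from poly_algebra_universal[OF V.R.is_cring A this]
  obtain f where f: "f \<in> algebra_hom K PV A" "\<And>v. v \<in> carrier V \<Longrightarrow> f (basis_vec K {#v#}) = g v" by blast
  note fl = algebra_hom_linear[OF f(1)]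
  have rh: "ring_hom_ring PV A f"
    by (rule ring_hom_ringI2[OF P.ring_axioms A.ring_axioms]) (use f(1) in \<open>simp add: algebra_hom_def\<close>)
  have "symmetric_relations K V \<subseteq> a_kernel PV A f"
  proof
    fix u assume u: "u \<in> symmetric_relations K V"
    then have uP: "u \<in> carrier PV" using symmetric_relations_carrier by blast
    have "f u = \<zero>\<^bsub>A\<^esub>"
      using u unfolding symmetric_relations_def Let_def
    proof (elim UnE CollectE exE conjE)
      fix v w
      assume u: "u = basis_vec K {#v \<oplus>\<^bsub>V\<^esub> w#} \<ominus>\<^bsub>PV\<^esub> (basis_vec K {#v#} \<oplus>\<^bsub>PV\<^esub> basis_vec K {#w#})"
        and v: "v \<in> carrier V" and w: "w \<in> carrier V"
      note vw = V.M.a_closed[OF v w]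
      show ?thesis
        unfolding u linear_maps_minus[OF P.module A.module fl gen_closed[OF vw]
            P.M.a_closed[OF gen_closed[OF v] gen_closed[OF w]]]
          linear_maps_add[OF fl gen_closed[OF v] gen_closed[OF w]] f(2)[OF v] f(2)[OF w] f(2)[OF vw]
          linear_maps_add[OF g v w] A.M.minus_eq
        by (rule A.M.r_neg) (intro A.M.a_closed linear_maps_closed[OF g] v w)
    next
      fix c v
      assume u: "u = basis_vec K {#c \<odot>\<^bsub>V\<^esub> v#} \<ominus>\<^bsub>PV\<^esub> c \<odot>\<^bsub>PV\<^esub> basis_vec K {#v#}"
        and c: "c \<in> carrier K" and v: "v \<in> carrier V"
      note cv = V.smult_closed[OF c v]
      show ?thesis
        unfolding u linear_maps_minus[OF P.module A.module fl gen_closed[OF cv]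
            P.smult_closed[OF c gen_closed[OF v]]]
          linear_maps_smult[OF fl c gen_closed[OF v]] f(2)[OF v] f(2)[OF cv]
          linear_maps_smult[OF g c v] A.M.minus_eq
        by (rule A.M.r_neg) (intro A.smult_closed c linear_maps_closed[OF g] v)
    qed
    with uP show "u \<in> a_kernel PV A f" unfolding a_kernel_def' by blast
  qed
  then have "IV \<subseteq> a_kernel PV A f"
    by (rule P.genideal_minimal[OF ring_hom_ring.kernel_is_ideal[OF rh]])
  then have "f h = \<zero>\<^bsub>A\<^esub>" if "h \<in> IV" for h
    using that unfolding a_kernel_def' by blast
  from quotient_algebra_lift[OF P.algebra_axioms IV A f(1) this]
  obtain g' where g': "g' \<in> algebra_hom K SV A" "\<And>u. u \<in> carrier PV \<Longrightarrow> g' (IV +>\<^bsub>PV\<^esub> u) = f u"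
    unfolding symmetric_algebra_eq by blast
  have "g' (inclV v) = g v" if "v \<in> carrier V" for v
    unfolding incl_eq g'(2)[OF gen_closed[OF that]] by (rule f(2)[OF that])
  with g'(1) show ?thesis by blast
qed

end

text \<open>In the symmetric algebra every vector is a generator, and the linear relations hide
  which monomials are independent. The universal properties on both sides give homomorphisms in both
  directions, inverse to each other because they are so on generators. Later this transports the
  monomial basis of polynomials.\<close>

lemma symmetric_algebra_free:
  fixes K :: "('k, 'm) ring_scheme" and X :: "'x set"
  defines "S \<equiv> symmetric_algebra K (free_module K X)" and "P \<equiv> poly_algebra K X"
    and "gen \<equiv> \<lambda>x. symmetric_incl K (free_module K X) (basis_vec K x)"
  assumes K: "cring K"
  obtains \<theta> \<iota> where "\<theta> \<in> algebra_hom K S P" "\<iota> \<in> algebra_hom K P S"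
    "\<And>x. x \<in> X \<Longrightarrow> \<theta> (gen x) = basis_vec K {#x#}"
    "\<And>x. x \<in> X \<Longrightarrow> \<iota> (basis_vec K {#x#}) = gen x"
    "\<And>s. s \<in> carrier S \<Longrightarrow> \<iota> (\<theta> s) = s" "\<And>p. p \<in> carrier P \<Longrightarrow> \<theta> (\<iota> p) = p"
proof -
  interpret cring K by (fact K)
  let ?V = "free_module K X" and ?incl = "symmetric_incl K (free_module K X)"
  have V: "module K ?V" by (rule free_module_module)
  interpret P: algebra K P unfolding P_def by (rule poly_algebra_algebra)
  interpret S: algebra K S unfolding S_def by (rule symmetric_algebra_algebra[OF V])
  note il = symmetric_incl_linear[OF V, folded S_def]
  have Xc: "(\<lambda>x. basis_vec K {#x#}) \<in> X \<rightarrow> carrier P"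
    unfolding P_def by (intro Pi_I poly_basis_closed) simp
  let ?g = "lin_ext K P (\<lambda>x. basis_vec K {#x#})"
  have g: "?g \<in> linear_maps K ?V P" by (rule lin_ext_linear[OF P.module Xc])
  have gb: "?g (basis_vec K x) = basis_vec K {#x#}" if "x \<in> X" for x
    by (rule lin_ext_basis_vec[OF P.module Xc that])
  from symmetric_algebra_universal[OF V P.algebra_axioms g]
  obtain \<theta> where \<theta>: "\<theta> \<in> algebra_hom K S P" "\<And>v. v \<in> carrier ?V \<Longrightarrow> \<theta> (?incl v) = ?g v"
    unfolding S_def by blast
  have genc: "gen \<in> X \<rightarrow> carrier S"
    unfolding gen_def by (intro Pi_I linear_maps_closed[OF il] basis_vec_closed)
  from poly_algebra_universal[OF K S.algebra_axioms genc]
  obtain \<iota> where \<iota>: "\<iota> \<in> algebra_hom K P S" "\<And>x. x \<in> X \<Longrightarrow> \<iota> (basis_vec K {#x#}) = gen x"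
    unfolding P_def by blast
  have \<theta>gen: "\<theta> (gen x) = basis_vec K {#x#}" if "x \<in> X" for x
    unfolding gen_def \<theta>(2)[OF basis_vec_closed[OF that]] by (rule gb[OF that])
  have \<theta>\<iota>: "\<theta> (\<iota> p) = p" if "p \<in> carrier P" for p
    using that unfolding P_def
    by (rule poly_algebra_hom_eq[OF K P.algebra_axioms[unfolded P_def]
          algebra_hom_comp[OF \<iota>(1) \<theta>(1), unfolded P_def] algebra_hom_id, rotated])
      (simp only: \<iota>(2) \<theta>gen)
  have \<iota>\<theta>: "\<iota> (\<theta> s) = s" if "s \<in> carrier S" for s
  proof (rule symmetric_algebra_hom_eq[OF V S.algebra_axioms[unfolded S_def]
          algebra_hom_comp[OF \<theta>(1) \<iota>(1), unfolded S_def] algebra_hom_id])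
    show "s \<in> carrier (symmetric_algebra K ?V)" using that unfolding S_def .
    fix v assume v: "v \<in> carrier ?V"
    have "\<iota> (?g v) = ?incl v"
    proof (rule free_module_linear_eq[OF S.module linear_maps_comp[OF g algebra_hom_linear[OF \<iota>(1)]] il _ v])
      show "\<iota> (?g (basis_vec K x)) = ?incl (basis_vec K x)" if "x \<in> X" for x
        unfolding gb[OF that] \<iota>(2)[OF that] gen_def ..
    qed
    then show "\<iota> (\<theta> (?incl v)) = ?incl v" unfolding \<theta>(2)[OF v] .
  qed
  show thesis by (rule that[OF \<theta>(1) \<iota>(1) \<theta>gen \<iota>(2) \<iota>\<theta> \<theta>\<iota>])
qed

section \<open>Coloured trees and their branches\<close>

text \<open>\<open>coloured_poset_iso\<close> with its witness exposed, because the same bijection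
  is reused for children and subtrees.\<close>

definition iso_map :: "coloured_poset \<Rightarrow> coloured_poset \<Rightarrow> (nat \<Rightarrow> nat) \<Rightarrow> bool" where
  "iso_map P Q h \<longleftrightarrow> bij_betw h (vertices P) (vertices Q) \<and>
     (\<forall>x\<in>vertices P. \<forall>y\<in>vertices P. (x, y) \<in> leq P \<longleftrightarrow> (h x, h y) \<in> leq Q) \<and>
     (\<forall>(v, w)\<in>edges P. colour Q (h v, h w) = colour P (v, w))"

lemma coloured_poset_iso_iff: "coloured_poset_iso P Q \<longleftrightarrow> (\<exists>h. iso_map P Q h)"
  by (simp add: coloured_poset_iso_def iso_map_def)

definition root_of :: "coloured_poset \<Rightarrow> nat" where
  "root_of P = (THE r. is_root P r)"

text \<open>A multiset, because isomorphic branches may occur several times; it is the family of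
  exponents of the monomial \<open>branches\<close>.\<close>

definition branch_classes :: "nat \<Rightarrow> coloured_poset \<Rightarrow> nat \<Rightarrow> coloured_tree multiset" where
  "branch_classes n P i = image_mset (\<lambda>w. tree_class n (subtree_at P w)) (mset_set (children P i))"

lemma subtree_at_simps [simp]:
  "vertices (subtree_at P w) = {x \<in> vertices P. (w, x) \<in> leq P}"
  "leq (subtree_at P w) = leq P \<inter> vertices (subtree_at P w) \<times> vertices (subtree_at P w)"
  "colour (subtree_at P w) = colour P"
  by (simp_all add: subtree_at_def Let_def)

lemma edges_iff: "(v, w) \<in> edges P \<longleftrightarrow> less_in P v w \<and> \<not> (\<exists>x. less_in P v x \<and> less_in P x w)"
  by (simp add: edges_def)

section \<open>Roots, branches and subtrees of a coloured tree\<close>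

context
  fixes n :: nat and P :: coloured_poset
  assumes P: "coloured_tree_poset n P"
begin

lemma tree_finite: "finite (vertices P)"
  using P by (simp add: coloured_tree_poset_def)

lemma tree_partial_order: "partial_order_on (vertices P) (leq P)"
  using P by (simp add: coloured_tree_poset_def)

lemma tree_leq_vertices: "(x, y) \<in> leq P \<Longrightarrow> x \<in> vertices P \<and> y \<in> vertices P"
  using partial_order_onD(4)[OF tree_partial_order] by auto

lemma tree_refl: "x \<in> vertices P \<Longrightarrow> (x, x) \<in> leq P"
  using partial_order_onD(1)[OF tree_partial_order] by (simp add: refl_on_def)

lemma tree_trans: "(x, y) \<in> leq P \<Longrightarrow> (y, z) \<in> leq P \<Longrightarrow> (x, z) \<in> leq P"
  using partial_order_onD(2)[OF tree_partial_order] by (rule transD)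

lemma tree_antisym: "(x, y) \<in> leq P \<Longrightarrow> (y, x) \<in> leq P \<Longrightarrow> x = y"
  using partial_order_onD(3)[OF tree_partial_order] by (rule antisymD)

lemma tree_condition: "y \<noteq> z \<Longrightarrow> less_in P y x \<Longrightarrow> less_in P z x \<Longrightarrow> less_in P y z \<or> less_in P z y"
  using P unfolding coloured_tree_poset_def by blast

lemma tree_colour: "(v, w) \<in> edges P \<Longrightarrow> colour P (v, w) \<in> {1..n}"
  using P unfolding coloured_tree_poset_def by blast

lemma is_root_iff: "is_root P r \<longleftrightarrow> r = root_of P"
proof -
  have uniq: "r = r'" if "is_root P r" "is_root P r'" for r r'
    using that tree_antisym unfolding is_root_def less_in_def by metis
  obtain r0 where r0: "is_root P r0" using P unfolding coloured_tree_poset_def by blast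
  have "is_root P (root_of P)" unfolding root_of_def by (rule theI[of "is_root P", OF r0]) (rule uniq[OF _ r0])
  with uniq show ?thesis by blast
qed

lemma root_in: "root_of P \<in> vertices P"
  using is_root_iff[of "root_of P"] by (simp add: is_root_def)

lemma root_leq: "x \<in> vertices P \<Longrightarrow> (root_of P, x) \<in> leq P"
  using is_root_iff[of "root_of P"] tree_refl by (cases "x = root_of P") (auto simp: is_root_def less_in_def)

lemma root_least: "(x, root_of P) \<in> leq P \<Longrightarrow> x = root_of P"
  using root_leq tree_antisym tree_leq_vertices by blast

lemma less_vertices: "less_in P x y \<Longrightarrow> x \<in> vertices P \<and> y \<in> vertices P"
  using tree_leq_vertices[of x y] by (simp add: less_in_def)

lemma edges_vertices: "(v, w) \<in> edges P \<Longrightarrow> v \<in> vertices P \<and> w \<in> vertices P"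
  using less_vertices[of v w] by (simp add: edges_iff)

lemma children_iff: "w \<in> children P i \<longleftrightarrow> (root_of P, w) \<in> edges P \<and> colour P (root_of P, w) = i"
  by (simp add: children_def is_root_iff)

lemma finite_children: "finite (children P i)"
  by (rule finite_subset[OF _ tree_finite]) (auto simp: children_iff dest: edges_vertices)

text \<open>Since the root lies below everything, a child of the root is a vertex that is minimal
  among the others.\<close>

lemma root_edge_iff: "(root_of P, w) \<in> edges P \<longleftrightarrow>
    w \<in> vertices P \<and> w \<noteq> root_of P \<and> (\<forall>x. (x, w) \<in> leq P \<longrightarrow> x = w \<or> x = root_of P)"
  unfolding edges_iff less_in_def using root_leq root_least tree_leq_vertices by metis

text \<open>A finite partial order is well founded, so among the vertices below \<open>x\<close>
  other than the root there is a minimal one.\<close>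

lemma child_below_exists:
  assumes "x \<in> vertices P" "x \<noteq> root_of P"
  shows "\<exists>w. (root_of P, w) \<in> edges P \<and> (w, x) \<in> leq P"
proof -
  have "finite (leq P)"
    using partial_order_onD(4)[OF tree_partial_order] tree_finite by (meson finite_SigmaI finite_subset)
  then have wf: "wf (leq P - Id)"
    using tree_partial_order by (rule partial_order_on_well_order_on)
  have "x \<in> {y. (y, x) \<in> leq P \<and> y \<noteq> root_of P}" using assms tree_refl by simp
  then obtain w where w: "(w, x) \<in> leq P" "w \<noteq> root_of P"
    and min: "\<And>y. (y, w) \<in> leq P - Id \<Longrightarrow> \<not> ((y, x) \<in> leq P \<and> y \<noteq> root_of P)"
    by (rule wfE_min[OF wf]) blast
  have "y = w \<or> y = root_of P" if "(y, w) \<in> leq P" for y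
    using min[of y] that tree_trans[OF that w(1)] by auto
  then have "(root_of P, w) \<in> edges P"
    using w tree_leq_vertices by (auto simp: root_edge_iff)
  with w(1) show ?thesis by blast
qed

text \<open>Two vertices strictly below \<open>x\<close> are comparable by the tree condition, and
  comparable children of the root coincide by minimality. If one of them is \<open>x\<close> itself,
  its minimality applies directly.\<close>

lemma child_below_unique:
  assumes "(root_of P, w) \<in> edges P" "(root_of P, w') \<in> edges P" "(w, x) \<in> leq P" "(w', x) \<in> leq P"
  shows "w = w'"
proof (rule ccontr)
  assume ne: "w \<noteq> w'"
  show False
  proof (cases "w = x \<or> w' = x")
    case True
    then show False using assms ne by (auto simp: root_edge_iff)
  next
    case False
    then have "less_in P w w' \<or> less_in P w' w"
      using assms ne by (intro tree_condition[of _ _ x]) (auto simp: less_in_def)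
    then show False using assms(1,2) ne by (auto simp: root_edge_iff less_in_def)
  qed
qed

definition child_below :: "nat \<Rightarrow> nat" where
  "child_below x = (THE w. (root_of P, w) \<in> edges P \<and> (w, x) \<in> leq P)"

lemma child_below_eqI: "(root_of P, w) \<in> edges P \<Longrightarrow> (w, x) \<in> leq P \<Longrightarrow> child_below x = w"
  unfolding child_below_def by (rule the_equality) (auto intro: child_below_unique)

lemma child_below:
  assumes "x \<in> vertices P" "x \<noteq> root_of P"
  shows "(root_of P, child_below x) \<in> edges P" "(child_below x, x) \<in> leq P"
  using child_below_exists[OF assms] child_below_eqI by metis+

text \<open>Branches are closed upwards. Hence vertices of different branches are incomparable,
  which is what allows isomorphisms to be glued branch by branch.\<close>

lemma child_below_leq:
  assumes "(x, y) \<in> leq P" "x \<noteq> root_of P"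
  shows "y \<noteq> root_of P" "child_below y = child_below x"
proof -
  show "y \<noteq> root_of P" using assms root_least by blast
  note x = child_below[OF conjunct1[OF tree_leq_vertices[OF assms(1)]] assms(2)]
  show "child_below y = child_below x"
    by (rule child_below_eqI[OF x(1) tree_trans[OF x(2) assms(1)]])
qed

context
  fixes w assumes w: "w \<in> vertices P"
begin

lemma subtree_less: "less_in (subtree_at P w) x y \<longleftrightarrow> (w, x) \<in> leq P \<and> less_in P x y"
  using tree_trans tree_leq_vertices by (auto simp: less_in_def)

text \<open>The subtree is closed upwards, so every vertex of \<open>P\<close> strictly between two
  of its elements belongs to it; no new edges arise.\<close>

lemma subtree_edges: "(x, y) \<in> edges (subtree_at P w) \<longleftrightarrow> (w, x) \<in> leq P \<and> (x, y) \<in> edges P"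
  unfolding edges_iff subtree_less using tree_trans by (auto simp: less_in_def)

lemma subtree_is_root: "is_root (subtree_at P w) w"
  unfolding is_root_def subtree_less using w tree_refl by (auto simp: less_in_def)

lemma subtree_tree: "coloured_tree_poset n (subtree_at P w)"
  unfolding coloured_tree_poset_def
proof (intro conjI)
  show "finite (vertices (subtree_at P w))" using tree_finite by simp
  show "partial_order_on (vertices (subtree_at P w)) (leq (subtree_at P w))"
    unfolding partial_order_on_def preorder_on_def
    by (auto simp: refl_on_def trans_def antisym_def intro: tree_refl tree_trans tree_antisym)
  show "\<exists>r. is_root (subtree_at P w) r" using subtree_is_root by blast
  show "\<forall>x y z. y \<noteq> z \<and> less_in (subtree_at P w) y x \<and> less_in (subtree_at P w) z x \<longrightarrow>
      less_in (subtree_at P w) y z \<or> less_in (subtree_at P w) z y"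
    unfolding subtree_less using tree_condition by blast
  show "\<forall>e\<in>edges (subtree_at P w). colour (subtree_at P w) e \<in> {1..n}"
    using tree_colour by (auto simp: subtree_edges)
qed

end

text \<open>The root of \<open>P\<close> is missing from the subtree. Recursion and induction over
  trees rest on this.\<close>

lemma subtree_card_less:
  assumes "w \<in> children P i"
  shows "card (vertices (subtree_at P w)) < card (vertices P)"
proof (rule psubset_card_mono[OF tree_finite])
  have "(w, root_of P) \<notin> leq P"
    using assms root_least by (auto simp: children_iff root_edge_iff)
  then show "vertices (subtree_at P w) \<subset> vertices P" using root_in by auto
qed

end

section \<open>Isomorphisms of coloured trees\<close>

context
  fixes n :: nat and P Q :: coloured_poset
  assumes P: "coloured_tree_poset n P" and Q: "coloured_tree_poset n Q"
begin

context
  fixes h assumes h: "iso_map P Q h"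
begin

lemma iso_map_bij: "bij_betw h (vertices P) (vertices Q)"
  using h by (simp add: iso_map_def)

lemma iso_map_leq: "x \<in> vertices P \<Longrightarrow> y \<in> vertices P \<Longrightarrow> (h x, h y) \<in> leq Q \<longleftrightarrow> (x, y) \<in> leq P"
  using h by (simp add: iso_map_def)

lemma iso_map_colour: "(v, w) \<in> edges P \<Longrightarrow> colour Q (h v, h w) = colour P (v, w)"
  using h by (auto simp: iso_map_def)

lemma iso_map_inj: "x \<in> vertices P \<Longrightarrow> y \<in> vertices P \<Longrightarrow> h x = h y \<longleftrightarrow> x = y"
  using iso_map_bij by (auto simp: bij_betw_def inj_on_def)

lemma iso_map_in: "x \<in> vertices P \<Longrightarrow> h x \<in> vertices Q"
  using iso_map_bij by (auto simp: bij_betw_def)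

lemma iso_map_surj: "y \<in> vertices Q \<Longrightarrow> \<exists>x\<in>vertices P. y = h x"
  using iso_map_bij by (auto simp: bij_betw_def)

lemma iso_map_less: "x \<in> vertices P \<Longrightarrow> y \<in> vertices P \<Longrightarrow> less_in Q (h x) (h y) \<longleftrightarrow> less_in P x y"
  by (simp add: less_in_def iso_map_leq iso_map_inj)

text \<open>Edges are defined from the order alone, and a vertex between \<open>h x\<close> and
  \<open>h y\<close> is the image of one between \<open>x\<close> and \<open>y\<close>.\<close>

lemma iso_map_edges:
  assumes x: "x \<in> vertices P" and y: "y \<in> vertices P"
  shows "(h x, h y) \<in> edges Q \<longleftrightarrow> (x, y) \<in> edges P"
proof -
  have "(\<exists>z. less_in Q (h x) z \<and> less_in Q z (h y)) \<longleftrightarrow> (\<exists>z. less_in P x z \<and> less_in P z y)"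
    using less_vertices[OF P] less_vertices[OF Q] iso_map_surj iso_map_less x y by metis
  then show ?thesis using x y by (simp add: edges_iff iso_map_less)
qed

lemma iso_map_root: "h (root_of P) = root_of Q"
proof -
  obtain x where "x \<in> vertices P" "root_of Q = h x" using iso_map_surj root_in[OF Q] by blast
  then have "(h (root_of P), root_of Q) \<in> leq Q"
    using root_leq[OF P] root_in[OF P] by (simp add: iso_map_leq)
  then show ?thesis by (rule root_least[OF Q])
qed

lemma iso_map_inverse: "iso_map Q P (inv_into (vertices P) h)"
proof -
  let ?g = "inv_into (vertices P) h"
  have g: "?g (h x) = x" if "x \<in> vertices P" for x
    using iso_map_bij that by (simp add: bij_betw_def)
  have "(x, y) \<in> leq Q \<longleftrightarrow> (?g x, ?g y) \<in> leq P" if "x \<in> vertices Q" "y \<in> vertices Q" for x y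
    using iso_map_surj[OF that(1)] iso_map_surj[OF that(2)] g iso_map_leq by auto
  moreover have "colour P (?g v, ?g w) = colour Q (v, w)" if e: "(v, w) \<in> edges Q" for v w
  proof -
    from edges_vertices[OF Q e] obtain x y
      where "x \<in> vertices P" "v = h x" "y \<in> vertices P" "w = h y" using iso_map_surj by blast
    then show ?thesis using e iso_map_edges iso_map_colour g by auto
  qed
  ultimately show ?thesis
    unfolding iso_map_def using bij_betw_inv_into[OF iso_map_bij] by auto
qed

text \<open>The same \<open>h\<close> serves, since it carries the vertices above \<open>w\<close>
  onto those above \<open>h w\<close>.\<close>

lemma iso_map_subtree:
  assumes w: "w \<in> vertices P"
  shows "iso_map (subtree_at P w) (subtree_at Q (h w)) h"
proof -
  let ?U = "vertices (subtree_at P w)" and ?V = "vertices (subtree_at Q (h w))"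
  have sub: "?U \<subseteq> vertices P" by auto
  have "h ` ?U = ?V"
  proof
    show "h ` ?U \<subseteq> ?V" using w iso_map_in iso_map_leq[OF w] by auto
    show "?V \<subseteq> h ` ?U"
    proof
      fix y assume "y \<in> ?V"
      then have y: "y \<in> vertices Q" "(h w, y) \<in> leq Q" by auto
      from iso_map_surj[OF y(1)] obtain x where x: "x \<in> vertices P" "y = h x" by blast
      then have "x \<in> ?U" using y(2) iso_map_leq[OF w x(1)] by simp
      with x(2) show "y \<in> h ` ?U" by blast
    qed
  qed
  moreover have "inj_on h ?U"
    using iso_map_bij sub unfolding bij_betw_def by (meson inj_on_subset)
  ultimately have b: "bij_betw h ?U ?V"
    by (simp only: bij_betw_def)
  have "(x, y) \<in> leq (subtree_at P w) \<longleftrightarrow> (h x, h y) \<in> leq (subtree_at Q (h w))"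
    if x: "x \<in> ?U" and y: "y \<in> ?U" for x y
  proof -
    have "h x \<in> ?V" "h y \<in> ?V" using b x y unfolding bij_betw_def by blast+
    moreover have "(h x, h y) \<in> leq Q \<longleftrightarrow> (x, y) \<in> leq P"
      using x y sub by (intro iso_map_leq) auto
    ultimately show ?thesis using x y unfolding subtree_at_simps(2) by blast
  qed
  moreover have "colour (subtree_at Q (h w)) (h u, h v) = colour (subtree_at P w) (u, v)"
    if "(u, v) \<in> edges (subtree_at P w)" for u v
    using that iso_map_colour[of u v] by (simp add: subtree_edges[OF P w])
  ultimately show ?thesis
    unfolding iso_map_def using b by blast
qed

lemma iso_map_children: "bij_betw h (children P i) (children Q i)"
proof -
  have "h w \<in> children Q i \<longleftrightarrow> w \<in> children P i" if "w \<in> vertices P" for w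
    using that root_in[OF P] iso_map_colour
    by (auto simp: children_iff[OF P] children_iff[OF Q] iso_map_edges simp flip: iso_map_root)
  moreover have "children P i \<subseteq> vertices P" "children Q i \<subseteq> vertices Q"
    using edges_vertices[OF P] edges_vertices[OF Q] by (auto simp: children_iff[OF P] children_iff[OF Q])
  ultimately have "h ` children P i = children Q i"
    using iso_map_surj by blast
  moreover have "inj_on h (children P i)"
    using \<open>children P i \<subseteq> vertices P\<close> iso_map_inj by (auto simp: inj_on_def subset_iff)
  ultimately show ?thesis by (simp add: bij_betw_def)
qed

end

lemma iso_sym: "coloured_poset_iso P Q \<Longrightarrow> coloured_poset_iso Q P"
  using iso_map_inverse by (auto simp: coloured_poset_iso_iff)

end

lemma iso_refl: "coloured_poset_iso P P"
proof -
  have "iso_map P P (\<lambda>x. x)" by (auto simp: iso_map_def bij_betw_def)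
  then show ?thesis by (auto simp: coloured_poset_iso_iff)
qed

lemma iso_trans:
  assumes P: "coloured_tree_poset n P" and Q: "coloured_tree_poset n Q"
    and "coloured_poset_iso P Q" "coloured_poset_iso Q R"
  shows "coloured_poset_iso P R"
proof -
  from assms obtain h k where h: "iso_map P Q h" and k: "iso_map Q R k"
    by (auto simp: coloured_poset_iso_iff)
  have "iso_map P R (k \<circ> h)"
    unfolding iso_map_def
  proof (intro conjI ballI; (elim prod.splits)?)
    show "bij_betw (k \<circ> h) (vertices P) (vertices R)"
      using h k by (auto simp: iso_map_def intro: bij_betw_trans)
    show "(x, y) \<in> leq P \<longleftrightarrow> ((k \<circ> h) x, (k \<circ> h) y) \<in> leq R"
      if "x \<in> vertices P" "y \<in> vertices P" for x y
      using that h k iso_map_in[OF P Q h] by (simp add: iso_map_def)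
    fix e assume "e \<in> edges P"
    then obtain v w where e: "e = (v, w)" "(v, w) \<in> edges P" by (cases e) auto
    note vw = edges_vertices[OF P e(2)]
    have "(h v, h w) \<in> edges Q"
      using iso_map_edges[OF P Q h, of v w] vw e(2) by blast
    then have "colour R (k (h v), k (h w)) = colour Q (h v, h w)"
      using k unfolding iso_map_def by blast
    also have "\<dots> = colour P (v, w)"
      using iso_map_colour[OF P Q h e(2)] .
    finally show "case e of (v, w) \<Rightarrow> colour R ((k \<circ> h) v, (k \<circ> h) w) = colour P (v, w)"
      using e(1) by simp
  qed
  then show ?thesis by (auto simp: coloured_poset_iso_iff)
qed

text \<open>Isomorphism is an equivalence relation on tree posets. For symmetry and transitivity the
  colours need care: they are compared on edges only, so edges must be carried to edges.\<close>

lemma tree_class_eq_iff: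
  assumes P: "coloured_tree_poset n P" and Q: "coloured_tree_poset n Q"
  shows "tree_class n P = tree_class n Q \<longleftrightarrow> coloured_poset_iso P Q"
proof
  assume "tree_class n P = tree_class n Q"
  then have "Q \<in> tree_class n P" using Q iso_refl by (simp add: tree_class_def)
  then show "coloured_poset_iso P Q" by (simp add: tree_class_def)
next
  assume "coloured_poset_iso P Q"
  then show "tree_class n P = tree_class n Q"
    using iso_trans[OF P Q] iso_trans[OF Q P] iso_sym[OF P Q] by (auto simp: tree_class_def)
qed

lemma branch_classes_iso:
  assumes P: "coloured_tree_poset n P" and Q: "coloured_tree_poset n Q" and "coloured_poset_iso P Q"
  shows "branch_classes n P i = branch_classes n Q i"
proof -
  from assms(3) obtain h where h: "iso_map P Q h" by (auto simp: coloured_poset_iso_iff)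
  note b = iso_map_children[OF P Q h, of i]
  have "branch_classes n P i =
      image_mset (\<lambda>w. tree_class n (subtree_at Q (h w))) (mset_set (children P i))"
    unfolding branch_classes_def
  proof (rule image_mset_cong)
    fix w assume "w \<in># mset_set (children P i)"
    then have w: "w \<in> vertices P"
      using finite_children[OF P] edges_vertices[OF P] by (auto simp: children_iff[OF P])
    then show "tree_class n (subtree_at P w) = tree_class n (subtree_at Q (h w))"
      using iso_map_subtree[OF P Q h w]
      by (subst tree_class_eq_iff[OF subtree_tree[OF P w] subtree_tree[OF Q iso_map_in[OF P Q h w]]])
        (auto simp: coloured_poset_iso_iff)
  qed
  also have "\<dots> = image_mset (\<lambda>w. tree_class n (subtree_at Q w)) (image_mset h (mset_set (children P i)))"
    by (simp add: multiset.map_comp comp_def)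
  also have "image_mset h (mset_set (children P i)) = mset_set (children Q i)"
    using b by (simp add: bij_betw_def image_mset_mset_set)
  finally show ?thesis by (simp add: branch_classes_def)
qed

section \<open>A tree is determined by its branches\<close>

lemma image_mset_set_eq_bij:
  assumes "finite A" "finite B" "image_mset f (mset_set A) = image_mset g (mset_set B)"
  shows "\<exists>k. bij_betw k A B \<and> (\<forall>a\<in>A. g (k a) = f a)"
  using assms
proof (induction A arbitrary: B)
  case empty
  then have "B = {}" by (simp add: mset_set_empty_iff)
  then show ?case by (auto simp: bij_betw_def)
next
  case (insert a A)
  have "f a \<in># image_mset g (mset_set B)"
    unfolding insert.prems(2)[symmetric] using insert.hyps by simp
  \<comment> \<open>\<open>f a\<close> occurs on the right, so \<open>a\<close> has a partner
    \<open>b\<close> of the same value; removing both leaves equal multisets.\<close>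
  then obtain b where b: "b \<in> B" "g b = f a" using insert.prems(1) by auto
  let ?B = "B - {b}"
  have B: "mset_set B = add_mset b (mset_set ?B)"
    using insert.prems(1) b(1) by (simp add: mset_set.remove)
  have "image_mset f (mset_set A) = image_mset g (mset_set ?B)"
    using insert.prems(2) insert.hyps b(2) unfolding B by simp
  from insert.IH[OF _ this] insert.prems(1)
  obtain k where k: "bij_betw k A ?B" "\<forall>a\<in>A. g (k a) = f a" by auto
  let ?k = "k(a := b)"
  have "bij_betw ?k A ?B" using k(1) insert.hyps by (subst bij_betw_cong[where g = k]) auto
  then have "bij_betw ?k (insert a A) (insert b ?B)"
    using notIn_Un_bij_betw[of a A ?k ?B] insert.hyps by simp
  moreover have "insert b ?B = B" using b(1) by auto
  ultimately have "bij_betw ?k (insert a A) B" by (simp only:)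
  moreover have "\<forall>c\<in>insert a A. g (?k c) = f c" using k(2) b(2) by simp
  ultimately show ?case by blast
qed

text \<open>Equal forests give, for each colour, a matching of the children under which the subtrees
  are isomorphic. Isomorphisms of the branches are then glued along the roots; the result respects
  the order because different branches are incomparable.\<close>

lemma branch_classes_inject:
  assumes P: "coloured_tree_poset n P" and Q: "coloured_tree_poset n Q"
    and eq: "\<And>i. i \<in> {1..n} \<Longrightarrow> branch_classes n P i = branch_classes n Q i"
  shows "coloured_poset_iso P Q"
proof -
  let ?r = "root_of P" and ?s = "root_of Q" and ?c = "child_below P" and ?d = "child_below Q"
  let ?kP = "{w. (?r, w) \<in> edges P}" and ?kQ = "{w. (?s, w) \<in> edges Q}"
  have vP: "w \<in> vertices P" if "w \<in> ?kP" for w using that edges_vertices[OF P] by blast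
  have vQ: "w \<in> vertices Q" if "w \<in> ?kQ" for w using that edges_vertices[OF Q] by blast
  have "\<exists>k. bij_betw k (children P i) (children Q i) \<and>
      (\<forall>w\<in>children P i. tree_class n (subtree_at Q (k w)) = tree_class n (subtree_at P w))"
    if "i \<in> {1..n}" for i
    using eq[OF that] unfolding branch_classes_def
    by (rule image_mset_set_eq_bij[OF finite_children[OF P] finite_children[OF Q]])
  then obtain k where k: "\<And>i. i \<in> {1..n} \<Longrightarrow> bij_betw (k i) (children P i) (children Q i)"
    "\<And>i w. i \<in> {1..n} \<Longrightarrow> w \<in> children P i \<Longrightarrow>
      tree_class n (subtree_at Q (k i w)) = tree_class n (subtree_at P w)"
    by metis
  \<comment> \<open>The matchings for the single colours combine to one map on all children of the
    root: the colour of the edge to \<open>w\<close> selects the matching that is used.\<close>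
  define j where "j w = k (colour P (?r, w)) w" for w
  have j: "j w \<in> ?kQ" "colour Q (?s, j w) = colour P (?r, w)"
    "coloured_poset_iso (subtree_at P w) (subtree_at Q (j w))" if w: "w \<in> ?kP" for w
  proof -
    let ?i = "colour P (?r, w)"
    have i: "?i \<in> {1..n}" using w tree_colour[OF P] by blast
    have wi: "w \<in> children P ?i" using w by (simp add: children_iff[OF P])
    have "j w \<in> children Q ?i" unfolding j_def using k(1)[OF i] wi by (auto simp: bij_betw_def)
    then show jw: "j w \<in> ?kQ" and "colour Q (?s, j w) = ?i" by (auto simp: children_iff[OF Q])
    have "tree_class n (subtree_at P w) = tree_class n (subtree_at Q (j w))"
      unfolding j_def using k(2)[OF i wi] ..
    then show "coloured_poset_iso (subtree_at P w) (subtree_at Q (j w))"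
      using tree_class_eq_iff[OF subtree_tree[OF P vP[OF w]] subtree_tree[OF Q vQ[OF jw]]] by blast
  qed
  \<comment> \<open>\<open>j\<close> preserves the colour of the edge at the root, so two children
    with the same image were matched by the same \<open>k i\<close>, which is injective.\<close>
  have j_inj: "w = w'" if w: "w \<in> ?kP" and w': "w' \<in> ?kP" and "j w = j w'" for w w'
  proof -
    let ?i = "colour P (?r, w)"
    have "?i = colour P (?r, w')" using j(2)[OF w] j(2)[OF w'] that(3) by simp
    moreover have i: "?i \<in> {1..n}" using w tree_colour[OF P] by blast
    ultimately show ?thesis
      using k(1)[OF i] w w' that(3) unfolding j_def bij_betw_def inj_on_def
      by (auto simp: children_iff[OF P])
  qed
  have j_surj: "\<exists>w\<in>?kP. j w = v" if v: "v \<in> ?kQ" for v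
  proof -
    let ?i = "colour Q (?s, v)"
    have i: "?i \<in> {1..n}" using v tree_colour[OF Q] by blast
    have "v \<in> children Q ?i" using v by (simp add: children_iff[OF Q])
    then obtain w where "w \<in> children P ?i" "v = k ?i w"
      using k(1)[OF i] by (auto simp: bij_betw_def)
    then show ?thesis by (intro bexI[of _ w]) (auto simp: children_iff[OF P] j_def)
  qed
  from j(3) obtain g where g: "\<And>w. w \<in> ?kP \<Longrightarrow> iso_map (subtree_at P w) (subtree_at Q (j w)) (g w)"
    unfolding coloured_poset_iso_iff by metis
  \<comment> \<open>Root goes to root, and each branch is mapped by the isomorphism chosen for it;
    \<open>?c x\<close> names the branch of \<open>x\<close>.\<close>
  define h where "h x = (if x = ?r then ?s else g (?c x) x)" for x
  have cP: "?c x \<in> ?kP" "x \<in> vertices (subtree_at P (?c x))" if "x \<in> vertices P" "x \<noteq> ?r" for x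
    using child_below[OF P that] that by auto
  have dQ: "?d y \<in> ?kQ" "y \<in> vertices (subtree_at Q (?d y))" if "y \<in> vertices Q" "y \<noteq> ?s" for y
    using child_below[OF Q that] that by auto
  have h: "h x \<in> vertices Q" "h x \<noteq> ?s" "?d (h x) = j (?c x)" "h x = g (?c x) x"
    if x: "x \<in> vertices P" "x \<noteq> ?r" for x
  proof -
    note c = cP[OF x]
    show hx: "h x = g (?c x) x" using x by (simp add: h_def)
    have "h x \<in> vertices (subtree_at Q (j (?c x)))"
      using g[OF c(1)] c(2) unfolding hx iso_map_def bij_betw_def by blast
    then have l: "h x \<in> vertices Q" "(j (?c x), h x) \<in> leq Q" by auto
    then show "h x \<in> vertices Q" by simp
    have jc: "(?s, j (?c x)) \<in> edges Q" using j(1)[OF c(1)] by simp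
    then have "j (?c x) \<noteq> ?s" by (simp add: root_edge_iff[OF Q])
    then show "h x \<noteq> ?s" using child_below_leq(1)[OF Q l(2)] by simp
    show "?d (h x) = j (?c x)" by (rule child_below_eqI[OF Q jc l(2)])
  qed
  have hr: "h ?r = ?s" by (simp add: h_def)
  have inj: "inj_on h (vertices P)"
  proof (rule inj_onI)
    fix x y assume x: "x \<in> vertices P" and y: "y \<in> vertices P" and e: "h x = h y"
    show "x = y"
    proof (cases "x = ?r \<or> y = ?r")
      case True
      then show ?thesis using h(2) x y e hr by metis
    next
      case False
      then have xr: "x \<noteq> ?r" and yr: "y \<noteq> ?r" by auto
      have c: "?c x = ?c y"
        by (rule j_inj) (use cP(1)[OF x xr] cP(1)[OF y yr] h(3)[OF x xr] h(3)[OF y yr] e in auto)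
      have "inj_on (g (?c x)) (vertices (subtree_at P (?c x)))"
        using g[OF cP(1)[OF x xr]] unfolding iso_map_def bij_betw_def by blast
      then show ?thesis
        using e h(4)[OF x xr] h(4)[OF y yr] cP(2)[OF x xr] cP(2)[OF y yr] c by (auto dest: inj_onD)
    qed
  qed
  have surj: "h ` vertices P = vertices Q"
  proof
    show "h ` vertices P \<subseteq> vertices Q"
    proof (rule image_subsetI)
      show "h x \<in> vertices Q" if "x \<in> vertices P" for x
        using h(1)[OF that] hr root_in[OF Q] by (cases "x = ?r") auto
    qed
    show "vertices Q \<subseteq> h ` vertices P"
    proof
      fix y assume y: "y \<in> vertices Q"
      show "y \<in> h ` vertices P"
      proof (cases "y = ?s")
        case True
        then show ?thesis using hr root_in[OF P] by (metis imageI)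
      next
        case False
        note d = dQ[OF y False]
        from j_surj[OF d(1)] obtain w where w: "w \<in> ?kP" "j w = ?d y" by blast
        have "y \<in> g w ` vertices (subtree_at P w)"
          using g[OF w(1)] d(2) unfolding iso_map_def bij_betw_def w(2) by blast
        then obtain x where x: "y = g w x" "x \<in> vertices P" "(w, x) \<in> leq P" by auto
        have "(?r, w) \<in> edges P" using w(1) by simp
        then have "?c x = w" "x \<noteq> ?r"
          using x(3) child_below_eqI[OF P] child_below_leq(1)[OF P x(3)] by (auto simp: root_edge_iff[OF P])
        then have "h x = y" using x(1) h(4)[OF x(2)] by simp
        with x(2) show ?thesis by blast
      qed
    qed
  qed
  have leq: "(x, y) \<in> leq P \<longleftrightarrow> (h x, h y) \<in> leq Q" if x: "x \<in> vertices P" and y: "y \<in> vertices P" for x y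
  proof (cases "x = ?r")
    case True
    have "h y \<in> vertices Q" using surj y by blast
    then show ?thesis using True hr root_leq[OF P y] root_leq[OF Q] by simp
  next
    case xr: False
    show ?thesis
    proof (cases "y = ?r")
      case True
      then show ?thesis
        using xr root_least[OF P] root_least[OF Q] h(2)[OF x xr] hr by metis
    next
      case yr: False
      show ?thesis
      \<comment> \<open>Within one branch the order is transported by the chosen isomorphism; across
        two branches neither side holds.\<close>
      proof (cases "?c x = ?c y")
        case True
        have "(x, y) \<in> leq (subtree_at P (?c x)) \<longleftrightarrow> (h x, h y) \<in> leq (subtree_at Q (j (?c x)))"
          using g[OF cP(1)[OF x xr]] cP(2)[OF x xr] cP(2)[OF y yr]
          unfolding h(4)[OF x xr] h(4)[OF y yr] True iso_map_def by blast
        moreover have "h x \<in> vertices (subtree_at Q (j (?c x)))" "h y \<in> vertices (subtree_at Q (j (?c x)))"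
          using dQ(2)[OF h(1,2)[OF x xr]] dQ(2)[OF h(1,2)[OF y yr]] h(3)[OF x xr] h(3)[OF y yr] True
          by simp_all
        ultimately show ?thesis
          using cP(2)[OF x xr] cP(2)[OF y yr] True by simp
      next
        case False
        then have "(x, y) \<notin> leq P" using child_below_leq(2)[OF P _ xr] by metis
        moreover have "(h x, h y) \<notin> leq Q"
        proof
          assume "(h x, h y) \<in> leq Q"
          from child_below_leq(2)[OF Q this h(2)[OF x xr]] have "j (?c x) = j (?c y)"
            using h(3)[OF x xr] h(3)[OF y yr] by simp
          then show False using j_inj[OF cP(1)[OF x xr] cP(1)[OF y yr]] False by simp
        qed
        ultimately show ?thesis by simp
      qed
    qed
  qed
  \<comment> \<open>The isomorphism of two branches sends root to root, so \<open>h\<close> agrees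
    with the matching \<open>j\<close> on the children. This settles the colours of the edges at the
    root, which are those that no branch contains.\<close>
  have root_child: "h w = j w" if w: "w \<in> ?kP" for w
  proof -
    have wv: "w \<in> vertices P" "w \<noteq> ?r" using w by (auto simp: root_edge_iff[OF P])
    have cw: "?c w = w" by (rule child_below_eqI[OF P]) (use w wv tree_refl[OF P] in auto)
    have P': "coloured_tree_poset n (subtree_at P w)" by (rule subtree_tree[OF P wv(1)])
    have jw: "j w \<in> vertices Q" by (rule vQ[OF j(1)[OF w]])
    have Q': "coloured_tree_poset n (subtree_at Q (j w))" by (rule subtree_tree[OF Q jw])
    have "root_of (subtree_at P w) = w" "root_of (subtree_at Q (j w)) = j w"
      using is_root_iff[OF P', of w] is_root_iff[OF Q', of "j w"]
        subtree_is_root[OF P wv(1)] subtree_is_root[OF Q jw] by simp_all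
    then show ?thesis
      using iso_map_root[OF P' Q' g[OF w]] h(4)[OF wv] cw by simp
  qed
  have colour: "colour Q (h v, h w) = colour P (v, w)" if e: "(v, w) \<in> edges P" for v w
  proof (cases "v = ?r")
    case True
    then show ?thesis using e hr root_child[of w] j(2)[of w] by simp
  next
    case False
    have v: "v \<in> vertices P" and w: "w \<in> vertices P" using edges_vertices[OF P e] by auto
    have l: "(v, w) \<in> leq P" using e by (auto simp: edges_iff less_in_def)
    note c = child_below_leq[OF P l False]
    have "(v, w) \<in> edges (subtree_at P (?c v))"
      using e cP[OF v False] by (simp add: subtree_edges[OF P vP[OF cP(1)[OF v False]]])
    then show ?thesis
      using g[OF cP(1)[OF v False]] h(4)[OF v False] h(4)[OF w c(1)] c(2)
      unfolding iso_map_def by auto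
  qed
  have "iso_map P Q h"
    unfolding iso_map_def bij_betw_def using inj surj leq colour by auto
  then show ?thesis by (auto simp: coloured_poset_iso_iff)
qed

text \<open>The posets \<open>\<rho> j\<close> with \<open>j < N\<close> are joined to the new root \<open>0\<close> by edges of colour \<open>\<kappa> j\<close>;
  \<open>graft_vertex j x\<close> stands for the vertex \<open>x\<close> of \<open>\<rho> j\<close>.\<close>

definition graft_vertex :: "nat \<Rightarrow> nat \<Rightarrow> nat" where
  "graft_vertex j x = Suc (prod_encode (j, x))"

lemma graft_vertex_simps [simp]:
  "graft_vertex j x = graft_vertex j' x' \<longleftrightarrow> j = j' \<and> x = x'"
  "graft_vertex j x \<noteq> 0" "0 \<noteq> graft_vertex j x"
  "prod_decode (graft_vertex j x - Suc 0) = (j, x)"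
  by (simp_all add: graft_vertex_def)

lemma graft_vertex_cases:
  obtains "v = 0" | j x where "v = graft_vertex j x"
proof (cases v)
  case (Suc m)
  obtain j x where "prod_decode m = (j, x)" by (cases "prod_decode m")
  then have "v = graft_vertex j x"
    unfolding Suc graft_vertex_def by (metis prod_decode_inverse)
  then show ?thesis using that by blast
qed (use that in blast)

section \<open>Grafting trees to a new root\<close>

context
  fixes n N :: nat and \<kappa> :: "nat \<Rightarrow> nat" and \<rho> :: "nat \<Rightarrow> coloured_poset"
  assumes \<kappa>: "\<And>j. j < N \<Longrightarrow> \<kappa> j \<in> {1..n}" and \<rho>: "\<And>j. j < N \<Longrightarrow> coloured_tree_poset n (\<rho> j)"
begin

text \<open>Colours need only be right on edges, so an edge between two old vertices takes its
  colour from the poset of its first end: both ends lie in the same \<open>\<rho> j\<close>.\<close>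

definition graft_poset :: coloured_poset where
  "graft_poset =
     \<lparr>vertices = insert 0 {graft_vertex j x | j x. j < N \<and> x \<in> vertices (\<rho> j)},
      leq = {(0, y) | y. y \<in> insert 0 {graft_vertex j x | j x. j < N \<and> x \<in> vertices (\<rho> j)}} \<union>
        {(graft_vertex j x, graft_vertex j y) | j x y. j < N \<and> (x, y) \<in> leq (\<rho> j)},
      colour = (\<lambda>(a, b). let (j, x) = prod_decode (a - 1); (k, y) = prod_decode (b - 1) in
        if a = 0 then \<kappa> k else colour (\<rho> j) (x, y))\<rparr>"

lemma graft_vertices: "0 \<in> vertices graft_poset"
  "graft_vertex j x \<in> vertices graft_poset \<longleftrightarrow> j < N \<and> x \<in> vertices (\<rho> j)"
  by (auto simp: graft_poset_def)

lemma graft_leq: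
  "(0, y) \<in> leq graft_poset \<longleftrightarrow> y \<in> vertices graft_poset"
  "(graft_vertex j x, 0) \<notin> leq graft_poset"
  "(graft_vertex j x, graft_vertex k y) \<in> leq graft_poset \<longleftrightarrow> j = k \<and> j < N \<and> (x, y) \<in> leq (\<rho> j)"
  by (auto simp: graft_poset_def)

lemma graft_colour:
  "colour graft_poset (0, graft_vertex j x) = \<kappa> j"
  "colour graft_poset (graft_vertex j x, graft_vertex j y) = colour (\<rho> j) (x, y)"
  by (simp_all add: graft_poset_def)

lemma graft_less:
  "less_in graft_poset 0 (graft_vertex j x) \<longleftrightarrow> j < N \<and> x \<in> vertices (\<rho> j)"
  "\<not> less_in graft_poset v 0"
  "less_in graft_poset (graft_vertex j x) (graft_vertex k y) \<longleftrightarrow> j = k \<and> j < N \<and> less_in (\<rho> j) x y"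
  by (auto simp: less_in_def graft_leq graft_vertices intro: graft_vertex_cases[of v])

lemma graft_edges:
  "(0, graft_vertex j x) \<in> edges graft_poset \<longleftrightarrow> j < N \<and> x = root_of (\<rho> j)"
  "(v, 0) \<notin> edges graft_poset"
  "(graft_vertex j x, graft_vertex k y) \<in> edges graft_poset \<longleftrightarrow> j = k \<and> j < N \<and> (x, y) \<in> edges (\<rho> j)"
proof -
  \<comment> \<open>Nothing lies below the new root, so a vertex strictly above another one is
    always a \<open>graft_vertex\<close>.\<close>
  have ex: "(\<exists>v. less_in graft_poset u v \<and> Q v) \<longleftrightarrow>
      (\<exists>i z. less_in graft_poset u (graft_vertex i z) \<and> Q (graft_vertex i z))" for u Q
    using graft_less(2) graft_vertex_cases by metis
  have "x = root_of (\<rho> j) \<longleftrightarrow> x \<in> vertices (\<rho> j) \<and> \<not> (\<exists>z. z \<in> vertices (\<rho> j) \<and> less_in (\<rho> j) z x)"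
    if "j < N"
    using root_in[OF \<rho>[OF that]] root_leq[OF \<rho>[OF that]] root_least[OF \<rho>[OF that]]
    unfolding less_in_def by metis
  then show "(0, graft_vertex j x) \<in> edges graft_poset \<longleftrightarrow> j < N \<and> x = root_of (\<rho> j)"
    unfolding edges_iff ex graft_less by blast
  show "(v, 0) \<notin> edges graft_poset" by (simp add: edges_iff graft_less)
  show "(graft_vertex j x, graft_vertex k y) \<in> edges graft_poset \<longleftrightarrow> j = k \<and> j < N \<and> (x, y) \<in> edges (\<rho> j)"
    unfolding edges_iff ex graft_less by blast
qed

lemma graft_tree: "coloured_tree_poset n graft_poset"
  unfolding coloured_tree_poset_def
proof (intro conjI)
  have "vertices graft_poset = insert 0 (\<Union>j\<in>{..<N}. graft_vertex j ` vertices (\<rho> j))"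
    by (auto simp: graft_poset_def)
  then show "finite (vertices graft_poset)" using tree_finite[OF \<rho>] by simp
  have "leq graft_poset \<subseteq> vertices graft_poset \<times> vertices graft_poset"
    using tree_leq_vertices[OF \<rho>] by (auto simp: graft_poset_def)
  moreover have "refl_on (vertices graft_poset) (leq graft_poset)"
    using tree_refl[OF \<rho>] by (auto simp: graft_poset_def refl_on_def)
  moreover have "trans (leq graft_poset)"
  proof (rule transI)
    fix a b c assume ab: "(a, b) \<in> leq graft_poset" and bc: "(b, c) \<in> leq graft_poset"
    show "(a, c) \<in> leq graft_poset"
    proof (cases a rule: graft_vertex_cases)
      case 1
      then show ?thesis using bc tree_leq_vertices[OF \<rho>] by (auto simp: graft_poset_def)
    next
      case a: (2 j x)
      with ab obtain y where "b = graft_vertex j y"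
        by (cases b rule: graft_vertex_cases) (auto simp: graft_leq)
      moreover from this bc obtain z where "c = graft_vertex j z"
        by (cases c rule: graft_vertex_cases) (auto simp: graft_leq)
      ultimately show ?thesis using a ab bc tree_trans[OF \<rho>] by (auto simp: graft_leq)
    qed
  qed
  moreover have "antisym (leq graft_poset)"
  proof (rule antisymI)
    fix a b assume ab: "(a, b) \<in> leq graft_poset" "(b, a) \<in> leq graft_poset"
    show "a = b"
    proof (cases a rule: graft_vertex_cases)
      case 1
      with ab show ?thesis by (cases b rule: graft_vertex_cases) (auto simp: graft_leq)
    next
      case (2 j x)
      with ab show ?thesis
        by (cases b rule: graft_vertex_cases) (auto simp: graft_leq intro: tree_antisym[OF \<rho>])
    qed
  qed
  ultimately show "partial_order_on (vertices graft_poset) (leq graft_poset)"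
    by (simp add: partial_order_on_def preorder_on_def)
  have "is_root graft_poset 0"
    by (auto simp: is_root_def less_in_def graft_leq graft_vertices)
  then show "\<exists>r. is_root graft_poset r" by blast
  show "\<forall>x y z. y \<noteq> z \<and> less_in graft_poset y x \<and> less_in graft_poset z x \<longrightarrow>
      less_in graft_poset y z \<or> less_in graft_poset z y"
  proof (intro allI impI; elim conjE)
    fix a b c assume bc: "b \<noteq> c" and ba: "less_in graft_poset b a" and ca: "less_in graft_poset c a"
    obtain j x where a: "a = graft_vertex j x"
      using ba graft_less(2) by (cases a rule: graft_vertex_cases) auto
    \<comment> \<open>The new root is comparable with everything; two old vertices below
      \<open>a\<close> lie in the same \<open>\<rho> j\<close> as \<open>a\<close>, where the tree
      condition is known.\<close>
    show "less_in graft_poset b c \<or> less_in graft_poset c b"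
    proof (cases b rule: graft_vertex_cases)
      case b: 1
      then show ?thesis using bc ca less_vertices[OF \<rho>]
        by (cases c rule: graft_vertex_cases) (auto simp: a graft_less)
    next
      case b: (2 k y)
      then show ?thesis
      proof (cases c rule: graft_vertex_cases)
        case 1
        then show ?thesis using b ba less_vertices[OF \<rho>] by (auto simp: a graft_less)
      next
        case (2 l z)
        then show ?thesis using b bc ba ca tree_condition[OF \<rho>, of j y z x] by (auto simp: a graft_less)
      qed
    qed
  qed
  show "\<forall>e\<in>edges graft_poset. colour graft_poset e \<in> {1..n}"
  proof (rule ballI)
    fix e assume e: "e \<in> edges graft_poset"
    obtain a b where ab: "e = (a, b)" by (cases e)
    from e obtain k y where b: "b = graft_vertex k y"
      by (cases b rule: graft_vertex_cases) (auto simp: ab graft_edges)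
    show "colour graft_poset e \<in> {1..n}"
    proof (cases a rule: graft_vertex_cases)
      case 1
      then show ?thesis using e \<kappa> unfolding ab b by (simp only: graft_edges graft_colour)
    next
      case (2 j x)
      then have "j = k" "j < N" "(x, y) \<in> edges (\<rho> j)"
        using e 2 unfolding ab b by (auto simp: graft_edges)
      then show ?thesis
        using tree_colour[OF \<rho>] 2 unfolding ab b by (simp only: graft_colour)
    qed
  qed
qed

lemma graft_root: "root_of graft_poset = 0"
proof -
  have "is_root graft_poset 0"
    by (auto simp: is_root_def less_in_def graft_leq graft_vertices)
  then show ?thesis by (simp add: is_root_iff[OF graft_tree])
qed

lemma graft_children:
  "children graft_poset i = (\<lambda>j. graft_vertex j (root_of (\<rho> j))) ` {j. j < N \<and> \<kappa> j = i}"
proof -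
  have "w \<in> children graft_poset i \<longleftrightarrow> (\<exists>j. w = graft_vertex j (root_of (\<rho> j)) \<and> j < N \<and> \<kappa> j = i)" for w
    unfolding children_iff[OF graft_tree] graft_root
    by (cases w rule: graft_vertex_cases) (auto simp: graft_edges graft_colour)
  then show ?thesis by blast
qed

lemma graft_subtree:
  assumes j: "j < N"
  shows "iso_map (\<rho> j) (subtree_at graft_poset (graft_vertex j (root_of (\<rho> j)))) (graft_vertex j)"
proof -
  let ?S = "subtree_at graft_poset (graft_vertex j (root_of (\<rho> j)))"
  have "v \<in> vertices ?S \<longleftrightarrow> v \<in> graft_vertex j ` vertices (\<rho> j)" for v
    using j root_leq[OF \<rho>[OF j]] tree_leq_vertices[OF \<rho>[OF j]]
    by (cases v rule: graft_vertex_cases) (auto simp: graft_leq graft_vertices)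
  then have V: "vertices ?S = graft_vertex j ` vertices (\<rho> j)" by blast
  then have "bij_betw (graft_vertex j) (vertices (\<rho> j)) (vertices ?S)"
    by (simp add: bij_betw_def inj_on_def)
  moreover have "(x, y) \<in> leq (\<rho> j) \<longleftrightarrow> (graft_vertex j x, graft_vertex j y) \<in> leq ?S"
    if "x \<in> vertices (\<rho> j)" "y \<in> vertices (\<rho> j)" for x y
    unfolding subtree_at_simps(2) V using that j by (auto simp: graft_leq)
  moreover have "colour ?S (graft_vertex j x, graft_vertex j y) = colour (\<rho> j) (x, y)" for x y
    by (simp only: subtree_at_simps graft_colour)
  ultimately show ?thesis unfolding iso_map_def by blast
qed

lemma graft_branch_classes:
  "branch_classes n graft_poset i = image_mset (\<lambda>j. tree_class n (\<rho> j)) (mset_set {j. j < N \<and> \<kappa> j = i})"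
proof -
  let ?J = "{j. j < N \<and> \<kappa> j = i}" and ?e = "\<lambda>j. graft_vertex j (root_of (\<rho> j))"
  have "inj_on ?e ?J" by (simp add: inj_on_def)
  then have "branch_classes n graft_poset i =
      image_mset (\<lambda>j. tree_class n (subtree_at graft_poset (?e j))) (mset_set ?J)"
    unfolding branch_classes_def graft_children
    by (simp add: multiset.map_comp comp_def flip: image_mset_mset_set)
  also have "\<dots> = image_mset (\<lambda>j. tree_class n (\<rho> j)) (mset_set ?J)"
  proof (rule image_mset_cong)
    fix j assume "j \<in># mset_set ?J"
    then have j: "j < N" by simp
    have e: "?e j \<in> vertices graft_poset"
      using j root_in[OF \<rho>[OF j]] by (simp add: graft_vertices)
    have "coloured_poset_iso (\<rho> j) (subtree_at graft_poset (?e j))"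
      unfolding coloured_poset_iso_iff by (rule exI, rule graft_subtree[OF j])
    then show "tree_class n (subtree_at graft_poset (?e j)) = tree_class n (\<rho> j)"
      using tree_class_eq_iff[OF \<rho>[OF j] subtree_tree[OF graft_tree e]] by simp
  qed
  finally show ?thesis .
qed

end

lemma branch_classes_surj:
  assumes F: "\<And>i. i \<in> {1..n} \<Longrightarrow> set_mset (F i) \<subseteq> coloured_trees n"
  shows "\<exists>P. coloured_tree_poset n P \<and> (\<forall>i\<in>{1..n}. branch_classes n P i = F i)"
proof -
  \<comment> \<open>All trees of all forests go into one list, each tagged with its colour.
    Positions in the list index the posets to be grafted, so repeated trees yield disjoint
    copies.\<close>
  let ?M = "\<Sum>i\<in>{1..n}. image_mset (Pair i) (F i)"
  obtain xs where xs: "mset xs = ?M" using ex_mset by blast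
  have M: "i \<in> {1..n} \<and> t \<in># F i" if "(i, t) \<in># ?M" for i t
    using that by (auto simp: set_mset_sum)
  have in_M: "fst (xs ! j) \<in> {1..n} \<and> snd (xs ! j) \<in> coloured_trees n" if "j < length xs" for j
  proof -
    have "xs ! j \<in># ?M" unfolding xs[symmetric] using that by simp
    then show ?thesis using M[of "fst (xs ! j)" "snd (xs ! j)"] F by auto
  qed
  define \<rho> where "\<rho> j = (SOME P. coloured_tree_poset n P \<and> tree_class n P = snd (xs ! j))" for j
  have \<rho>: "coloured_tree_poset n (\<rho> j) \<and> tree_class n (\<rho> j) = snd (xs ! j)" if "j < length xs" for j
    unfolding \<rho>_def
    by (rule someI_ex) (use in_M[OF that] in \<open>auto simp: coloured_trees_def\<close>)
  define G where "G = graft_poset (length xs) (\<lambda>j. fst (xs ! j)) \<rho>"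
  have tree: "coloured_tree_poset n G"
    unfolding G_def by (rule graft_tree) (use \<rho> in_M in auto)
  have "branch_classes n G i = F i" if i: "i \<in> {1..n}" for i
  proof -
    let ?J = "{j. j < length xs \<and> fst (xs ! j) = i}"
    have J: "?J = {j \<in> {0..<length xs}. fst (xs ! j) = i}" by auto
    have mx: "mset xs = image_mset ((!) xs) (mset_set {0..<length xs})"
      by (metis map_nth mset_map mset_upt)
    have "branch_classes n G i = image_mset (\<lambda>j. tree_class n (\<rho> j)) (mset_set ?J)"
      unfolding G_def by (rule graft_branch_classes) (use \<rho> in_M in auto)
    also have "\<dots> = image_mset (\<lambda>j. snd (xs ! j)) (mset_set ?J)"
      by (rule image_mset_cong) (use \<rho> in auto)
    also have "\<dots> = image_mset snd (filter_mset (\<lambda>p. fst p = i) (mset xs))"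
      unfolding mx J by (simp add: filter_mset_image_mset multiset.map_comp comp_def)
    also have "\<dots> = (if i \<in> {1..n} then F i else {#})"
    proof -
      \<comment> \<open>The colours \<open>{1..n}\<close> are replaced by any finite set to allow
        induction: filtering by the tag \<open>i\<close> keeps just the summand of
        \<open>i\<close>.\<close>
      have "image_mset snd (filter_mset (\<lambda>p. fst p = i) (\<Sum>k\<in>A. image_mset (Pair k) (F k))) =
          (if i \<in> A then F i else {#})" if "finite A" for A
        using that
      proof (induction A)
        case (insert k A)
        then show ?case
          by (auto simp: filter_mset_image_mset multiset.map_comp comp_def)
      qed simp
      then show ?thesis unfolding xs by blast
    qed
    finally show ?thesis using i by simp
  qed
  with tree show ?thesis by blast
qed

section \<open>Isomorphism classes of trees as tuples of forests\<close>

definition tree_rep :: "nat \<Rightarrow> coloured_tree \<Rightarrow> coloured_poset" where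
  "tree_rep n t = (SOME P. coloured_tree_poset n P \<and> tree_class n P = t)"

lemma tree_rep:
  assumes "t \<in> coloured_trees n"
  shows "coloured_tree_poset n (tree_rep n t)" "tree_class n (tree_rep n t) = t"
proof -
  from assms have "\<exists>P. coloured_tree_poset n P \<and> tree_class n P = t"
    by (auto simp: coloured_trees_def)
  from someI_ex[OF this] show "coloured_tree_poset n (tree_rep n t)" "tree_class n (tree_rep n t) = t"
    by (simp_all add: tree_rep_def)
qed

definition tree_branches :: "nat \<Rightarrow> coloured_tree \<Rightarrow> nat \<Rightarrow> coloured_tree multiset" where
  "tree_branches n t = branch_classes n (tree_rep n t)"

definition tree_size :: "nat \<Rightarrow> coloured_tree \<Rightarrow> nat" where
  "tree_size n t = card (vertices (tree_rep n t))"

lemma tree_class_in: "coloured_tree_poset n P \<Longrightarrow> tree_class n P \<in> coloured_trees n"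
  by (auto simp: coloured_trees_def)

lemma tree_rep_iso:
  assumes "coloured_tree_poset n P"
  shows "coloured_poset_iso (tree_rep n (tree_class n P)) P"
  using tree_rep[OF tree_class_in[OF assms]] assms by (simp flip: tree_class_eq_iff)

text \<open>The chosen representative is isomorphic to \<open>P\<close>, and isomorphic trees have
  the same branch classes, so the choice does not matter.\<close>

lemma tree_branches_class:
  assumes "coloured_tree_poset n P"
  shows "tree_branches n (tree_class n P) = branch_classes n P"
  unfolding tree_branches_def
  using branch_classes_iso[OF tree_rep(1)[OF tree_class_in[OF assms]] assms tree_rep_iso[OF assms]]
  by blast

lemma tree_size_class:
  assumes "coloured_tree_poset n P"
  shows "tree_size n (tree_class n P) = card (vertices P)"
  using tree_rep_iso[OF assms] unfolding tree_size_def coloured_poset_iso_def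
  by (auto intro: bij_betw_same_card)

lemma branch_classes_subset:
  assumes P: "coloured_tree_poset n P" and t: "t \<in># branch_classes n P i"
  shows "t \<in> coloured_trees n" "tree_size n t < card (vertices P)"
proof -
  from t obtain w where w: "w \<in> children P i" "t = tree_class n (subtree_at P w)"
    using finite_children[OF P] by (auto simp: branch_classes_def)
  have S: "coloured_tree_poset n (subtree_at P w)"
    using w(1) edges_vertices[OF P] by (intro subtree_tree[OF P]) (auto simp: children_iff[OF P])
  show "t \<in> coloured_trees n" unfolding w(2) by (rule tree_class_in[OF S])
  show "tree_size n t < card (vertices P)"
    unfolding w(2) tree_size_class[OF S] by (rule subtree_card_less[OF P w(1)])
qed

lemma tree_branches_subset:
  assumes "t \<in> coloured_trees n" "u \<in># tree_branches n t i"
  shows "u \<in> coloured_trees n" "tree_size n u < tree_size n t"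
  using branch_classes_subset[OF tree_rep(1)[OF assms(1)], of u i] assms(2)
  by (simp_all add: tree_branches_def tree_size_def)

lemma tree_branches_inject:
  assumes "s \<in> coloured_trees n" "t \<in> coloured_trees n"
    and "\<And>i. i \<in> {1..n} \<Longrightarrow> tree_branches n s i = tree_branches n t i"
  shows "s = t"
proof -
  note s = tree_rep[OF assms(1)] and t = tree_rep[OF assms(2)]
  have "coloured_poset_iso (tree_rep n s) (tree_rep n t)"
    by (rule branch_classes_inject[OF s(1) t(1)]) (use assms(3) in \<open>simp add: tree_branches_def\<close>)
  then show ?thesis using tree_class_eq_iff[OF s(1) t(1)] s(2) t(2) by simp
qed

text \<open>Together with \<open>tree_branches_inject\<close> this makes trees correspond to
  families of forests indexed by \<open>{1..n}\<close>. For \<open>n = 0\<close> there is one such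
  family, and one tree, the single vertex.\<close>

lemma tree_branches_surj:
  assumes "\<And>i. i \<in> {1..n} \<Longrightarrow> set_mset (F i) \<subseteq> coloured_trees n"
  obtains t where "t \<in> coloured_trees n" "\<And>i. i \<in> {1..n} \<Longrightarrow> tree_branches n t i = F i"
proof -
  from branch_classes_surj[of n F, OF assms] obtain P where
    P: "coloured_tree_poset n P" "\<forall>i\<in>{1..n}. branch_classes n P i = F i" by blast
  show thesis
    by (rule that[OF tree_class_in[OF P(1)]]) (simp add: tree_branches_class[OF P(1)] P(2))
qed

section \<open>Multilinear maps out of a symmetric algebra on a free module\<close>

context
  fixes K :: "('k, 'm) ring_scheme" and n :: nat and X :: "'x set" and N :: "('k, 'b) module"
    and g :: "(nat \<Rightarrow> 'x) \<Rightarrow> 'b"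
  assumes N: "module K N" and g: "g \<in> ({1..n} \<rightarrow>\<^sub>E X) \<rightarrow> carrier N"
begin

interpretation module K N by (fact N)

private abbreviation (input) "FX \<equiv> free_module K X"

text \<open>The expansion of a multilinear map in a basis: \<open>m\<close> picks a basis vector in
  each slot, and the coefficients multiply. On tuples from the free module the index set is finite,
  since each slot has finite support.\<close>

private definition multi_ext :: "(nat \<Rightarrow> 'x \<Rightarrow> 'k) \<Rightarrow> 'b" where
  "multi_ext f = (\<Oplus>\<^bsub>N\<^esub>m\<in>(\<Pi>\<^sub>E i\<in>{1..n}. {x. f i x \<noteq> \<zero>\<^bsub>K\<^esub>}). (\<Otimes>\<^bsub>K\<^esub>i\<in>{1..n}. f i (m i)) \<odot>\<^bsub>N\<^esub> g m)"

private lemma coeff_closed: "f \<in> tuples n FX \<Longrightarrow> i \<in> {1..n} \<Longrightarrow> f i x \<in> carrier K"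
  using tuples_component[of f n FX i] by (simp add: free_module_carrier)

private lemma weight_closed: "f \<in> tuples n FX \<Longrightarrow> J \<subseteq> {1..n} \<Longrightarrow> (\<Otimes>\<^bsub>K\<^esub>i\<in>J. f i (m i)) \<in> carrier K"
  by (rule R.finprod_closed) (use coeff_closed in blast)

text \<open>If \<open>m\<close> picks a basis vector outside the support of its slot, the product of
  coefficients has a zero factor. Hence all slots may range over one finite set \<open>U\<close>,
  which can stay fixed while a slot varies.\<close>

private lemma multi_ext_eq:
  assumes f: "f \<in> tuples n FX" and U: "finite U" "U \<subseteq> X" "\<And>i. i \<in> {1..n} \<Longrightarrow> {x. f i x \<noteq> \<zero>\<^bsub>K\<^esub>} \<subseteq> U"
  shows "multi_ext f = (\<Oplus>\<^bsub>N\<^esub>m\<in>{1..n} \<rightarrow>\<^sub>E U. (\<Otimes>\<^bsub>K\<^esub>i\<in>{1..n}. f i (m i)) \<odot>\<^bsub>N\<^esub> g m)"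
  unfolding multi_ext_def
proof (rule M.add.finprod_mono_neutral_cong_left)
  show "finite ({1..n} \<rightarrow>\<^sub>E U)" using U(1) by (intro finite_PiE) auto
  show "(\<Pi>\<^sub>E i\<in>{1..n}. {x. f i x \<noteq> \<zero>\<^bsub>K\<^esub>}) \<subseteq> {1..n} \<rightarrow>\<^sub>E U" using U(3) by (rule PiE_mono)
  have gc: "g m \<in> carrier N" if "m \<in> {1..n} \<rightarrow>\<^sub>E U" for m
    using g that U(2) PiE_mono[of "{1..n}" "\<lambda>_. U" "\<lambda>_. X"] by blast
  show "(\<lambda>m. (\<Otimes>\<^bsub>K\<^esub>i\<in>{1..n}. f i (m i)) \<odot>\<^bsub>N\<^esub> g m) \<in> ({1..n} \<rightarrow>\<^sub>E U) \<rightarrow> carrier N"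
    using weight_closed[OF f order_refl] gc by blast
  fix m assume m: "m \<in> ({1..n} \<rightarrow>\<^sub>E U) - (\<Pi>\<^sub>E i\<in>{1..n}. {x. f i x \<noteq> \<zero>\<^bsub>K\<^esub>})"
  then obtain i where i: "i \<in> {1..n}" "f i (m i) = \<zero>\<^bsub>K\<^esub>" by (auto simp: PiE_iff)
  have "(\<Otimes>\<^bsub>K\<^esub>j\<in>{1..n}. f j (m j)) = (\<Otimes>\<^bsub>K\<^esub>j\<in>insert i ({1..n} - {i}). f j (m j))"
    using i(1) by (simp add: insert_absorb)
  also have "\<dots> = f i (m i) \<otimes>\<^bsub>K\<^esub> (\<Otimes>\<^bsub>K\<^esub>j\<in>{1..n} - {i}. f j (m j))"
    by (rule R.finprod_insert) (use coeff_closed[OF f] i(1) in auto)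
  also have "\<dots> = \<zero>\<^bsub>K\<^esub>"
    using i(2) weight_closed[OF f, of "{1..n} - {i}" m] by simp
  finally show "(\<Otimes>\<^bsub>K\<^esub>i\<in>{1..n}. f i (m i)) \<odot>\<^bsub>N\<^esub> g m = \<zero>\<^bsub>N\<^esub>"
    using m gc by simp
qed simp

text \<open>Pulling the factor of slot \<open>i\<close> out of the product leaves \<open>z\<close>
  in one place, which makes linearity in \<open>z\<close> visible.\<close>

private lemma multi_ext_update:
  assumes f: "f \<in> tuples n FX" and i: "i \<in> {1..n}" and U: "finite U" "U \<subseteq> X"
    "\<And>j. j \<in> {1..n} \<Longrightarrow> {x. f j x \<noteq> \<zero>\<^bsub>K\<^esub>} \<subseteq> U"
    and z: "z \<in> carrier FX" "{x. z x \<noteq> \<zero>\<^bsub>K\<^esub>} \<subseteq> U"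
  shows "multi_ext (f(i := z)) =
    (\<Oplus>\<^bsub>N\<^esub>m\<in>{1..n} \<rightarrow>\<^sub>E U. z (m i) \<odot>\<^bsub>N\<^esub> ((\<Otimes>\<^bsub>K\<^esub>j\<in>{1..n} - {i}. f j (m j)) \<odot>\<^bsub>N\<^esub> g m))"
proof -
  note fz = tuples_update[OF f i z(1)]
  have gc: "g m \<in> carrier N" if "m \<in> {1..n} \<rightarrow>\<^sub>E U" for m
    using g that U(2) PiE_mono[of "{1..n}" "\<lambda>_. U" "\<lambda>_. X"] by blast
  have zc: "z x \<in> carrier K" for x using z(1) by (simp add: free_module_carrier)
  have "multi_ext (f(i := z)) = (\<Oplus>\<^bsub>N\<^esub>m\<in>{1..n} \<rightarrow>\<^sub>E U. (\<Otimes>\<^bsub>K\<^esub>j\<in>{1..n}. (f(i := z)) j (m j)) \<odot>\<^bsub>N\<^esub> g m)"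
    by (rule multi_ext_eq[OF fz U(1,2)]) (use U(3) z(2) in auto)
  also have "\<dots> = (\<Oplus>\<^bsub>N\<^esub>m\<in>{1..n} \<rightarrow>\<^sub>E U. z (m i) \<odot>\<^bsub>N\<^esub> ((\<Otimes>\<^bsub>K\<^esub>j\<in>{1..n} - {i}. f j (m j)) \<odot>\<^bsub>N\<^esub> g m))"
  proof (rule M.finsum_cong')
    show "(\<lambda>m. z (m i) \<odot>\<^bsub>N\<^esub> ((\<Otimes>\<^bsub>K\<^esub>j\<in>{1..n} - {i}. f j (m j)) \<odot>\<^bsub>N\<^esub> g m)) \<in> ({1..n} \<rightarrow>\<^sub>E U) \<rightarrow> carrier N"
      using zc weight_closed[OF f Diff_subset] gc by blast
    fix m assume m: "m \<in> {1..n} \<rightarrow>\<^sub>E U"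
    have w: "(\<Otimes>\<^bsub>K\<^esub>j\<in>{1..n} - {i}. f j (m j)) \<in> carrier K" by (rule weight_closed[OF f Diff_subset])
    have "(\<Otimes>\<^bsub>K\<^esub>j\<in>{1..n}. (f(i := z)) j (m j)) = (\<Otimes>\<^bsub>K\<^esub>j\<in>insert i ({1..n} - {i}). (f(i := z)) j (m j))"
      using i by (simp add: insert_absorb)
    also have "\<dots> = (f(i := z)) i (m i) \<otimes>\<^bsub>K\<^esub> (\<Otimes>\<^bsub>K\<^esub>j\<in>{1..n} - {i}. (f(i := z)) j (m j))"
      by (rule R.finprod_insert) (use coeff_closed[OF fz] i in blast)+
    also have "(\<Otimes>\<^bsub>K\<^esub>j\<in>{1..n} - {i}. (f(i := z)) j (m j)) = (\<Otimes>\<^bsub>K\<^esub>j\<in>{1..n} - {i}. f j (m j))"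
      by (rule R.finprod_cong') (use coeff_closed[OF f] in auto)
    finally show "(\<Otimes>\<^bsub>K\<^esub>j\<in>{1..n}. (f(i := z)) j (m j)) \<odot>\<^bsub>N\<^esub> g m =
        z (m i) \<odot>\<^bsub>N\<^esub> ((\<Otimes>\<^bsub>K\<^esub>j\<in>{1..n} - {i}. f j (m j)) \<odot>\<^bsub>N\<^esub> g m)"
      using smult_assoc1[OF zc w gc[OF m]] by simp
  qed simp
  finally show ?thesis .
qed

private lemma multi_ext_multilinear: "multi_ext \<in> multilinear_maps K n FX N"
proof -
  have gc: "g m \<in> carrier N" if "m \<in> {1..n} \<rightarrow>\<^sub>E U" "U \<subseteq> X" for m U
    using g that PiE_mono[of "{1..n}" "\<lambda>_. U" "\<lambda>_. X"] by blast
  have lin: "(\<lambda>x. multi_ext (f(i := x))) \<in> linear_maps K FX N"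
    if f: "f \<in> tuples n FX" and i: "i \<in> {1..n}" for f i
  proof -
    \<comment> \<open>\<open>V\<close> holds the supports of all slots of \<open>f\<close>. Adding
      to it the supports of the vectors put into slot \<open>i\<close> gives an index set common to
      all sums of one identity.\<close>
    define V where "V = (\<Union>j\<in>{1..n}. {x. f j x \<noteq> \<zero>\<^bsub>K\<^esub>})"
    have V: "finite V" "V \<subseteq> X" "\<And>j. j \<in> {1..n} \<Longrightarrow> {x. f j x \<noteq> \<zero>\<^bsub>K\<^esub>} \<subseteq> V"
    proof -
      have "finite {x. f j x \<noteq> \<zero>\<^bsub>K\<^esub>} \<and> {x. f j x \<noteq> \<zero>\<^bsub>K\<^esub>} \<subseteq> X" if "j \<in> {1..n}" for j
        using tuples_component[OF f that] by (auto simp: free_module_carrier)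
      then show "finite V" "V \<subseteq> X" "\<And>j. j \<in> {1..n} \<Longrightarrow> {x. f j x \<noteq> \<zero>\<^bsub>K\<^esub>} \<subseteq> V"
        unfolding V_def by blast+
    qed
    let ?h = "\<lambda>m. (\<Otimes>\<^bsub>K\<^esub>j\<in>{1..n} - {i}. f j (m j)) \<odot>\<^bsub>N\<^esub> g m"
    have hc: "?h m \<in> carrier N" if "m \<in> {1..n} \<rightarrow>\<^sub>E U" "U \<subseteq> X" for m U
      using weight_closed[OF f Diff_subset] gc[OF that] by blast
    have supp: "finite {u. x u \<noteq> \<zero>\<^bsub>K\<^esub>}" "{u. x u \<noteq> \<zero>\<^bsub>K\<^esub>} \<subseteq> X" "\<And>u. x u \<in> carrier K"
      if "x \<in> carrier FX" for x
      using that by (auto simp: free_module_carrier)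
    show ?thesis
    proof (rule linear_mapsI)
      fix x assume x: "x \<in> carrier FX"
      let ?U = "V \<union> {u. x u \<noteq> \<zero>\<^bsub>K\<^esub>}"
      have U: "finite ?U" "?U \<subseteq> X" "\<And>j. j \<in> {1..n} \<Longrightarrow> {x. f j x \<noteq> \<zero>\<^bsub>K\<^esub>} \<subseteq> ?U"
        using V supp[OF x] by blast+
      have fin: "finite ({1..n} \<rightarrow>\<^sub>E ?U)" using U(1) by (intro finite_PiE) auto
      have ex: "multi_ext (f(i := x)) = (\<Oplus>\<^bsub>N\<^esub>m\<in>{1..n} \<rightarrow>\<^sub>E ?U. x (m i) \<odot>\<^bsub>N\<^esub> ?h m)"
        by (rule multi_ext_update[OF f i U x]) auto
      show "multi_ext (f(i := x)) \<in> carrier N"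
        unfolding ex by (rule M.finsum_closed) (use supp(3)[OF x] hc[OF _ U(2)] in blast)
      fix c assume c: "c \<in> carrier K"
      have "multi_ext (f(i := c \<odot>\<^bsub>FX\<^esub> x)) = (\<Oplus>\<^bsub>N\<^esub>m\<in>{1..n} \<rightarrow>\<^sub>E ?U. (c \<odot>\<^bsub>FX\<^esub> x) (m i) \<odot>\<^bsub>N\<^esub> ?h m)"
        by (rule multi_ext_update[OF f i U]) (use R.free_module_smult_closed[OF x c] c in auto)
      also have "\<dots> = (\<Oplus>\<^bsub>N\<^esub>m\<in>{1..n} \<rightarrow>\<^sub>E ?U. c \<odot>\<^bsub>N\<^esub> (x (m i) \<odot>\<^bsub>N\<^esub> ?h m))"
      proof (rule M.finsum_cong')
        show "(\<lambda>m. c \<odot>\<^bsub>N\<^esub> (x (m i) \<odot>\<^bsub>N\<^esub> ?h m)) \<in> ({1..n} \<rightarrow>\<^sub>E ?U) \<rightarrow> carrier N"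
          using supp(3)[OF x] hc[OF _ U(2)] c by blast
        show "(c \<odot>\<^bsub>FX\<^esub> x) (m i) \<odot>\<^bsub>N\<^esub> ?h m = c \<odot>\<^bsub>N\<^esub> (x (m i) \<odot>\<^bsub>N\<^esub> ?h m)"
          if "m \<in> {1..n} \<rightarrow>\<^sub>E ?U" for m
          using smult_assoc1[OF c supp(3)[OF x] hc[OF that U(2)]] by simp
      qed simp
      also have "\<dots> = c \<odot>\<^bsub>N\<^esub> multi_ext (f(i := x))"
        unfolding ex by (rule finsum_smult_ldistr[OF fin c, symmetric])
          (use supp(3)[OF x] hc[OF _ U(2)] in blast)
      finally show "multi_ext (f(i := c \<odot>\<^bsub>FX\<^esub> x)) = c \<odot>\<^bsub>N\<^esub> multi_ext (f(i := x))" .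
    next
      fix x y assume x: "x \<in> carrier FX" and y: "y \<in> carrier FX"
      let ?U = "V \<union> {u. x u \<noteq> \<zero>\<^bsub>K\<^esub>} \<union> {u. y u \<noteq> \<zero>\<^bsub>K\<^esub>}"
      have U: "finite ?U" "?U \<subseteq> X" "\<And>j. j \<in> {1..n} \<Longrightarrow> {x. f j x \<noteq> \<zero>\<^bsub>K\<^esub>} \<subseteq> ?U"
        using V supp[OF x] supp[OF y] by blast+
      have "multi_ext (f(i := x \<oplus>\<^bsub>FX\<^esub> y)) = (\<Oplus>\<^bsub>N\<^esub>m\<in>{1..n} \<rightarrow>\<^sub>E ?U. (x \<oplus>\<^bsub>FX\<^esub> y) (m i) \<odot>\<^bsub>N\<^esub> ?h m)"
        by (rule multi_ext_update[OF f i U]) (use R.free_module_add_closed[OF x y] in auto)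
      also have "\<dots> = (\<Oplus>\<^bsub>N\<^esub>m\<in>{1..n} \<rightarrow>\<^sub>E ?U. x (m i) \<odot>\<^bsub>N\<^esub> ?h m \<oplus>\<^bsub>N\<^esub> y (m i) \<odot>\<^bsub>N\<^esub> ?h m)"
      proof (rule M.finsum_cong')
        show "(\<lambda>m. x (m i) \<odot>\<^bsub>N\<^esub> ?h m \<oplus>\<^bsub>N\<^esub> y (m i) \<odot>\<^bsub>N\<^esub> ?h m) \<in> ({1..n} \<rightarrow>\<^sub>E ?U) \<rightarrow> carrier N"
          using supp(3)[OF x] supp(3)[OF y] hc[OF _ U(2)] by blast
        show "(x \<oplus>\<^bsub>FX\<^esub> y) (m i) \<odot>\<^bsub>N\<^esub> ?h m = x (m i) \<odot>\<^bsub>N\<^esub> ?h m \<oplus>\<^bsub>N\<^esub> y (m i) \<odot>\<^bsub>N\<^esub> ?h m"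
          if "m \<in> {1..n} \<rightarrow>\<^sub>E ?U" for m
          using smult_l_distr[OF supp(3)[OF x] supp(3)[OF y] hc[OF that U(2)]] by simp
      qed simp
      also have "\<dots> = (\<Oplus>\<^bsub>N\<^esub>m\<in>{1..n} \<rightarrow>\<^sub>E ?U. x (m i) \<odot>\<^bsub>N\<^esub> ?h m) \<oplus>\<^bsub>N\<^esub>
          (\<Oplus>\<^bsub>N\<^esub>m\<in>{1..n} \<rightarrow>\<^sub>E ?U. y (m i) \<odot>\<^bsub>N\<^esub> ?h m)"
        by (rule M.finsum_addf) (use supp(3)[OF x] supp(3)[OF y] hc[OF _ U(2)] in blast)+
      also have "(\<Oplus>\<^bsub>N\<^esub>m\<in>{1..n} \<rightarrow>\<^sub>E ?U. x (m i) \<odot>\<^bsub>N\<^esub> ?h m) = multi_ext (f(i := x))"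
        by (rule multi_ext_update[OF f i U x, symmetric]) auto
      also have "(\<Oplus>\<^bsub>N\<^esub>m\<in>{1..n} \<rightarrow>\<^sub>E ?U. y (m i) \<odot>\<^bsub>N\<^esub> ?h m) = multi_ext (f(i := y))"
        by (rule multi_ext_update[OF f i U y, symmetric]) auto
      finally show "multi_ext (f(i := x \<oplus>\<^bsub>FX\<^esub> y)) = multi_ext (f(i := x)) \<oplus>\<^bsub>N\<^esub> multi_ext (f(i := y))" .
    qed
  qed
  have "multi_ext f \<in> carrier N" if f: "f \<in> tuples n FX" for f
    unfolding multi_ext_def
  proof (rule M.finsum_closed)
    have "(\<Pi>\<^sub>E i\<in>{1..n}. {x. f i x \<noteq> \<zero>\<^bsub>K\<^esub>}) \<subseteq> {1..n} \<rightarrow>\<^sub>E X"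
      by (rule PiE_mono) (use tuples_component[OF f] in \<open>auto simp: free_module_carrier\<close>)
    then show "(\<lambda>m. (\<Otimes>\<^bsub>K\<^esub>i\<in>{1..n}. f i (m i)) \<odot>\<^bsub>N\<^esub> g m) \<in>
        (\<Pi>\<^sub>E i\<in>{1..n}. {x. f i x \<noteq> \<zero>\<^bsub>K\<^esub>}) \<rightarrow> carrier N"
      using weight_closed[OF f order_refl] gc[OF _ order_refl] by blast
  qed
  with lin show ?thesis by (simp add: multilinear_maps_def)
qed

private lemma multi_ext_basis:
  assumes a: "a \<in> {1..n} \<rightarrow>\<^sub>E X"
  shows "multi_ext (\<lambda>i\<in>{1..n}. basis_vec K (a i)) = g a"
proof -
  let ?f = "\<lambda>i\<in>{1..n}. basis_vec K (a i)"
  have f: "?f \<in> tuples n FX" using a by (auto simp: tuples_def PiE_iff)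
  let ?U = "a ` {1..n}"
  have U: "finite ?U" "?U \<subseteq> X" using a by auto
  have "multi_ext ?f = (\<Oplus>\<^bsub>N\<^esub>m\<in>{1..n} \<rightarrow>\<^sub>E ?U. (\<Otimes>\<^bsub>K\<^esub>i\<in>{1..n}. ?f i (m i)) \<odot>\<^bsub>N\<^esub> g m)"
    by (rule multi_ext_eq[OF f U]) (auto simp: basis_vec_def)
  also have "\<dots> = (\<Oplus>\<^bsub>N\<^esub>m\<in>{a}. (\<Otimes>\<^bsub>K\<^esub>i\<in>{1..n}. ?f i (m i)) \<odot>\<^bsub>N\<^esub> g m)"
  proof (rule M.add.finprod_mono_neutral_cong_right)
    show "finite ({1..n} \<rightarrow>\<^sub>E ?U)" using U(1) by (intro finite_PiE) auto
    show "{a} \<subseteq> {1..n} \<rightarrow>\<^sub>E ?U" using a by (auto simp: PiE_iff)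
    have gc: "g m \<in> carrier N" if "m \<in> {1..n} \<rightarrow>\<^sub>E ?U" for m
      using g that U(2) PiE_mono[of "{1..n}" "\<lambda>_. ?U" "\<lambda>_. X"] by blast
    show "(\<lambda>m. (\<Otimes>\<^bsub>K\<^esub>i\<in>{1..n}. ?f i (m i)) \<odot>\<^bsub>N\<^esub> g m) \<in> ({1..n} \<rightarrow>\<^sub>E ?U) \<rightarrow> carrier N"
      using weight_closed[OF f order_refl] gc by blast
    fix m assume m: "m \<in> ({1..n} \<rightarrow>\<^sub>E ?U) - {a}"
    \<comment> \<open>Extensional tuples that agree in all slots are equal, so \<open>m\<close>
      differs from \<open>a\<close> in some slot, where the basis vector has coefficient zero; only
      the term \<open>m = a\<close> survives.\<close>
    have "\<exists>i\<in>{1..n}. m i \<noteq> a i"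
    proof (rule ccontr)
      assume "\<not> ?thesis"
      then have "m = a"
        using m a by (intro extensionalityI[of m "{1..n}" a]) (auto simp: PiE_def)
      with m show False by simp
    qed
    then obtain i where i: "i \<in> {1..n}" "?f i (m i) = \<zero>\<^bsub>K\<^esub>" by (auto simp: basis_vec_def)
    have "(\<Otimes>\<^bsub>K\<^esub>j\<in>{1..n}. ?f j (m j)) = (\<Otimes>\<^bsub>K\<^esub>j\<in>insert i ({1..n} - {i}). ?f j (m j))"
      using i(1) by (simp add: insert_absorb)
    also have "\<dots> = ?f i (m i) \<otimes>\<^bsub>K\<^esub> (\<Otimes>\<^bsub>K\<^esub>j\<in>{1..n} - {i}. ?f j (m j))"
      by (rule R.finprod_insert) (use coeff_closed[OF f] i(1) in blast)+
    also have "\<dots> = \<zero>\<^bsub>K\<^esub>"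
      unfolding i(2) by (rule R.l_null[OF weight_closed[OF f Diff_subset]])
    finally show "(\<Otimes>\<^bsub>K\<^esub>i\<in>{1..n}. ?f i (m i)) \<odot>\<^bsub>N\<^esub> g m = \<zero>\<^bsub>N\<^esub>"
      using smult_l_null[OF gc, of m] m by simp
  qed simp
  also have "\<dots> = (\<Otimes>\<^bsub>K\<^esub>i\<in>{1..n}. ?f i (a i)) \<odot>\<^bsub>N\<^esub> g a"
    using weight_closed[OF f order_refl, of a] g a by (simp add: Pi_iff)
  also have "(\<Otimes>\<^bsub>K\<^esub>i\<in>{1..n}. ?f i (a i)) = \<one>\<^bsub>K\<^esub>"
    by (rule R.finprod_one_eqI) (simp add: basis_vec_def)
  also have "\<one>\<^bsub>K\<^esub> \<odot>\<^bsub>N\<^esub> g a = g a"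
    by (rule smult_one) (use g a in blast)
  finally show ?thesis .
qed

lemma free_module_multilinear_ext:
  "\<exists>\<mu> \<in> multilinear_maps K n (free_module K X) N.
     \<forall>a\<in>{1..n} \<rightarrow>\<^sub>E X. \<mu> (\<lambda>i\<in>{1..n}. basis_vec K (a i)) = g a"
  using multi_ext_multilinear multi_ext_basis by blast

end

section \<open>The monomial basis of the symmetric algebra on a free module\<close>

context
  fixes K :: "('k, 'm) ring_scheme" and X :: "'x set"
  assumes K: "cring K"
begin

interpretation cring K by (fact K)

private abbreviation (input) "SX \<equiv> symmetric_algebra K (free_module K X)"
private abbreviation (input) "gen x \<equiv> symmetric_incl K (free_module K X) (basis_vec K x)"
private abbreviation (input) "monoms \<equiv> {m. set_mset m \<subseteq> X}"

interpretation S: algebra K SX by (rule symmetric_algebra_algebra[OF free_module_module])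

lemma symmetric_gen_closed: "x \<in> X \<Longrightarrow> gen x \<in> carrier SX"
  by (rule linear_maps_closed[OF symmetric_incl_linear[OF free_module_module] basis_vec_closed])

lemma symmetric_free_universal:
  assumes A: "algebra K A" and g: "g \<in> X \<rightarrow> carrier A"
  shows "\<exists>f \<in> algebra_hom K SX A. \<forall>x\<in>X. f (gen x) = g x"
proof -
  interpret A: algebra K A by (rule A)
  note l = lin_ext_linear[OF A.module g] and b = lin_ext_basis_vec[OF A.module g]
  from symmetric_algebra_universal[OF free_module_module A l]
  obtain f where f: "f \<in> algebra_hom K SX A"
    "\<And>v. v \<in> carrier (free_module K X) \<Longrightarrow> f (symmetric_incl K (free_module K X) v) = lin_ext K A g v"
    by blast
  have "f (gen x) = g x" if "x \<in> X" for x
    using f(2)[OF basis_vec_closed[OF that]] b[OF that] by simp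
  with f(1) show ?thesis by blast
qed

lemma symmetric_free_hom_eq:
  assumes A: "algebra K A" and f: "f \<in> algebra_hom K SX A" and g: "g \<in> algebra_hom K SX A"
    and eq: "\<And>x. x \<in> X \<Longrightarrow> f (gen x) = g (gen x)" and s: "s \<in> carrier SX"
  shows "f s = g s"
proof (rule symmetric_algebra_hom_eq[OF free_module_module A f g _ s])
  interpret A: algebra K A by (rule A)
  note il = symmetric_incl_linear[OF free_module_module]
  fix v assume v: "v \<in> carrier (free_module K X)"
  show "f (symmetric_incl K (free_module K X) v) = g (symmetric_incl K (free_module K X) v)"
    by (rule free_module_linear_eq[OF A.module linear_maps_comp[OF il algebra_hom_linear[OF f]]
          linear_maps_comp[OF il algebra_hom_linear[OF g]] eq v])
qed

text \<open>Under the isomorphism with polynomials the monomials in the generators become basis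
  vectors, so both spanning and the free choice of values of a multilinear map carry over from free
  modules.\<close>

lemma symmetric_free_span: "span_in K SX (monomial_prod SX gen ` monoms) = carrier SX"
  and symmetric_free_multilinear_ext:
    "\<And>(N :: ('k, 'b) module) g. module K N \<Longrightarrow> g \<in> ({1..n} \<rightarrow>\<^sub>E monoms) \<rightarrow> carrier N \<Longrightarrow>
      \<exists>\<mu> \<in> multilinear_maps K n SX N. \<forall>a\<in>{1..n} \<rightarrow>\<^sub>E monoms.
        \<mu> (\<lambda>i\<in>{1..n}. monomial_prod SX gen (a i)) = g a"
proof -
  let ?P = "poly_algebra K X" and ?F = "free_module K monoms"
  interpret P: algebra K ?P by (rule poly_algebra_algebra)
  obtain \<theta> \<iota> where \<theta>: "\<theta> \<in> algebra_hom K SX ?P" and \<iota>: "\<iota> \<in> algebra_hom K ?P SX"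
    and \<theta>gen: "\<And>x. x \<in> X \<Longrightarrow> \<theta> (gen x) = basis_vec K {#x#}"
    and \<iota>gen: "\<And>x. x \<in> X \<Longrightarrow> \<iota> (basis_vec K {#x#}) = gen x"
    and \<iota>\<theta>: "\<And>s. s \<in> carrier SX \<Longrightarrow> \<iota> (\<theta> s) = s"
    and \<theta>\<iota>: "\<And>p. p \<in> carrier ?P \<Longrightarrow> \<theta> (\<iota> p) = p"
    using symmetric_algebra_free[OF K] by blast
  have \<iota>m: "\<iota> (basis_vec K m) = monomial_prod SX gen m" if m: "m \<in> monoms" for m
  proof -
    have mX: "set_mset m \<subseteq> X" using m by simp
    have "\<iota> (basis_vec K m) = monomial_prod SX (\<lambda>x. \<iota> (basis_vec K {#x#})) m"
      unfolding poly_basis_eq_monomial_prod[OF K mX]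
      by (rule algebra_hom_monomial_prod[OF P.algebra_axioms S.algebra_axioms \<iota> poly_basis_closed])
        (use mX in auto)
    also have "\<dots> = monomial_prod SX gen m"
      by (rule S.monomial_prod_cong) (use mX \<iota>gen symmetric_gen_closed in auto)
    finally show ?thesis .
  qed
  have \<theta>m: "\<theta> (monomial_prod SX gen m) = basis_vec K m" if m: "m \<in> monoms" for m
    using \<theta>\<iota>[OF poly_basis_closed, of m] \<iota>m[OF m] m by simp
  have \<iota>l: "\<iota> \<in> linear_maps K ?F SX" and \<theta>l: "\<theta> \<in> linear_maps K SX ?F"
    using algebra_hom_linear[OF \<iota>] algebra_hom_linear[OF \<theta>] by (simp_all add: linear_maps_poly_algebra)
  have sub: "basis_vec K ` monoms \<subseteq> carrier ?F" by (rule image_subsetI) (rule basis_vec_closed)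
  have "\<iota> ` carrier ?F = carrier SX"
  proof
    show "\<iota> ` carrier ?F \<subseteq> carrier SX" using linear_maps_closed[OF \<iota>l] by blast
    show "carrier SX \<subseteq> \<iota> ` carrier ?F"
    proof
      fix s assume s: "s \<in> carrier SX"
      show "s \<in> \<iota> ` carrier ?F"
        by (rule image_eqI[where f = \<iota>, OF \<iota>\<theta>[OF s, symmetric] linear_maps_closed[OF \<theta>l s]])
    qed
  qed
  from span_in_image[OF free_module_module S.module \<iota>l this free_module_span sub]
  have "span_in K SX (\<iota> ` basis_vec K ` monoms) = carrier SX" .
  moreover have "\<iota> ` basis_vec K ` monoms = monomial_prod SX gen ` monoms"
    unfolding image_image by (rule image_cong[OF refl \<iota>m])
  ultimately show "span_in K SX (monomial_prod SX gen ` monoms) = carrier SX" by simp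
  fix N :: "('k, 'b) module" and g
  assume N: "module K N" and g: "g \<in> ({1..n} \<rightarrow>\<^sub>E monoms) \<rightarrow> carrier N"
  from free_module_multilinear_ext[OF N g]
  obtain \<mu> where \<mu>: "\<mu> \<in> multilinear_maps K n ?F N"
    "\<And>a. a \<in> {1..n} \<rightarrow>\<^sub>E monoms \<Longrightarrow> \<mu> (\<lambda>i\<in>{1..n}. basis_vec K (a i)) = g a" by blast
  have "\<mu> (\<lambda>i\<in>{1..n}. \<theta> ((\<lambda>i\<in>{1..n}. monomial_prod SX gen (a i)) i)) = g a"
    if a: "a \<in> {1..n} \<rightarrow>\<^sub>E monoms" for a
  proof -
    have "(\<lambda>i\<in>{1..n}. \<theta> ((\<lambda>i\<in>{1..n}. monomial_prod SX gen (a i)) i)) = (\<lambda>i\<in>{1..n}. basis_vec K (a i))"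
      by (rule restrict_ext) (use \<theta>m PiE_mem[OF a] in simp)
    with \<mu>(2)[OF a] show ?thesis by simp
  qed
  moreover have "(\<lambda>s. \<mu> (\<lambda>i\<in>{1..n}. \<theta> (s i))) \<in> multilinear_maps K n SX N"
    by (rule multilinear_linear_comp[OF S.module \<mu>(1) \<theta>l])
  ultimately show "\<exists>\<mu> \<in> multilinear_maps K n SX N. \<forall>a\<in>{1..n} \<rightarrow>\<^sub>E monoms.
      \<mu> (\<lambda>i\<in>{1..n}. monomial_prod SX gen (a i)) = g a"
    by (intro bexI[of _ "\<lambda>s. \<mu> (\<lambda>i\<in>{1..n}. \<theta> (s i))"] ballI)
qed

end

section \<open>The grafting operation and its initiality\<close>

lemma n_algebra_hom_comp:
  assumes A: "n_algebra K n A \<alpha>" and B: "n_algebra K n B \<beta>" and C: "n_algebra K n C \<gamma>"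
    and f: "f \<in> n_algebra_hom K n A \<alpha> B \<beta>" and g: "g \<in> n_algebra_hom K n B \<beta> C \<gamma>"
  shows "(\<lambda>x. g (f x)) \<in> n_algebra_hom K n A \<alpha> C \<gamma>"
proof -
  note f' = f[unfolded n_algebra_hom_iff[OF A B]] and g' = g[unfolded n_algebra_hom_iff[OF B C]]
  have fc: "f \<in> carrier A \<rightarrow> carrier B" using f' by (auto simp: algebra_hom_def linear_maps_def)
  have "g (f (\<alpha> (pure_tensor K n A a))) = \<gamma> (pure_tensor K n C (\<lambda>i\<in>{1..n}. g (f (a i))))"
    if a: "a \<in> tuples n A" for a
  proof -
    have "g (f (\<alpha> (pure_tensor K n A a))) = g (\<beta> (pure_tensor K n B (\<lambda>i\<in>{1..n}. f (a i))))"
      using f' a by simp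
    also have "\<dots> = \<gamma> (pure_tensor K n C (\<lambda>i\<in>{1..n}. g ((\<lambda>i\<in>{1..n}. f (a i)) i)))"
      using g' tuples_map[OF a fc] by blast
    also have "(\<lambda>i\<in>{1..n}. g ((\<lambda>i\<in>{1..n}. f (a i)) i)) = (\<lambda>i\<in>{1..n}. g (f (a i)))"
      by (rule restrict_ext) simp
    finally show ?thesis .
  qed
  with f' g' show ?thesis
    unfolding n_algebra_hom_iff[OF A C] by (blast intro: algebra_hom_comp)
qed

text \<open>Initiality represents morphisms by extensional functions; this lemma allows a morphism
  to be replaced by its restriction to the carrier.\<close>

lemma n_algebra_hom_cong:
  assumes A: "n_algebra K n A \<alpha>" and B: "n_algebra K n B \<beta>"
    and f: "f \<in> n_algebra_hom K n A \<alpha> B \<beta>" and eq: "\<And>x. x \<in> carrier A \<Longrightarrow> f x = g x"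
  shows "g \<in> n_algebra_hom K n A \<alpha> B \<beta>"
proof -
  interpret A: algebra K A using A by (simp add: n_algebra_def)
  note f' = f[unfolded n_algebra_hom_iff[OF A B]]
  have fh: "f \<in> algebra_hom K A B" using f' by blast
  have "g \<in> algebra_hom K A B"
  proof (rule algebra_homI)
    show "g \<in> linear_maps K A B" by (rule linear_maps_cong[OF algebra_hom_linear[OF fh] A.module eq])
    show "g (x \<otimes>\<^bsub>A\<^esub> y) = g x \<otimes>\<^bsub>B\<^esub> g y" if "x \<in> carrier A" "y \<in> carrier A" for x y
      using algebra_hom_mult[OF fh that] that by (simp flip: eq)
    show "g \<one>\<^bsub>A\<^esub> = \<one>\<^bsub>B\<^esub>" using algebra_hom_one[OF fh] by (simp flip: eq)
  qed
  moreover have "g (\<alpha> (pure_tensor K n A a)) = \<beta> (pure_tensor K n B (\<lambda>i\<in>{1..n}. g (a i)))"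
    if a: "a \<in> tuples n A" for a
  proof -
    have "\<alpha> (pure_tensor K n A a) \<in> carrier A"
      using A pure_tensor_closed[OF A.module a] by (auto simp: n_algebra_def intro: linear_maps_closed)
    then have "g (\<alpha> (pure_tensor K n A a)) = \<beta> (pure_tensor K n B (\<lambda>i\<in>{1..n}. f (a i)))"
      using f' a by (simp flip: eq)
    also have "(\<lambda>i\<in>{1..n}. f (a i)) = (\<lambda>i\<in>{1..n}. g (a i))"
      by (rule restrict_ext) (rule eq[OF tuples_component[OF a]])
    finally show ?thesis .
  qed
  ultimately show ?thesis unfolding n_algebra_hom_iff[OF A B] by blast
qed

lemma n_algebra_hom_id:
  assumes A: "n_algebra K n A \<alpha>"
  shows "(\<lambda>x. x) \<in> n_algebra_hom K n A \<alpha> A \<alpha>"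
  unfolding n_algebra_hom_iff[OF A A]
proof (intro conjI ballI)
  show "\<alpha> (pure_tensor K n A a) = \<alpha> (pure_tensor K n A (\<lambda>i\<in>{1..n}. a i))" if "a \<in> tuples n A" for a
    using that by (simp add: tuples_def PiE_restrict)
qed (rule algebra_hom_id)

definition forest_monomial :: "('k, 'm) ring_scheme \<Rightarrow> nat \<Rightarrow> coloured_tree multiset \<Rightarrow> 'k tree_poly" where
  "forest_monomial K n =
     monomial_prod (sym_trees K n) (\<lambda>t. symmetric_incl K (tree_space K n) (basis_vec K t))"

section \<open>Forests as monomials and the grafting operation\<close>

context
  fixes K :: "('k, 'm) ring_scheme" and n :: nat
  assumes K: "cring K"
begin

interpretation cring K by (fact K)

private abbreviation (input) "ST \<equiv> sym_trees K n"
private abbreviation (input) "tgen t \<equiv> symmetric_incl K (tree_space K n) (basis_vec K t)"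
private abbreviation (input) "forests \<equiv> {m. set_mset m \<subseteq> coloured_trees n}"

private lemma ST_eq: "ST = symmetric_algebra K (free_module K (coloured_trees n))"
  "tgen t = symmetric_incl K (free_module K (coloured_trees n)) (basis_vec K t)"
  by (simp_all add: sym_trees_def tree_space_def)

interpretation S: algebra K ST
  unfolding ST_eq by (rule symmetric_algebra_algebra[OF free_module_module])

private lemma tgen_closed: "t \<in> coloured_trees n \<Longrightarrow> tgen t \<in> carrier ST"
  unfolding ST_eq by (rule symmetric_gen_closed[OF K])

text \<open>\<open>branches\<close> multiplies over the children of the root,
  \<open>forest_monomial\<close> over classes with multiplicity; they agree because each child
  contributes its class once to the multiset.\<close>

lemma branches_eq_forest_monomial:
  assumes P: "coloured_tree_poset n P"
  shows "branches K n P i = forest_monomial K n (branch_classes n P i)"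
proof -
  have "tgen (tree_class n (subtree_at P w)) \<in> carrier ST" if "w \<in> children P i" for w
  proof (rule tgen_closed, rule branch_classes_subset(1)[OF P])
    show "tree_class n (subtree_at P w) \<in># branch_classes n P i"
      using that finite_children[OF P] by (simp add: branch_classes_def)
  qed
  then show ?thesis
    unfolding branches_def forest_monomial_def branch_classes_def tree_gen_def
    by (intro S.monomial_prod_image_mset_set[symmetric] finite_children[OF P])
qed

lemma grafting_operation_exists:
  "\<exists>\<beta>. n_algebra K n (sym_trees K n) \<beta> \<and> (\<forall>t\<in>coloured_trees n.
     \<beta> (pure_tensor K n (sym_trees K n) (\<lambda>i\<in>{1..n}. forest_monomial K n (tree_branches n t i))) =
     symmetric_incl K (tree_space K n) (basis_vec K t))"
proof -
  let ?T = "coloured_trees n"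
  \<comment> \<open>\<open>node F\<close> is the tree with forests \<open>F\<close>: unique by
    \<open>tree_branches_inject\<close>, and existing for tuples of forests by
    \<open>tree_branches_surj\<close>.\<close>
  define node where
    "node F = (THE t. t \<in> ?T \<and> (\<forall>i\<in>{1..n}. tree_branches n t i = F i))" for F
  have node_eq: "node F = t" if "t \<in> ?T" "\<And>i. i \<in> {1..n} \<Longrightarrow> tree_branches n t i = F i" for F t
    unfolding node_def
  proof (rule the_equality)
    show "t \<in> ?T \<and> (\<forall>i\<in>{1..n}. tree_branches n t i = F i)" using that by blast
    show "s = t" if s: "s \<in> ?T \<and> (\<forall>i\<in>{1..n}. tree_branches n s i = F i)" for s
      by (rule tree_branches_inject[of s n t]) (use s \<open>t \<in> ?T\<close> \<open>\<And>i. i \<in> {1..n} \<Longrightarrow> tree_branches n t i = F i\<close> in simp_all)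
  qed
  have "tgen (node F) \<in> carrier ST" if F: "F \<in> {1..n} \<rightarrow>\<^sub>E forests" for F
  proof -
    have "set_mset (F i) \<subseteq> ?T" if "i \<in> {1..n}" for i using PiE_mem[OF F that] by simp
    from tree_branches_surj[of n F, OF this] obtain t
      where t: "t \<in> ?T" "\<And>i. i \<in> {1..n} \<Longrightarrow> tree_branches n t i = F i" by blast
    have "node F = t" by (rule node_eq[OF t(1)]) (rule t(2))
    then show ?thesis using tgen_closed[OF t(1)] by simp
  qed
  then have "(\<lambda>F. tgen (node F)) \<in> ({1..n} \<rightarrow>\<^sub>E forests) \<rightarrow> carrier ST" by blast
  from symmetric_free_multilinear_ext[OF K S.module this] obtain \<mu>
    where \<mu>: "\<mu> \<in> multilinear_maps K n ST ST"
      "\<And>F. F \<in> {1..n} \<rightarrow>\<^sub>E forests \<Longrightarrow> \<mu> (\<lambda>i\<in>{1..n}. forest_monomial K n (F i)) = tgen (node F)"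
    unfolding forest_monomial_def ST_eq by blast
  from tensor_lift[OF S.module S.module \<mu>(1)] obtain \<beta>
    where \<beta>: "\<beta> \<in> linear_maps K (tensor_power K n ST) ST"
      "\<And>a. a \<in> tuples n ST \<Longrightarrow> \<beta> (pure_tensor K n ST a) = \<mu> a" by blast
  have "n_algebra K n ST \<beta>" using \<beta>(1) S.algebra_axioms by (simp add: n_algebra_def)
  moreover have "\<beta> (pure_tensor K n ST (\<lambda>i\<in>{1..n}. forest_monomial K n (tree_branches n t i))) = tgen t"
    if t: "t \<in> ?T" for t
  proof -
    \<comment> \<open>\<mu> is prescribed on extensional tuples of forests, so the branches are cut
      off outside \<open>{1..n}\<close>; \<open>node\<close> looks only at the indices
      inside.\<close>
    let ?F = "\<lambda>i\<in>{1..n}. tree_branches n t i"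
    have F: "?F \<in> {1..n} \<rightarrow>\<^sub>E forests" using tree_branches_subset(1)[OF t] by auto
    have "forest_monomial K n (tree_branches n t i) \<in> carrier ST" for i
      unfolding forest_monomial_def
      by (rule S.monomial_prod_closed) (rule tgen_closed[OF tree_branches_subset(1)[OF t]])
    then have "(\<lambda>i\<in>{1..n}. forest_monomial K n (tree_branches n t i)) \<in> tuples n ST"
      by (simp add: tuples_def)
    from \<beta>(2)[OF this]
    have "\<beta> (pure_tensor K n ST (\<lambda>i\<in>{1..n}. forest_monomial K n (tree_branches n t i))) =
        \<mu> (\<lambda>i\<in>{1..n}. forest_monomial K n (?F i))"
      by (simp cong: restrict_cong)
    also have "\<dots> = tgen t" unfolding \<mu>(2)[OF F] by (subst node_eq[OF t]) auto
    finally show ?thesis .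
  qed
  ultimately show ?thesis by blast
qed

section \<open>Initiality of the symmetric algebra with grafting\<close>

context
  fixes \<beta> :: "('k, 'k tree_poly) tensor \<Rightarrow> 'k tree_poly"
  assumes \<beta>: "n_algebra K n (sym_trees K n) \<beta>"
    and grafting: "\<And>t. t \<in> coloured_trees n \<Longrightarrow>
      \<beta> (pure_tensor K n (sym_trees K n) (\<lambda>i\<in>{1..n}. forest_monomial K n (tree_branches n t i))) =
      symmetric_incl K (tree_space K n) (basis_vec K t)"
begin

private lemma forest_monomial_closed: "m \<in> forests \<Longrightarrow> forest_monomial K n m \<in> carrier ST"
  unfolding forest_monomial_def by (rule S.monomial_prod_closed) (use tgen_closed in auto)

private lemma forest_tuple:
  assumes "t \<in> coloured_trees n"
  shows "(\<lambda>i\<in>{1..n}. forest_monomial K n (tree_branches n t i)) \<in> tuples n ST"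
proof -
  have "forest_monomial K n (tree_branches n t i) \<in> carrier ST" for i
    by (rule forest_monomial_closed) (use tree_branches_subset(1)[OF assms] in blast)
  then show ?thesis by (simp add: tuples_def)
qed

lemma grafting_hom_unique:
  assumes A: "n_algebra K n A \<alpha>" and f: "f \<in> n_algebra_hom K n ST \<beta> A \<alpha>"
    and g: "g \<in> n_algebra_hom K n ST \<beta> A \<alpha>" and s: "s \<in> carrier ST"
  shows "f s = g s"
proof -
  interpret A: algebra K A using A by (simp add: n_algebra_def)
  note f' = f[unfolded n_algebra_hom_iff[OF \<beta> A]] and g' = g[unfolded n_algebra_hom_iff[OF \<beta> A]]
  have monomial: "h (forest_monomial K n m) = monomial_prod A (\<lambda>t. h (tgen t)) m"
    if "h \<in> algebra_hom K ST A" "m \<in> forests" for h m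
    unfolding forest_monomial_def
    by (rule algebra_hom_monomial_prod[OF S.algebra_axioms A.algebra_axioms that(1)])
      (use that(2) tgen_closed in auto)
  have "f (tgen t) = g (tgen t)" if "t \<in> coloured_trees n" for t
    using that
  proof (induction "tree_size n t" arbitrary: t rule: less_induct)
    case less
    note t = less.prems
    \<comment> \<open>Stated for any morphism \<open>h\<close>, so that the recursion unfolds for
      \<open>f\<close> and \<open>g\<close> alike.\<close>
    have step: "h (tgen t) = \<alpha> (pure_tensor K n A
        (\<lambda>i\<in>{1..n}. monomial_prod A (\<lambda>u. h (tgen u)) (tree_branches n t i)))"
      if h: "h \<in> n_algebra_hom K n ST \<beta> A \<alpha>" for h
    proof -
      note h' = h[unfolded n_algebra_hom_iff[OF \<beta> A]]
      have "h (tgen t) =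
          h (\<beta> (pure_tensor K n ST (\<lambda>i\<in>{1..n}. forest_monomial K n (tree_branches n t i))))"
        using grafting[OF t] by simp
      also have "\<dots> = \<alpha> (pure_tensor K n A
          (\<lambda>i\<in>{1..n}. h ((\<lambda>i\<in>{1..n}. forest_monomial K n (tree_branches n t i)) i)))"
        using h' forest_tuple[OF t] by blast
      also have "(\<lambda>i\<in>{1..n}. h ((\<lambda>i\<in>{1..n}. forest_monomial K n (tree_branches n t i)) i)) =
          (\<lambda>i\<in>{1..n}. monomial_prod A (\<lambda>u. h (tgen u)) (tree_branches n t i))"
        by (rule restrict_ext) (use h' monomial tree_branches_subset(1)[OF t] in auto)
      finally show ?thesis .
    qed
    have "monomial_prod A (\<lambda>u. f (tgen u)) (tree_branches n t i) =
        monomial_prod A (\<lambda>u. g (tgen u)) (tree_branches n t i)" for i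
    proof (rule A.monomial_prod_cong)
      fix u assume u: "u \<in># tree_branches n t i"
      note u' = tree_branches_subset[OF t u]
      show "f (tgen u) = g (tgen u)" by (rule less.hyps[OF u'(2,1)])
      show "f (tgen u) \<in> carrier A" using f' tgen_closed[OF u'(1)] by (blast intro: algebra_hom_closed)
    qed
    then show ?case unfolding step[OF f] step[OF g] by simp
  qed
  then show ?thesis
    using f' g' s symmetric_free_hom_eq[OF K A.algebra_axioms] unfolding ST_eq by blast
qed

lemma grafting_hom_exists:
  assumes A: "n_algebra K n A \<alpha>"
  shows "\<exists>h. h \<in> n_algebra_hom K n ST \<beta> A \<alpha>"
proof -
  interpret A: algebra K A using A by (simp add: n_algebra_def)
  have \<alpha>: "\<alpha> \<in> linear_maps K (tensor_power K n A) A" using A by (simp add: n_algebra_def)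
  let ?R = "measure (tree_size n)"
  let ?step = "\<lambda>g t. \<alpha> (pure_tensor K n A (\<lambda>i\<in>{1..n}. monomial_prod A g (tree_branches n t i)))"
  \<comment> \<open>\<open>wfrec\<close> hands \<open>?step\<close> the function cut off to smaller
    trees. For genuine trees the branches are smaller, so the cut changes nothing.\<close>
  define g where "g = wfrec ?R ?step"
  \<comment> \<open>Equation and membership are proved together: replacing the cut-off function by
    \<open>g\<close> inside a product requires its values on the branches to lie in
    \<open>A\<close>.\<close>
  have "g t \<in> carrier A \<and> g t = ?step g t" if "t \<in> coloured_trees n" for t
    using that
  proof (induction "tree_size n t" arbitrary: t rule: less_induct)
    case less
    note t = less.prems
    have br: "g u \<in> carrier A" "cut g ?R t u = g u" if "u \<in># tree_branches n t i" for u i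
    proof -
      note u = tree_branches_subset[OF t that]
      show "g u \<in> carrier A" using less.hyps[OF u(2,1)] by (rule conjunct1)
      show "cut g ?R t u = g u" using u(2) by (simp add: cut_def)
    qed
    have mc: "monomial_prod A g (tree_branches n t i) \<in> carrier A" for i
      by (rule A.monomial_prod_closed) (rule br(1))
    have "monomial_prod A (cut g ?R t) (tree_branches n t i) = monomial_prod A g (tree_branches n t i)" for i
      by (rule A.monomial_prod_cong) (simp_all add: br)
    moreover have "g t = ?step (cut g ?R t) t"
      unfolding g_def by (subst wfrec) simp_all
    ultimately have "g t = ?step g t" by simp
    moreover have "?step g t \<in> carrier A"
      by (rule linear_maps_closed[OF \<alpha> pure_tensor_closed[OF A.module]])
        (use mc in \<open>auto simp: tuples_def\<close>)
    ultimately show ?case by simp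
  qed
  then have gc: "g \<in> coloured_trees n \<rightarrow> carrier A"
    and g: "\<And>t. t \<in> coloured_trees n \<Longrightarrow> g t = ?step g t" by blast+
  from symmetric_free_universal[OF K A.algebra_axioms gc] obtain h
    where h: "h \<in> algebra_hom K ST A" "\<And>t. t \<in> coloured_trees n \<Longrightarrow> h (tgen t) = g t"
    unfolding ST_eq by blast
  have hm: "h (forest_monomial K n m) = monomial_prod A g m" if m: "m \<in> forests" for m
  proof -
    have "h (forest_monomial K n m) = monomial_prod A (\<lambda>t. h (tgen t)) m"
      unfolding forest_monomial_def
      by (rule algebra_hom_monomial_prod[OF S.algebra_axioms A.algebra_axioms h(1)])
        (use m tgen_closed in auto)
    also have "\<dots> = monomial_prod A g m"
    proof (rule A.monomial_prod_cong)
      fix t assume "t \<in># m"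
      then have t: "t \<in> coloured_trees n" using m by blast
      show "h (tgen t) = g t" by (rule h(2)[OF t])
      show "h (tgen t) \<in> carrier A" by (rule algebra_hom_closed[OF h(1) tgen_closed[OF t]])
    qed
    finally show ?thesis .
  qed
  have "h (\<beta> (pure_tensor K n ST a)) = \<alpha> (pure_tensor K n A (\<lambda>i\<in>{1..n}. h (a i)))"
    if a: "a \<in> tuples n ST" for a
  \<comment> \<open>Both sides are multilinear in \<open>a\<close> and forest monomials span, so
    \<open>a\<close> may be taken to be a tuple of forests. Such a tuple consists of the branches of
    some tree \<open>t\<close>, and for it the claim is the recursion equation of
    \<open>g\<close>.\<close>
  proof (rule multilinear_eq_on_span[OF S.module A.module _ _ _ _ _ a])
    have "\<beta> \<in> linear_maps K (tensor_power K n ST) ST" using \<beta> by (simp add: n_algebra_def)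
    from linear_maps_comp[OF this algebra_hom_linear[OF h(1)]]
    show "(\<lambda>a. h (\<beta> (pure_tensor K n ST a))) \<in> multilinear_maps K n ST A"
      by (rule linear_multilinear_comp[OF pure_tensor_multilinear[OF S.module]])
    show "(\<lambda>a. \<alpha> (pure_tensor K n A (\<lambda>i\<in>{1..n}. h (a i)))) \<in> multilinear_maps K n ST A"
      by (rule multilinear_linear_comp[OF S.module
            linear_multilinear_comp[OF pure_tensor_multilinear[OF A.module] \<alpha>]
            algebra_hom_linear[OF h(1)]])
    show "span_in K ST (forest_monomial K n ` forests) = carrier ST"
      unfolding forest_monomial_def ST_eq by (rule symmetric_free_span[OF K])
    show "forest_monomial K n ` forests \<subseteq> carrier ST" using forest_monomial_closed by blast
    fix s assume s: "s \<in> {1..n} \<rightarrow>\<^sub>E forest_monomial K n ` forests"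
    then have "\<forall>i\<in>{1..n}. \<exists>m. m \<in> forests \<and> s i = forest_monomial K n m" by blast
    then obtain F where F: "\<And>i. i \<in> {1..n} \<Longrightarrow> F i \<in> forests"
      "\<And>i. i \<in> {1..n} \<Longrightarrow> s i = forest_monomial K n (F i)" by metis
    then obtain t where t: "t \<in> coloured_trees n" "\<And>i. i \<in> {1..n} \<Longrightarrow> tree_branches n t i = F i"
      using tree_branches_surj[of n F] by blast
    have "s = (\<lambda>i\<in>{1..n}. s i)" using s by (simp add: PiE_restrict)
    also have "\<dots> = (\<lambda>i\<in>{1..n}. forest_monomial K n (tree_branches n t i))"
      by (rule restrict_ext) (simp only: F(2) t(2))
    finally have "\<beta> (pure_tensor K n ST s) = tgen t" using grafting[OF t(1)] by simp
    then have "h (\<beta> (pure_tensor K n ST s)) = g t" using h(2)[OF t(1)] by simp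
    also have "\<dots> = ?step g t" by (rule g[OF t(1)])
    also have "(\<lambda>i\<in>{1..n}. monomial_prod A g (tree_branches n t i)) = (\<lambda>i\<in>{1..n}. h (s i))"
      by (rule restrict_ext) (simp only: F t(2) hm)
    finally show "h (\<beta> (pure_tensor K n ST s)) = \<alpha> (pure_tensor K n A (\<lambda>i\<in>{1..n}. h (s i)))" .
  qed
  with h(1) show ?thesis unfolding n_algebra_hom_iff[OF \<beta> A] by blast
qed

end

end

section \<open>The comparison of the two initial objects\<close>

theorem proposition3p2:
  fixes K :: "('k, 'm) ring_scheme"
    and n :: nat
    and C :: "('k, 'c) module"
    and lam :: "('k, 'c) tensor \<Rightarrow> 'c"
  assumes "field K"
    and "characteristic_zero K"
    and "initial_n_algebra TYPE('c) K n C lam"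
    and "initial_n_algebra TYPE('k tree_poly) K n C lam"
  shows "\<exists>\<phi> \<in> algebra_iso K C (sym_trees K n). takes_to_grafting K n C lam \<phi>"
proof -
  have K: "cring K" using fieldE(1)[OF assms(1)] .
  let ?S = "sym_trees K n"
  from grafting_operation_exists[OF K, of n] obtain \<beta> where \<beta>: "n_algebra K n ?S \<beta>"
    and grafting: "\<And>t. t \<in> coloured_trees n \<Longrightarrow>
      \<beta> (pure_tensor K n ?S (\<lambda>i\<in>{1..n}. forest_monomial K n (tree_branches n t i))) =
      symmetric_incl K (tree_space K n) (basis_vec K t)" by blast
  have C: "n_algebra K n C lam" using assms(3) by (simp add: initial_n_algebra_def)
  \<comment> \<open>Here initiality of \<open>C\<close> is used at the type of
    \<open>?S\<close>.\<close>
  obtain \<phi> where \<phi>: "\<phi> \<in> n_algebra_hom K n C lam ?S \<beta>"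
    using assms(4) \<beta> unfolding initial_n_algebra_def by blast
  obtain \<psi> where \<psi>: "\<psi> \<in> n_algebra_hom K n ?S \<beta> C lam"
    using grafting_hom_exists[OF K \<beta> grafting C] by blast
  note \<phi>' = \<phi>[unfolded n_algebra_hom_iff[OF C \<beta>]] and \<psi>' = \<psi>[unfolded n_algebra_hom_iff[OF \<beta> C]]
  have \<phi>\<psi>: "\<phi> (\<psi> s) = s" if "s \<in> carrier ?S" for s
    by (rule grafting_hom_unique[OF K \<beta> grafting \<beta> n_algebra_hom_comp[OF \<beta> C \<beta> \<psi> \<phi>]
          n_algebra_hom_id[OF \<beta>] that])
  have \<psi>\<phi>: "\<psi> (\<phi> c) = c" if c: "c \<in> carrier C" for c
  proof -
    \<comment> \<open>Here initiality of \<open>C\<close> is used at its own type: after restriction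
      the composite and the identity are extensional morphisms, hence equal.\<close>
    have "restrict h (carrier C) \<in> n_algebra_hom K n C lam C lam"
      if "h \<in> n_algebra_hom K n C lam C lam" for h
      by (rule n_algebra_hom_cong[OF C C that]) simp
    from this[OF n_algebra_hom_comp[OF C \<beta> C \<phi> \<psi>]] this[OF n_algebra_hom_id[OF C]]
    have "restrict (\<lambda>c. \<psi> (\<phi> c)) (carrier C) = restrict (\<lambda>c. c) (carrier C)"
      using assms(3) C unfolding initial_n_algebra_def by (blast intro: restrict_extensional)
    from fun_cong[OF this, of c] show ?thesis using c by simp
  qed
  have "bij_betw \<phi> (carrier C) (carrier ?S)"
    by (rule bij_betw_byWitness[where f' = \<psi>])
      (use \<phi>\<psi> \<psi>\<phi> \<phi>' \<psi>' in \<open>auto intro: algebra_hom_closed\<close>)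
  then have "\<phi> \<in> algebra_iso K C ?S" using \<phi>' by (simp add: algebra_iso_def)
  moreover have "takes_to_grafting K n C lam \<phi>"
    unfolding takes_to_grafting_def
  proof (intro allI impI)
    fix P a
    assume P: "coloured_tree_poset n P" and a: "a \<in> tuples n C"
      and eq: "\<forall>i\<in>{1..n}. \<phi> (a i) = branches K n P i"
    \<comment> \<open>\<phi> is a morphism into the grafting algebra, and the branches of
      \<open>P\<close> are forest monomials on which \<beta> is prescribed.\<close>
    have "\<phi> (lam (pure_tensor K n C a)) = \<beta> (pure_tensor K n ?S (\<lambda>i\<in>{1..n}. \<phi> (a i)))"
      using \<phi>' a by blast
    also have "(\<lambda>i\<in>{1..n}. \<phi> (a i)) =
        (\<lambda>i\<in>{1..n}. forest_monomial K n (tree_branches n (tree_class n P) i))"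
      by (rule restrict_ext)
        (simp only: eq branches_eq_forest_monomial[OF K P] tree_branches_class[OF P])
    also have "\<beta> (pure_tensor K n ?S \<dots>) = tree_gen K n P"
      unfolding tree_gen_def by (rule grafting[OF tree_class_in[OF P]])
    finally show "\<phi> (lam (pure_tensor K n C a)) = tree_gen K n P" .
  qed
  ultimately show ?thesis by blast
qed

end
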